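(* Let $\mu=\mathcal{GW}(\{q_k\},\lambda)$ be a Galton-Watson measure on $\mathcal{L}^{|}$ with $q_1=0$ and $\lambda>0$, with progeny generating function $Q$, and let $T$ be a random tree with distribution $\mu$. Let $H_1,H_2,\ldots$ be a sequence of hereditary properties with corresponding hereditary reductions $R_{H_1},R_{H_2},\ldots$, put $R^{(n)}=R_{H_n}\circ\cdots\circ R_{H_1}$, and suppose that $$\lim_{n\to\infty}\mathsf{P}\big(R^{(n)}(T)\ne\phi\big)=0,$$ with $\mathsf{P}\big(R^{(n)}(T)\ne\phi\big)>0$ for all $n$. (i) Suppose that $\mu$ is critical and that the limit $\lim_{x\to1-}\frac{Q(x)-x}{(1-x)(1-Q'(x))}$ exists. Then $$\lim_{n\to\infty}\mathsf{P}\big(\mathrm{shape}(R^{(n)}(T))=\tau\,\big|\,R^{(n)}(T)\ne\phi\big)=\mu^*(\tau)\qquad\text{for all }\tau\in\mathcal{T}^{|},$$ where $\mu^*$ is the invariant Galton-Watson measure $\mathcal{IGW}(q)$ with $q=\frac{1}{2-L}$ and $L=\lim_{x\to1-}\frac{\ln g(x)}{-\ln(1-x)}$. (ii) Suppose that $\mu$ is subcritical. Then the conditional distribution $\mathsf{P}\big(\mathrm{shape}(R^{(n)}(T))=\cdot\,\big|\,R^{(n)}(T)\ne\phi\big)$ converges, as $n\to\infty$, to the point mass measure $\mathcal{GW}(q_0=1)$.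
   Context: Trees. A rooted tree is reduced if it has no vertices of degree 2 except possibly the root, and planted if its root has degree one. $\mathcal{T}^{|}$ is the space of finite unlabeled rooted reduced planted trees without planar embedding, together with the empty tree $\phi$ (a root and no edges); $\mathcal{L}^{|}$ is the corresponding space of trees with positive edge lengths, regarded as metric spaces with the path metric. $\mathrm{shape}(T)$ is the combinatorial tree underlying a metric tree $T$ (non-root degree-two vertices are removed by merging adjacent edges). Galton-Watson measures. For a p.m.f. $\{q_k\}_{k\ge 0}$ with $q_1=0$ and $\sum_k kq_k\le1$, $\mathcal{GW}(\{q_k\})$ is the law on $\mathcal{T}^{|}$ of the tree of the Galton-Watson process started from a progenitor (the root) with exactly one offspring, after which each individual independently has $k$ offspring with probability $q_k$. It is critical if $\sum_k kq_k=1$ and subcritical if $\sum_k kq_k<1$. $\mathcal{GW}(\{q_k\},\lambda)$ is the law on $\mathcal{L}^{|}$ of a tree whose shape has law $\mathcal{GW}(\{q_k\})$ and whose edge lengths, conditioned on the shape, are i.i.d. exponential with parameter $\lambda$. $Q(z)=\sum_k q_kz^k$. For $q\in[1/2,1)$, $\mathcal{IGW}(q)$ is $\mathcal{GW}$ with progeny generating function $z+q(1-z)^{1/q}$; if $q=1$ occurs, the formula is read as the generating function $z+(1-z)=1$, i.e. $\mathcal{GW}(q_0=1)$. The function $g$ is $g(x)=\sum_{m=0}^\infty\sum_{k=m+1}^\infty(k-m-1)q_k\,x^m$, so that in the critical case $Q(x)-x=(1-x)^2g(x)$. In the critical case, when the limit $\lim_{x\to1-}\frac{Q(x)-x}{(1-x)(1-Q'(x))}$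 exists, the limit $L$ is known to exist. Hereditary reductions. Let $\mathbb{T}$ be the space of (isometry classes of) complete locally compact rooted real trees with the pointed Gromov-Hausdorff metric; it contains all trees of $\mathcal{L}^{|}$. For $T\in\mathbb{T}$ with root $\rho$ and $x\in T$, $\Delta_{x,T}$ is the descendant tree of $x$ (all points of $T$ descendant to $x$, including $x$, rooted at $x$), so $\Delta_{\rho,T}=T$. A hereditary property is a Borel subset $A\subset\mathbb{T}$ such that for every $T\in\mathbb{T}$ and $x\in T$, $\Delta_{x,T}\in A$ implies $T\in A$. The corresponding hereditary reduction is $R_A(T)=\{\rho\}\cup\{x\in T\setminus\rho:\Delta_{x,T}\in A\}$. *)

theory Defs
  imports "HOL-Probability.Probability" "HOL-Library.Sublist"
begin

section \<open>Rooted metric spaces and rooted real trees\<close>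

type_synonym 'a rooted = "'a metric \<times> 'a"

definition isometric_embedding :: "'a metric \<Rightarrow> 'b metric \<Rightarrow> ('a \<Rightarrow> 'b) \<Rightarrow> bool" where
  "isometric_embedding M M' f \<longleftrightarrow>
     f ` mspace M \<subseteq> mspace M' \<and>
     (\<forall>x\<in>mspace M. \<forall>y\<in>mspace M. mdist M' (f x) (f y) = mdist M x y)"

definition rooted_isometric :: "'a rooted \<Rightarrow> 'b rooted \<Rightarrow> bool" where
  "rooted_isometric X Y \<longleftrightarrow>
     (\<exists>f. isometric_embedding (fst X) (fst Y) f \<and> f ` mspace (fst X) = mspace (fst Y) \<and>
          f (snd X) = snd Y)"

definition geodesic_between :: "'a metric \<Rightarrow> 'a \<Rightarrow> 'a \<Rightarrow> (real \<Rightarrow> 'a) \<Rightarrow> bool" where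
  "geodesic_between M x y f \<longleftrightarrow>
     f ` {0..mdist M x y} \<subseteq> mspace M \<and>
     (\<forall>s\<in>{0..mdist M x y}. \<forall>t\<in>{0..mdist M x y}. mdist M (f s) (f t) = \<bar>s - t\<bar>) \<and>
     f 0 = x \<and> f (mdist M x y) = y"

definition real_tree :: "'a metric \<Rightarrow> bool" where
  "real_tree M \<longleftrightarrow> mspace M \<noteq> {} \<and>
     (\<forall>x\<in>mspace M. \<forall>y\<in>mspace M. \<exists>f. geodesic_between M x y f \<and>
        (\<forall>f'. geodesic_between M x y f' \<longrightarrow> (\<forall>s\<in>{0..mdist M x y}. f' s = f s)) \<and>
        (\<forall>g. continuous_map (top_of_set {0..1}) (mtopology_of M) g \<and>
             inj_on g {0..1::real} \<and> g 0 = x \<and> g 1 = y \<longrightarrow>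
             g ` {0..1} = f ` {0..mdist M x y}))"

text \<open>
  A complete locally compact real tree is separable, hence has at most continuum many points and
  an isometric copy carried by any type of the cardinality of the continuum.  The carrier type
  \<open>point\<close> is chosen because it labels the points of a finite metric tree directly: \<open>(u, s)\<close> is the
  point at height \<open>s\<close> on the edge leading to the vertex with Ulam-Harris label \<open>u\<close>.
  The set \<open>rooted_trees\<close> consists of representatives of isometry classes.
\<close>

type_synonym point = "nat list \<times> real"

definition rooted_trees :: "point rooted set" where
  "rooted_trees = {X. real_tree (fst X) \<and> mcomplete_of (fst X) \<and>
                      locally_compact_space (mtopology_of (fst X)) \<and> snd X \<in> mspace (fst X)}"


section \<open>The pointed Gromov-Hausdorff metric\<close>

definition hausdorff :: "'a metric \<Rightarrow> 'a set \<Rightarrow> 'a set \<Rightarrow> real" where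
  "hausdorff Z A B = Inf {r. 0 \<le> r \<and> (\<forall>a\<in>A. \<exists>b\<in>B. mdist Z a b \<le> r) \<and>
                                     (\<forall>b\<in>B. \<exists>a\<in>A. mdist Z a b \<le> r)}"

text \<open>
  For compact spaces: the infimum over isometric embeddings into a common metric space.
  The type \<open>'a + 'b\<close> is large enough to carry every space that matters, as the ambient space may be
  restricted to the union of the two images.
\<close>

definition gh_compact :: "'a rooted \<Rightarrow> 'b rooted \<Rightarrow> real" where
  "gh_compact X Y =
     Inf {max (hausdorff Z (f ` mspace (fst X)) (g ` mspace (fst Y))) (mdist Z (f (snd X)) (g (snd Y))) |
          (Z :: ('a + 'b) metric) f g.
          isometric_embedding (fst X) Z f \<and> isometric_embedding (fst Y) Z g}"

definition root_ball :: "'a rooted \<Rightarrow> real \<Rightarrow> 'a rooted" where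
  "root_ball X r = (submetric (fst X) (mcball_of (fst X) (snd X) r), snd X)"

text \<open>
  The summand is at most \<open>(k + 1) / 2 ^ (k + 1)\<close>, since two balls of radius \<open>k + 1\<close> may be
  glued at their roots.
\<close>

definition pointed_gh :: "'a rooted \<Rightarrow> 'b rooted \<Rightarrow> real" where
  "pointed_gh X Y =
     (\<Sum>k. gh_compact (root_ball X (real (k + 1))) (root_ball Y (real (k + 1))) / 2 ^ (k + 1))"

text \<open>
  On representatives \<open>pointed_gh\<close> is a pseudometric vanishing exactly on isometric pairs, so its
  open sets are unions of isometry classes, and so are the Borel sets they generate: these are
  the Borel subsets of the space of isometry classes.
\<close>

definition borel_trees :: "point rooted measure" where
  "borel_trees = sigma rooted_trees
     {U. U \<subseteq> rooted_trees \<and>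
         (\<forall>X\<in>U. \<exists>e>0. \<forall>Y\<in>rooted_trees. pointed_gh X Y < e \<longrightarrow> Y \<in> U)}"


section \<open>Hereditary properties and reductions\<close>

definition descendant_tree :: "'a rooted \<Rightarrow> 'a \<Rightarrow> 'a rooted" where
  "descendant_tree X x =
     (submetric (fst X)
        {y \<in> mspace (fst X). mdist (fst X) (snd X) y = mdist (fst X) (snd X) x + mdist (fst X) x y},
      x)"

definition hereditary :: "point rooted set \<Rightarrow> bool" where
  "hereditary A \<longleftrightarrow> A \<in> sets borel_trees \<and>
     (\<forall>X\<in>rooted_trees. \<forall>x\<in>mspace (fst X). descendant_tree X x \<in> A \<longrightarrow> X \<in> A)"

definition reduced_points :: "point rooted set \<Rightarrow> point rooted \<Rightarrow> point set" where
  "reduced_points A X =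
     {snd X} \<union> {x \<in> mspace (fst X) - {snd X}. descendant_tree X x \<in> A}"

text \<open>
  The subtree \<open>reduced_points A X\<close> may lack boundary points (for instance when \<open>A\<close> is the set of
  trees of height greater than a constant); as an element of the space of complete trees, so that
  reductions can be composed, it is represented by its closure, i.e. its completion.
\<close>

definition reduction :: "point rooted set \<Rightarrow> point rooted \<Rightarrow> point rooted" where
  "reduction A X =
     (submetric (fst X) (mtopology_of (fst X) closure_of reduced_points A X), snd X)"

text \<open>
  Reductions are indexed from 1: \<open>iterated_reduction H n\<close> applies \<open>H 1\<close> first and \<open>H n\<close> last.
\<close>

primrec iterated_reduction :: "(nat \<Rightarrow> point rooted set) \<Rightarrow> nat \<Rightarrow> point rooted \<Rightarrow> point rooted" where
  "iterated_reduction H 0 X = X"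
| "iterated_reduction H (Suc n) X = reduction (H (Suc n)) (iterated_reduction H n X)"

definition is_empty_tree :: "'a rooted \<Rightarrow> bool" where
  "is_empty_tree X \<longleftrightarrow> mspace (fst X) = {snd X}"


section \<open>Combinatorial and metric trees\<close>

text \<open>A vertex of a rooted tree is given by the multiset of the subtrees at its children.\<close>

datatype ctree = Node "ctree multiset"

text \<open>A vertex other than the root has degree two iff it has exactly one child.\<close>

inductive reduced :: "ctree \<Rightarrow> bool" where
  "(\<And>t. t \<in># ts \<Longrightarrow> reduced t) \<Longrightarrow> size ts \<noteq> 1 \<Longrightarrow> reduced (Node ts)"

definition planted_trees :: "ctree set" where
  "planted_trees = insert (Node {#}) {Node {#t#} | t. reduced t}"

text \<open>
  Ulam-Harris encoding of the genealogy: \<open>N u\<close> is the number of offspring of individual \<open>u\<close>,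
  whose children are \<open>u @ [i]\<close> for \<open>i < N u\<close>.  The label \<open>[]\<close> belongs to the single child of the
  root; the root itself carries no label.
\<close>

inductive_set family :: "(nat list \<Rightarrow> nat) \<Rightarrow> nat list set" for N where
  "[] \<in> family N"
| "u \<in> family N \<Longrightarrow> i < N u \<Longrightarrow> u @ [i] \<in> family N"

inductive genealogy :: "(nat list \<Rightarrow> nat) \<Rightarrow> nat list \<Rightarrow> ctree \<Rightarrow> bool" for N where
  "(\<And>i. i < N u \<Longrightarrow> genealogy N (u @ [i]) (ts i)) \<Longrightarrow>
   genealogy N u (Node (image_mset ts (mset_set {..<N u})))"

text \<open>
  The \<open>THE\<close> denotes the unique such tree whenever the family is finite; infinite families are
  assigned the empty tree.
\<close>

definition planted_tree :: "(nat list \<Rightarrow> nat) \<Rightarrow> ctree" where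
  "planted_tree N = (if finite (family N) then Node {#THE t. genealogy N [] t#} else Node {#})"

text \<open>
  The path from the root to \<open>(u, s)\<close> covers, of the edge leading to \<open>w\<close>, an initial piece of
  length \<open>covered l (u, s) w\<close>; the path between two points is the symmetric difference of their
  root paths.  The root is the point \<open>([], 0)\<close>.
\<close>

definition covered :: "(nat list \<Rightarrow> real) \<Rightarrow> point \<Rightarrow> nat list \<Rightarrow> real" where
  "covered l x w = (if w = fst x then snd x else if strict_prefix w (fst x) then l w else 0)"

definition path_dist :: "(nat list \<Rightarrow> real) \<Rightarrow> point \<Rightarrow> point \<Rightarrow> real" where
  "path_dist l x y =
     (\<Sum>w\<in>{w. prefix w (fst x) \<or> prefix w (fst y)}. \<bar>covered l x w - covered l y w\<bar>)"

definition metric_tree :: "(nat list \<Rightarrow> nat) \<Rightarrow> (nat list \<Rightarrow> real) \<Rightarrow> point rooted" where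
  "metric_tree N l =
     (metric (insert ([], 0) {(u, s). u \<in> family N \<and> 0 < s \<and> s \<le> l u}, path_dist l), ([], 0))"

definition empty_metric_tree :: "point rooted" where
  "empty_metric_tree = (metric ({([], 0)}, \<lambda>_ _. 0), ([], 0))"

definition has_shape :: "'a rooted \<Rightarrow> ctree \<Rightarrow> bool" where
  "has_shape X \<tau> \<longleftrightarrow> \<tau> \<in> planted_trees \<and>
     (\<tau> = Node {#} \<and> is_empty_tree X \<or>
      (\<exists>N l. finite (family N) \<and> (\<forall>u\<in>family N. 0 < l u) \<and> planted_tree N = \<tau> \<and>
             rooted_isometric X (metric_tree N l)))"

definition shape :: "'a rooted \<Rightarrow> ctree" where
  "shape X = (THE \<tau>. has_shape X \<tau>)"


section \<open>Galton-Watson measures\<close>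

definition mean_offspring :: "nat pmf \<Rightarrow> ennreal" where
  "mean_offspring q = (\<Sum>k. of_nat k * ennreal (pmf q k))"

definition critical :: "nat pmf \<Rightarrow> bool" where
  "critical q \<longleftrightarrow> mean_offspring q = 1"

definition subcritical :: "nat pmf \<Rightarrow> bool" where
  "subcritical q \<longleftrightarrow> mean_offspring q < 1"

definition pgf :: "nat pmf \<Rightarrow> real \<Rightarrow> real" where
  "pgf q z = (\<Sum>k. pmf q k * z ^ k)"

definition g_fun :: "nat pmf \<Rightarrow> real \<Rightarrow> real" where
  "g_fun q x = (\<Sum>m. (\<Sum>\<^sub>\<infinity>k\<in>{m+1..}. (real k - real m - 1) * pmf q k) * x ^ m)"

definition GW :: "nat pmf \<Rightarrow> ctree measure" where
  "GW q = distr (\<Pi>\<^sub>M u\<in>UNIV. measure_pmf q) (count_space UNIV) planted_tree"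

text \<open>For \<open>q = 1\<close> the generating function below is constantly 1 on the unit interval.\<close>

definition igw_offspring :: "real \<Rightarrow> nat pmf" where
  "igw_offspring q = (THE p. \<forall>z\<in>{0..1}. pgf p z = z + q * (1 - z) powr (1 / q))"

definition IGW :: "real \<Rightarrow> ctree measure" where
  "IGW q = GW (igw_offspring q)"

text \<open>
  The exponential distribution lives on the positive reals, so that all edge lengths are positive.
\<close>

definition exponential_law :: "real \<Rightarrow> real measure" where
  "exponential_law lam =
     restrict_space (density lborel (\<lambda>x. ennreal (exponential_density lam x))) {0<..}"

text \<open>
  The sample space of the Galton-Watson tree with edge lengths: independent offspring numbers and,
  independent of them, independent exponential lengths of the edges above the individuals.
\<close>

definition gw_space :: "nat pmf \<Rightarrow> real \<Rightarrow> (nat list \<Rightarrow> nat \<times> real) measure" where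
  "gw_space q lam = (\<Pi>\<^sub>M u\<in>UNIV. measure_pmf q \<Otimes>\<^sub>M exponential_law lam)"

definition random_tree :: "(nat list \<Rightarrow> nat \<times> real) \<Rightarrow> point rooted" where
  "random_tree \<omega> = (if finite (family (fst \<circ> \<omega>)) then metric_tree (fst \<circ> \<omega>) (snd \<circ> \<omega>)
                     else empty_metric_tree)"

end

theory Submission
  imports Defs
begin

text \<open>
  The law of the shape of a pruned tree depends on the pruning only through the survival probability
  \<open>p\<close>.  A point other than the root survives an iterated hereditary reduction according to its
  descendant tree alone, and survival is inherited by ancestors.  So if \<open>I\<close> is the set of
  branches at the top of the stem that have surviving points, then the tree survives whenever
  \<open>I\<close> is nonempty, and its shape is the shape of the surviving branch if \<open>I\<close> is a singleton and is
  obtained by grafting the shapes of the branches in \<open>I\<close> otherwise.  The branches are independent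
  copies of the tree, so conditionally on survival the shape is a Galton-Watson tree with progeny
  generating function \<open>z + (Q(1 - p + p z) - (1 - p + p z)) / (p (1 - Q'(1 - p)))\<close>; the weight of the
  event that the tree survives with empty \<open>I\<close> comes for free as \<open>p - 1 + Q(1 - p)\<close>.  As \<open>p\<close> tends
  to 0 this function tends to \<open>z + c (1 - z) powr (1 / c)\<close> in the critical case, because
  \<open>D(y) = Q(1 - y) - (1 - y)\<close> satisfies \<open>D(y) / (y D'(y)) \<rightarrow> c\<close> and is therefore regularly varying with
  exponent \<open>1 / c\<close>, and to 1 in the subcritical case.
\<close>

section \<open>Compact rooted real trees\<close>

text \<open>Two obstacles shape the proof. First, hereditary properties are Borel sets of isometry
  classes, while survival must be compared between a branch sitting in the whole tree and the same
  branch as a tree of its own. The root of the branch corresponds to the top of the edge below,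
  where the sibling branches start as well. Hence points are compared away from the roots only, and
  ancestors below the branch are handled by heredity. Second, \<open>reduction\<close> takes
  closures, so a surviving point need not have the property itself; prunings are therefore described
  by conditions on strict ancestors.

  Measurability of the survival event is not assumed. It follows from the positive survival
  probability, because \<open>measure\<close> is 0 on sets that are not measurable.

  Merging makes the law of the shape satisfy a linear equation: the part with exactly one surviving
  branch contributes \<open>Q'(1 - p)\<close> times the unknown itself, and solving for the unknown
  produces the denominator \<open>1 - Q'(1 - p)\<close>. Finally \<open>L = 2 - 1 / c\<close>, so
  the parameter \<open>1 / (2 - L)\<close> is the limit c of the overview.\<close>

definition gprod :: "'a metric \<Rightarrow> 'a \<Rightarrow> 'a \<Rightarrow> 'a \<Rightarrow> real" where
  "gprod M r x y = (mdist M r x + mdist M r y - mdist M x y) / 2"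

lemma mdist_self [simp]: "x \<in> mspace M \<Longrightarrow> mdist M x x = 0"
  by simp

lemma mdist_pos: "\<lbrakk>x \<in> mspace M; y \<in> mspace M; x \<noteq> y\<rbrakk> \<Longrightarrow> 0 < mdist M x y"
  using mdist_nonneg[of M x y] mdist_zero[of x M y] by linarith

text \<open>\<open>gprod M r x y\<close> is the Gromov product at r, in a tree the height at which
  the root paths of x and y separate. The locale asks only for 0-hyperbolicity at r and for segments
  to the root. Both are easy to check for metric trees and pass to descendant trees and prunings,
  whereas \<open>rooted_trees\<close> speaks of arbitrary arcs; the arc condition is derived
  once.\<close>

locale compact_tree =
  fixes M :: "'a metric" and r :: 'a
  assumes root_in [simp]: "r \<in> mspace M"
    and compact: "compact_space (mtopology_of M)"
    and hyperbolic: "\<lbrakk>x \<in> mspace M; y \<in> mspace M; z \<in> mspace M\<rbrakk> \<Longrightarrow>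
      min (gprod M r x y) (gprod M r y z) \<le> gprod M r x z"
    and ancestor_exists: "\<lbrakk>x \<in> mspace M; 0 \<le> t; t \<le> mdist M r x\<rbrakk> \<Longrightarrow>
      \<exists>y\<in>mspace M. mdist M r y = t \<and> mdist M y x = mdist M r x - t"
begin

text \<open>The three pairings of the four points have the same sum of heights, so the root cancels
  and the claim becomes \<open>min (G x z + G y w) (G x w + G y z) \<le> G x y + G z w\<close>, a
  consequence of the ultrametric inequality for the Gromov product \<open>G\<close>.\<close>

lemma four_point:
  assumes "x \<in> mspace M" "y \<in> mspace M" "z \<in> mspace M" "w \<in> mspace M"
  shows "mdist M x y + mdist M z w \<le> max (mdist M x z + mdist M y w) (mdist M x w + mdist M y z)"
proof -
  define G where "G = gprod M r"
  have d: "mdist M a b = mdist M r a + mdist M r b - 2 * G a b" for a b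
    unfolding G_def gprod_def by argo
  have s: "G a b = G b a" for a b by (simp add: G_def gprod_def mdist_commute)
  have h: "min (G a b) (G b c) \<le> G a c"
    if "a \<in> mspace M" "b \<in> mspace M" "c \<in> mspace M" for a b c
    using hyperbolic[OF that] by (simp add: G_def)
  have "min (G x z + G y w) (G x w + G y z) \<le> G x y + G z w"
    using h[of x z y] h[of x w y] h[of z x w] h[of z y w] h[of x y z] h[of x w z] h[of y x z]
      h[of x y w] h[of x z w] h[of y z w] h[of y x w] h[of y w z] assms
      s[of z x] s[of w x] s[of z y] s[of w y] s[of y x] s[of w z]
    by (smt (verit))
  then show ?thesis
    using d[of x y] d[of z w] d[of x z] d[of y w] d[of x w] d[of y z] by (smt (verit))
qed

text \<open>The segment from x to y runs down from x to the height of the meet and up again to y, so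
  the point at distance s from x is an ancestor of x in the first case and of y in the
  second.\<close>

lemma between_exists:
  assumes x: "x \<in> mspace M" and y: "y \<in> mspace M" and s: "0 \<le> s" "s \<le> mdist M x y"
  shows "\<exists>z\<in>mspace M. mdist M x z = s \<and> mdist M z y = mdist M x y - s"
proof (cases "mdist M r x - s \<ge> gprod M r x y")
  case True
  have "0 \<le> mdist M r x - s"
    using True x y mdist_triangle[of x M r y] mdist_triangle[of r M x y] mdist_triangle[of r M y x] mdist_commute[of M]
    by (simp add: gprod_def)
  then obtain z where z: "z \<in> mspace M" "mdist M r z = mdist M r x - s" "mdist M z x = s"
    using ancestor_exists[of x "mdist M r x - s"] x s by auto
  have "min (gprod M r z x) (gprod M r x y) \<le> gprod M r z y" using hyperbolic z x y by blast
  then have "gprod M r x y \<le> gprod M r z y" using z True by (simp add: gprod_def)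
  then have "mdist M z y \<le> mdist M x y - s" using z by (simp add: gprod_def)
  then show ?thesis using z mdist_triangle[of x M z y] x y mdist_commute[of M x z] by (intro bexI[of _ z]) auto
next
  case False
  define t where "t = mdist M r y - (mdist M x y - s)"
  have tm: "t \<ge> gprod M r x y" using False by (simp add: t_def gprod_def field_simps)
  have "0 \<le> gprod M r x y"
    using mdist_triangle[of x M r y] x y mdist_commute[of M] by (simp add: gprod_def)
  then have "0 \<le> t" using tm by simp
  then obtain z where z: "z \<in> mspace M" "mdist M r z = t" "mdist M z y = mdist M x y - s"
    using ancestor_exists[of y t] y s t_def by auto
  have "min (gprod M r z y) (gprod M r y x) \<le> gprod M r z x" using hyperbolic z x y by blast
  moreover have "gprod M r z y = t" using z by (simp add: gprod_def t_def)
  ultimately have "gprod M r x y \<le> gprod M r z x" using tm by (simp add: gprod_def mdist_commute)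
  then have "mdist M z x \<le> s" using z t_def by (simp add: gprod_def)
  then show ?thesis using z mdist_triangle[of x M z y] x y mdist_commute[of M x z] by (intro bexI[of _ z]) auto
qed

text \<open>The four-point condition for x, y, a, b reads
  \<open>d(x,y) + d(a,b) \<le> d(x,y) + |s - t|\<close>.\<close>

lemma between_unique:
  assumes "x \<in> mspace M" "y \<in> mspace M" "a \<in> mspace M" "b \<in> mspace M"
    and "mdist M x a = s" "mdist M a y = mdist M x y - s" "mdist M x b = t" "mdist M b y = mdist M x y - t"
  shows "mdist M a b = \<bar>s - t\<bar>"
proof -
  have "mdist M a b \<le> \<bar>s - t\<bar>"
    using four_point[of x y a b] assms mdist_commute[of M] by (smt (verit))
  moreover have "\<bar>s - t\<bar> \<le> mdist M a b"
    using mdist_triangle[of x M a b] mdist_triangle[of x M b a] assms mdist_commute[of M a b] by auto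
  ultimately show ?thesis by simp
qed

lemma geodesic_exists:
  assumes x: "x \<in> mspace M" and y: "y \<in> mspace M"
  shows "\<exists>f. geodesic_between M x y f"
proof -
  have "\<forall>s\<in>{0..mdist M x y}. \<exists>z. z \<in> mspace M \<and> mdist M x z = s \<and> mdist M z y = mdist M x y - s"
    using between_exists[OF x y] by (metis atLeastAtMost_iff)
  then obtain f where f: "\<And>s. s \<in> {0..mdist M x y} \<Longrightarrow>
      f s \<in> mspace M \<and> mdist M x (f s) = s \<and> mdist M (f s) y = mdist M x y - s"
    by metis
  have 0: "f 0 = x"
    using f[of 0] x mdist_nonneg[of M x y] mdist_zero[of x M "f 0"] by auto
  have 1: "f (mdist M x y) = y"
    using f[of "mdist M x y"] y mdist_nonneg[of M x y] mdist_zero[of "f (mdist M x y)" M y] by auto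
  have "geodesic_between M x y f"
    unfolding geodesic_between_def using f 0 1 between_unique[OF x y] by blast
  then show ?thesis by (intro exI[of _ f])
qed

lemma geodesic_between_point:
  assumes "geodesic_between M x y f" "s \<in> {0..mdist M x y}"
  shows "f s \<in> mspace M" "mdist M x (f s) = s" "mdist M (f s) y = mdist M x y - s"
proof -
  have 0: "0 \<in> {0..mdist M x y}" and 1: "mdist M x y \<in> {0..mdist M x y}" by auto
  show "f s \<in> mspace M" using assms by (auto simp: geodesic_between_def)
  show "mdist M x (f s) = s" "mdist M (f s) y = mdist M x y - s"
    using assms 0 1 unfolding geodesic_between_def
    by (metis abs_of_nonneg atLeastAtMost_iff diff_0 abs_minus_cancel,
        metis abs_of_nonneg abs_minus_commute atLeastAtMost_iff diff_ge_0_iff_ge)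
qed

lemma geodesic_image:
  assumes x: "x \<in> mspace M" and y: "y \<in> mspace M" and f: "geodesic_between M x y f"
  shows "f ` {0..mdist M x y} = {z \<in> mspace M. mdist M x z + mdist M z y = mdist M x y}"
proof (intro equalityI subsetI)
  fix z assume "z \<in> f ` {0..mdist M x y}"
  then show "z \<in> {z \<in> mspace M. mdist M x z + mdist M z y = mdist M x y}"
    using geodesic_between_point[OF f] by auto
next
  fix z assume z: "z \<in> {z \<in> mspace M. mdist M x z + mdist M z y = mdist M x y}"
  define s where "s = mdist M x z"
  have s: "s \<in> {0..mdist M x y}" using z mdist_nonneg[of M z y] mdist_nonneg[of M x z] unfolding s_def by (simp del: mdist_nonneg)
  have "mdist M z (f s) = \<bar>s - s\<bar>"
    using z geodesic_between_point[OF f s] x y by (intro between_unique[OF x y]) (auto simp: s_def)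
  then have "z = f s" using z geodesic_between_point[OF f s] by auto
  then show "z \<in> f ` {0..mdist M x y}" using s by auto
qed

text \<open>
  The set of times \<open>t\<close> at which \<open>z\<close> separates \<open>g t\<close> from the starting point is open and closed
  along a path that avoids \<open>z\<close>.
\<close>

lemma path_through_between:
  fixes g :: "real \<Rightarrow> 'a"
  assumes g: "continuous_map (top_of_set {\<alpha>..\<beta>}) (mtopology_of M) g" and ab: "\<alpha> \<le> \<beta>"
    and z: "z \<in> mspace M" "mdist M (g \<alpha>) z + mdist M z (g \<beta>) = mdist M (g \<alpha>) (g \<beta>)"
  shows "z \<in> g ` {\<alpha>..\<beta>}"
proof (rule ccontr)
  assume nz: "z \<notin> g ` {\<alpha>..\<beta>}"
  have gM: "g t \<in> mspace M" if "t \<in> {\<alpha>..\<beta>}" for t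
    using continuous_map_funspace[OF g] that by auto
  define sep where "sep = (\<lambda>t. mdist M (g \<alpha>) z + mdist M z (g t) = mdist M (g \<alpha>) (g t))"
  have step: "sep t'" if "t \<in> {\<alpha>..\<beta>}" "t' \<in> {\<alpha>..\<beta>}" "sep t" "mdist M (g t) (g t') < mdist M (g t) z" for t t'
    using four_point[of "g \<alpha>" "g t" z "g t'"] mdist_triangle[of "g \<alpha>" M z "g t'"] that gM[of t] gM[of t'] gM[of \<alpha>] z ab
      mdist_commute[of M z] mdist_nonneg[of M z "g t'"]
    unfolding sep_def by (smt (verit) atLeastAtMost_iff)
  \<comment> \<open>From \<beta> down to \<alpha>, \<open>sep\<close> persists along the connected
    interval; at \<alpha> it says that z is \<open>g \<alpha>\<close>, which is excluded.\<close>
  have "sep \<alpha>"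
  proof (rule connected_induction_simple[of "{\<alpha>..\<beta>}" \<beta> \<alpha> sep])
    show "sep \<beta>" using z by (simp add: sep_def)
    fix t assume t: "t \<in> {\<alpha>..\<beta>}"
    \<comment> \<open>A third of the distance to z: two points of this ball are less than
      \<open>2 * e\<close> apart and both are more than \<open>2 * e\<close> away from z, as
      \<open>step\<close> demands.\<close>
    define e where "e = mdist M (g t) z / 3"
    have e: "e > 0" using nz t gM[OF t] z mdist_nonneg[of M "g t" z] mdist_zero[of "g t" M z]
      by (auto simp: e_def less_le)
    define T where "T = {t'\<in>{\<alpha>..\<beta>}. g t' \<in> mball_of M (g t) e}"
    have "openin (mtopology_of M) (mball_of M (g t) e)"
      by (simp add: Metric_space.openin_mball mball_of_def mtopology_of_def)
    then have "openin (top_of_set {\<alpha>..\<beta>}) T"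
      using openin_continuous_map_preimage[OF g, of "mball_of M (g t) e"] by (simp add: T_def del: in_mball_of)
    moreover have "t \<in> T" using e t gM[OF t] mdist_zero[of "g t" M "g t"] by (simp add: T_def del: mdist_zero)
    moreover have "sep b" if "a \<in> T" "b \<in> T" "sep a" for a b
    proof (rule step[of a b])
      have m: "g a \<in> mspace M" "g b \<in> mspace M" "mdist M (g t) (g a) < e" "mdist M (g t) (g b) < e"
        using that by (auto simp: T_def)
      have "mdist M (g a) (g b) < 2 * e"
        using m mdist_triangle[of "g a" M "g t" "g b"] gM[OF t] mdist_commute[of M "g a" "g t"] by linarith
      moreover have "mdist M (g a) z > 2 * e"
        using m mdist_triangle[of "g t" M "g a" z] gM[OF t] z e_def by linarith
      ultimately show "mdist M (g a) (g b) < mdist M (g a) z" by simp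
    qed (use that in \<open>auto simp: T_def\<close>)
    ultimately show "\<exists>T. openin (top_of_set {\<alpha>..\<beta>}) T \<and> t \<in> T \<and> (\<forall>a\<in>T. \<forall>b\<in>T. sep a \<longrightarrow> sep b)"
      by blast
  qed (use ab in auto)
  moreover have "g \<alpha> \<in> mspace M" using gM ab by auto
  ultimately have "mdist M (g \<alpha>) z = 0"
    using mdist_commute[of M "g \<alpha>" z] mdist_self[of "g \<alpha>" M] by (simp add: sep_def)
  then show False using nz ab gM[of \<alpha>] z by auto
qed

text \<open>An arc from x to y contains the segment by \<open>path_through_between\<close>.
  Conversely, a point visited by the arc at time t has a projection z to the segment; the arc passes
  through z both no later and no earlier than t, so injectivity makes the point equal to z.\<close>

lemma real_tree: "real_tree M"
proof -
  have path: "g ` {0..1} = f ` {0..mdist M x y}"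
    if x: "x \<in> mspace M" and y: "y \<in> mspace M" and f: "geodesic_between M x y f"
      and g: "continuous_map (top_of_set {0..1}) (mtopology_of M) g" "inj_on g {0..1::real}" "g 0 = x" "g 1 = y"
    for x y f g
  proof
    show "f ` {0..mdist M x y} \<subseteq> g ` {0..1}"
      unfolding geodesic_image[OF x y f] using path_through_between[OF g(1)] g by auto
    show "g ` {0..1} \<subseteq> f ` {0..mdist M x y}"
    proof
      fix a assume "a \<in> g ` {0..1}"
      then obtain t where t: "t \<in> {0..1}" "a = g t" by auto
      have a: "a \<in> mspace M" using continuous_map_funspace[OF g(1)] t by auto
      \<comment> \<open>The Gromov product of a and y at x, that is, the distance from x to the
        projection of a to the segment.\<close>
      define s where "s = (mdist M x a + mdist M x y - mdist M a y) / 2"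
      have s: "0 \<le> s" "s \<le> mdist M x y"
        using mdist_triangle[of a M x y] mdist_triangle[of x M y a] a x y mdist_commute[of M] unfolding s_def by auto
      obtain z where z: "z \<in> mspace M" "mdist M x z = s" "mdist M z y = mdist M x y - s"
        using between_exists[OF x y s] by auto
      have "mdist M x y + mdist M a z \<le> max (mdist M x a + mdist M y z) (mdist M x z + mdist M y a)"
        using four_point x y a z by blast
      then have za: "mdist M a z \<le> mdist M x a - s" "mdist M a z \<le> mdist M a y - (mdist M x y - s)"
        using z mdist_commute[of M] unfolding s_def by (simp_all add: field_simps)
      have "mdist M (g 0) z + mdist M z (g t) = mdist M (g 0) (g t)"
        using za z t g mdist_triangle[of x M z a] x a mdist_commute[of M a z] by auto
      then have "z \<in> g ` {0..t}"
        using path_through_between[of 0 t g z] z t continuous_map_from_subtopology_mono[OF g(1), of "{0..t}"] by auto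
      moreover have "mdist M (g t) z + mdist M z (g 1) = mdist M (g t) (g 1)"
        using za z t g mdist_triangle[of a M z y] y a mdist_commute[of M a z] by auto
      then have "z \<in> g ` {t..1}"
        using path_through_between[of t 1 g z] z t continuous_map_from_subtopology_mono[OF g(1), of "{t..1}"] by auto
      ultimately obtain t1 t2 where "t1 \<in> {0..t}" "t2 \<in> {t..1}" "g t1 = z" "g t2 = z" by auto
      then have "t1 = t" using inj_onD[OF g(2), of t1 t2] t by auto
      then have "z = a" using \<open>g t1 = z\<close> t by simp
      then show "a \<in> f ` {0..mdist M x y}"
        unfolding geodesic_image[OF x y f] using z by simp
    qed
  qed
  have unique: "f' s = f s" if "x \<in> mspace M" "y \<in> mspace M" "geodesic_between M x y f" "geodesic_between M x y f'" "s \<in> {0..mdist M x y}" for x y f f' s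
  proof -
    have "mdist M (f' s) (f s) = \<bar>s - s\<bar>"
      using that geodesic_between_point by (intro between_unique[of x y]) auto
    then show ?thesis using geodesic_between_point that by auto
  qed
  have ne: "mspace M \<noteq> {}" using root_in by blast
  show ?thesis
    unfolding real_tree_def
    using geodesic_exists unique path ne by (intro conjI ballI) (assumption, metis)
qed

end

lemma compact_tree_in_rooted_trees:
  fixes M :: "point metric"
  assumes "compact_tree M r"
  shows "(M, r) \<in> rooted_trees"
proof -
  interpret compact_tree M r by fact
  interpret Metric_space "mspace M" "mdist M" by simp
  show ?thesis
    using real_tree compact compact_space_imp_mcomplete compact_imp_locally_compact_space
    by (simp add: rooted_trees_def mtopology_of_def mcomplete_of_def)
qed

section \<open>Descendant trees and hereditary reductions\<close>

definition desc :: "'a metric \<Rightarrow> 'a \<Rightarrow> 'a \<Rightarrow> 'a set" where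
  "desc M r x = {y \<in> mspace M. mdist M r y = mdist M r x + mdist M x y}"

lemma descendant_tree_eq: "descendant_tree (M, r) x = (submetric M (desc M r x), x)"
  by (simp add: descendant_tree_def desc_def)

lemma desc_submetric: "desc (submetric M K) r x = K \<inter> desc M r x"
  by (auto simp: desc_def)

context compact_tree begin

lemma desc_in: "y \<in> desc M r x \<Longrightarrow> y \<in> mspace M"
  by (simp add: desc_def)

lemma desc_refl: "x \<in> mspace M \<Longrightarrow> x \<in> desc M r x"
  by (simp add: desc_def)

lemma desc_root: "x \<in> mspace M \<Longrightarrow> x \<in> desc M r r"
  by (simp add: desc_def)

lemma desc_trans:
  "\<lbrakk>x \<in> mspace M; y \<in> mspace M; y \<in> desc M r x; z \<in> desc M r y\<rbrakk> \<Longrightarrow> z \<in> desc M r x"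
  using mdist_triangle[of x M y z] mdist_triangle[of r M x z] by (simp add: desc_def)

lemma desc_antisym:
  "\<lbrakk>x \<in> mspace M; y \<in> mspace M; y \<in> desc M r x; x \<in> desc M r y\<rbrakk> \<Longrightarrow> x = y"
  using mdist_commute[of M x y] by (simp add: desc_def)

lemma desc_not_root: "\<lbrakk>x \<in> mspace M; y \<in> desc M r x; x \<noteq> r\<rbrakk> \<Longrightarrow> y \<noteq> r"
  using desc_antisym desc_root by auto

lemma desc_height_less:
  "\<lbrakk>x \<in> mspace M; y \<in> desc M r x; x \<noteq> y\<rbrakk> \<Longrightarrow> mdist M r x < mdist M r y"
  using mdist_nonneg[of M x y] mdist_zero[of x M y] by (simp add: desc_def less_le)

text \<open>The products of x and y with z are their own heights, so hyperbolicity puts the meet of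
  x and y at least at the height of x: the ancestors of a point form a chain.\<close>

lemma desc_linear:
  assumes "x \<in> mspace M" "y \<in> mspace M" "z \<in> desc M r x" "z \<in> desc M r y" "mdist M r x \<le> mdist M r y"
  shows "y \<in> desc M r x"
proof -
  have z: "z \<in> mspace M" using assms desc_in by auto
  have "min (gprod M r x z) (gprod M r z y) \<le> gprod M r x y" using hyperbolic assms z by blast
  moreover have "gprod M r x z = mdist M r x" "gprod M r z y = mdist M r y"
    using assms mdist_commute[of M z y] by (auto simp: gprod_def desc_def)
  ultimately have "mdist M r x \<le> gprod M r x y" using assms by simp
  then have "mdist M r x + mdist M x y \<le> mdist M r y" by (simp add: gprod_def)
  then show ?thesis using mdist_triangle[of r M x y] assms by (simp add: desc_def)
qed

text \<open>The root paths of w and y agree up to height \<open>mdist M r w - mdist M w y\<close>,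
  which is not below x. This local constancy of ancestry controls the closure in
  \<open>reduction\<close>.\<close>

lemma desc_neighbourhood:
  assumes "x \<in> mspace M" "y \<in> mspace M" "w \<in> desc M r x" "mdist M w y \<le> mdist M r w - mdist M r x"
  shows "y \<in> desc M r x"
proof -
  have w: "w \<in> mspace M" using assms desc_in by auto
  have "min (gprod M r x w) (gprod M r w y) \<le> gprod M r x y" using hyperbolic assms w by blast
  moreover have "gprod M r x w = mdist M r x" using assms by (auto simp: gprod_def desc_def)
  moreover have "gprod M r w y \<ge> mdist M r x"
    using assms mdist_triangle[of r M y w] w mdist_commute[of M y w] by (simp add: gprod_def)
  ultimately have "mdist M r x \<le> gprod M r x y" by simp
  then have "mdist M r x + mdist M x y \<le> mdist M r y" by (simp add: gprod_def)
  then show ?thesis using mdist_triangle[of r M x y] assms by (simp add: desc_def)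
qed

lemma ancestor_at_height:
  assumes "x \<in> mspace M" "0 \<le> t" "t \<le> mdist M r x"
  obtains y where "y \<in> mspace M" "mdist M r y = t" "x \<in> desc M r y"
  using ancestor_exists[OF assms] assms by (auto simp: desc_def)

lemma ancestor_between:
  assumes "z \<in> mspace M" "x \<in> desc M r z" "mdist M r z \<le> t" "t \<le> mdist M r x"
  obtains y where "y \<in> desc M r z" "mdist M r y = t" "x \<in> desc M r y"
proof -
  have x: "x \<in> mspace M" using assms desc_in by auto
  obtain y where y: "y \<in> mspace M" "mdist M r y = t" "x \<in> desc M r y"
    using ancestor_at_height[OF x, of t] assms mdist_nonneg[of M r z] by auto
  have "y \<in> desc M r z" using desc_linear[of z y x] y assms by auto
  then show ?thesis using y that by auto
qed

lemma strict_ancestor_between: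
  assumes "z \<in> mspace M" "x \<in> desc M r z" "x \<noteq> z"
  obtains y where "y \<in> desc M r z" "x \<in> desc M r y" "y \<noteq> z" "y \<noteq> x"
proof -
  have "mdist M r z < mdist M r x" using desc_height_less assms by auto
  then obtain y where y: "y \<in> desc M r z" "mdist M r y = (mdist M r z + mdist M r x) / 2" "x \<in> desc M r y"
    using ancestor_between[OF assms(1,2), of "(mdist M r z + mdist M r x) / 2"] by auto
  then have "mdist M r y \<noteq> mdist M r z" "mdist M r y \<noteq> mdist M r x" using \<open>mdist M r z < mdist M r x\<close> by auto
  then show ?thesis using that[of y] y by blast
qed

lemma desc_of_desc:
  assumes "x \<in> mspace M" "y \<in> desc M r x"
  shows "desc (submetric M (desc M r x)) x y = desc M r y"
proof -
  have y: "y \<in> mspace M" using assms desc_in by auto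
  show ?thesis
  proof (intro equalityI subsetI)
    fix z assume "z \<in> desc (submetric M (desc M r x)) x y"
    then show "z \<in> desc M r y" using assms by (simp add: desc_def)
  next
    fix z assume z: "z \<in> desc M r y"
    then have "z \<in> desc M r x" using desc_trans[OF assms(1) y assms(2)] by simp
    then show "z \<in> desc (submetric M (desc M r x)) x y" using z assms by (simp add: desc_def)
  qed
qed

lemma descendant_tree_descendant_tree:
  assumes "x \<in> mspace M" "y \<in> desc M r x"
  shows "descendant_tree (submetric M (desc M r x), x) y = descendant_tree (M, r) y"
proof -
  have y: "y \<in> mspace M" using assms desc_in by auto
  have "desc M r y \<subseteq> desc M r x" using desc_trans[OF assms(1) y assms(2)] by auto
  then show ?thesis
    unfolding descendant_tree_eq desc_of_desc[OF assms] by (simp add: Int_absorb1)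
qed

lemma closedin_desc:
  assumes "x \<in> mspace M"
  shows "closedin (mtopology_of M) (desc M r x)"
proof -
  have c: "continuous_map (mtopology_of M) euclidean (\<lambda>y. mdist M r y - mdist M x y)"
    by (intro continuous_intros) (auto simp: assms)
  have "desc M r x = {y \<in> topspace (mtopology_of M). mdist M r y - mdist M x y \<in> {mdist M r x}}"
    by (auto simp: desc_def)
  then show ?thesis
    using closedin_continuous_map_preimage[OF c, of "{mdist M r x}"] by simp
qed

lemma compact_space_submetric:
  assumes "closedin (mtopology_of M) K"
  shows "compact_space (mtopology_of (submetric M K))"
  using closedin_compact_space[OF compact assms]
  by (simp add: mtopology_of_submetric compactin_subspace)

text \<open>For descendants of x, changing the base point from r to x lowers every Gromov product by
  the height of x, which respects hyperbolicity.\<close>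

lemma compact_tree_descendant:
  assumes x: "x \<in> mspace M"
  shows "compact_tree (submetric M (desc M r x)) x"
proof
  let ?N = "submetric M (desc M r x)"
  show "x \<in> mspace ?N" using x desc_refl by auto
  show "compact_space (mtopology_of ?N)" using compact_space_submetric closedin_desc x by blast
  fix y assume y: "y \<in> mspace ?N"
  have gp: "gprod ?N x u v = gprod M r u v - mdist M r x"
    if "u \<in> desc M r x" "v \<in> desc M r x" for u v
    using that by (simp add: gprod_def desc_def field_simps)
  show "min (gprod ?N x y z) (gprod ?N x z w) \<le> gprod ?N x y w"
    if "z \<in> mspace ?N" "w \<in> mspace ?N" for z w
    using y that gp[of y z] gp[of z w] gp[of y w] hyperbolic[of y z w] by auto
  show "\<exists>z\<in>mspace ?N. mdist ?N x z = t \<and> mdist ?N z y = mdist ?N x y - t"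
    if t: "0 \<le> t" "t \<le> mdist ?N x y" for t
  proof -
    have "y \<in> desc M r x" using y by simp
    then obtain z where z: "z \<in> desc M r x" "mdist M r z = mdist M r x + t" "y \<in> desc M r z"
      using ancestor_between[of x y "mdist M r x + t"] x t by (auto simp: desc_def)
    then show ?thesis using y by (intro bexI[of _ z]) (auto simp: desc_def)
  qed
qed

lemma compact_tree_subtree:
  assumes "r \<in> K" "closedin (mtopology_of M) K"
    and "\<And>x z. \<lbrakk>x \<in> K; z \<in> mspace M; x \<in> desc M r z\<rbrakk> \<Longrightarrow> z \<in> K"
  shows "compact_tree (submetric M K) r"
proof
  let ?N = "submetric M K"
  show "r \<in> mspace ?N" using assms by auto
  show "compact_space (mtopology_of ?N)" using compact_space_submetric assms by blast
  fix y assume y: "y \<in> mspace ?N"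
  show "min (gprod ?N r y z) (gprod ?N r z w) \<le> gprod ?N r y w"
    if "z \<in> mspace ?N" "w \<in> mspace ?N" for z w
    using y that hyperbolic[of y z w] by (auto simp: gprod_def)
  show "\<exists>z\<in>mspace ?N. mdist ?N r z = t \<and> mdist ?N z y = mdist ?N r y - t"
    if t: "0 \<le> t" "t \<le> mdist ?N r y" for t
  proof -
    obtain z where z: "z \<in> mspace M" "mdist M r z = t" "y \<in> desc M r z"
      using ancestor_at_height[of y t] y t by auto
    then show ?thesis using y assms(3)[of y z] by (intro bexI[of _ z]) (auto simp: desc_def)
  qed
qed

end

text \<open>The closure of the reduced points in terms of ancestry. The property is asked at strict
  ancestors of x but not at x itself, because the upper end of a surviving segment may lack
  it.\<close>

definition stable_points :: "point rooted set \<Rightarrow> point metric \<Rightarrow> point \<Rightarrow> point set" where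
  "stable_points A M r =
     {x \<in> mspace M. \<forall>z\<in>mspace M. z \<noteq> r \<longrightarrow> z \<noteq> x \<longrightarrow> x \<in> desc M r z \<longrightarrow> descendant_tree (M, r) z \<in> A}"

text \<open>\<open>hereditary\<close> compares a point with the root only. It is applied to the
  descendant tree of x, whose descendant tree at y is the same as in the whole tree.\<close>

lemma hereditary_descendant:
  fixes M :: "point metric"
  assumes "compact_tree M r" "hereditary A" "x \<in> mspace M" "y \<in> desc M r x"
    and "descendant_tree (M, r) y \<in> A"
  shows "descendant_tree (M, r) x \<in> A"
proof -
  interpret compact_tree M r by fact
  have 1: "(submetric M (desc M r x), x) \<in> rooted_trees"
    using compact_tree_in_rooted_trees compact_tree_descendant assms by blast
  have 2: "y \<in> mspace (submetric M (desc M r x))" using assms desc_in by auto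
  have "descendant_tree (submetric M (desc M r x), x) y \<in> A"
    using descendant_tree_descendant_tree assms by simp
  then show ?thesis
    using 1 2 assms(2) unfolding hereditary_def descendant_tree_eq[of M r x] by auto
qed

text \<open>
  Taking the closure adds no conditions on ancestors, since nearby points have the same ancestors up
  to a slightly lower height.
\<close>

lemma reduction_eq_stable_points:
  fixes M :: "point metric"
  assumes "compact_tree M r" "hereditary A"
  shows "reduction A (M, r) = (submetric M (stable_points A M r), r)"
    and "closedin (mtopology_of M) (stable_points A M r)"
proof -
  interpret compact_tree M r by fact
  define K where "K = reduced_points A (M, r)"
  have K: "x \<in> K \<longleftrightarrow> x = r \<or> x \<in> mspace M \<and> descendant_tree (M, r) x \<in> A" for x
    by (auto simp: K_def reduced_points_def)
  have cl: "mtopology_of M closure_of K = {x \<in> mspace M. \<forall>e>0. \<exists>y\<in>K. y \<in> mspace M \<and> mdist M x y < e}"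
  proof -
    have "mtopology_of M closure_of K = {x \<in> mspace M. \<forall>e>0. \<exists>y\<in>K. y \<in> mball_of M x e}"
      unfolding mtopology_of_def mball_of_def by (rule Metric_space.metric_closure_of) simp
    then show ?thesis by (simp cong: conj_cong)
  qed
  have eq: "mtopology_of M closure_of K = stable_points A M r"
  proof (intro equalityI subsetI)
    fix x assume x: "x \<in> mtopology_of M closure_of K"
    then have xM: "x \<in> mspace M" and near: "\<And>e. e > 0 \<Longrightarrow> \<exists>y\<in>K. y \<in> mspace M \<and> mdist M x y < e"
      unfolding cl by blast+
    have "descendant_tree (M, r) z \<in> A"
      if z: "z \<in> mspace M" "z \<noteq> r" "z \<noteq> x" "x \<in> desc M r z" for z
    proof -
      have "mdist M r z < mdist M r x" using desc_height_less z by auto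
      then obtain y where y: "y \<in> K" "y \<in> mspace M" "mdist M x y < mdist M r x - mdist M r z"
        using near[of "mdist M r x - mdist M r z"] by auto
      have yz: "y \<in> desc M r z" using desc_neighbourhood[of z y x] z y by auto
      then have "y \<noteq> r" using desc_not_root z by auto
      then have "descendant_tree (M, r) y \<in> A" using y K by auto
      then show ?thesis using hereditary_descendant assms z yz by blast
    qed
    then show "x \<in> stable_points A M r" using xM by (simp add: stable_points_def)
  next
    fix x assume x: "x \<in> stable_points A M r"
    then have xM: "x \<in> mspace M" by (simp add: stable_points_def)
    have "\<exists>y\<in>K. y \<in> mspace M \<and> mdist M x y < e" if e: "e > 0" for e
    proof (cases "x = r")
      case True
      then show ?thesis using K[of r] e by (intro bexI[of _ r]) simp_all
    next
      case False
      then have h: "mdist M r x > 0" using xM mdist_pos[of r M x] by simp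
      \<comment> \<open>The ancestor has to differ from both the root and x and to be closer to x
        than e: at most \<open>e / 2\<close> below x, but not lower than half the height of
        x.\<close>
      define t where "t = max (mdist M r x - e / 2) (mdist M r x / 2)"
      have t: "0 < t" "t < mdist M r x" "mdist M r x - t < e" using h e unfolding t_def by linarith+
      obtain y where y: "y \<in> mspace M" "mdist M r y = t" "x \<in> desc M r y"
        using ancestor_at_height[OF xM, of t] t by auto
      have "y \<noteq> r" "y \<noteq> x" using y t by auto
      then have "y \<in> K" using x y K[of y] by (simp add: stable_points_def)
      moreover have "mdist M x y < e" using y t by (simp add: desc_def mdist_commute)
      ultimately show ?thesis using y by blast
    qed
    then show "x \<in> mtopology_of M closure_of K" using xM unfolding cl by blast
  qed
  show "reduction A (M, r) = (submetric M (stable_points A M r), r)"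
    using eq by (simp add: reduction_def K_def)
  show "closedin (mtopology_of M) (stable_points A M r)"
    using eq by (metis closedin_closure_of)
qed

text \<open>
  \<open>is_pruning M r K\<close> records the properties of the points \<open>K\<close> surviving an iterated reduction; the
  last clause says that \<open>K\<close> contains the upper end of every root segment whose interior it contains.
\<close>

definition is_pruning :: "point metric \<Rightarrow> point \<Rightarrow> point set \<Rightarrow> bool" where
  "is_pruning M r K \<longleftrightarrow> K \<subseteq> mspace M \<and> r \<in> K \<and> compact_tree (submetric M K) r \<and>
     (\<forall>x\<in>K. \<forall>z\<in>mspace M. x \<in> desc M r z \<longrightarrow> z \<in> K) \<and>
     (\<forall>x\<in>mspace M. (\<forall>z\<in>mspace M. z \<noteq> r \<longrightarrow> z \<noteq> x \<longrightarrow> x \<in> desc M r z \<longrightarrow> z \<in> K) \<longrightarrow> x \<in> K)"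

lemma is_pruning_subset: "is_pruning M r K \<Longrightarrow> K \<subseteq> mspace M" and is_pruning_root: "is_pruning M r K \<Longrightarrow> r \<in> K"
  unfolding is_pruning_def by blast+

lemma stable_points_pruning:
  fixes M :: "point metric"
  assumes M: "compact_tree M r" and A: "hereditary A" and K: "is_pruning M r K"
  defines "N \<equiv> submetric M K"
  shows "is_pruning M r (stable_points A N r)" "reduction A (N, r) = (submetric M (stable_points A N r), r)"
proof -
  interpret compact_tree M r by fact
  interpret N: compact_tree N r using K by (simp add: is_pruning_def N_def)
  have [simp]: "mspace N = K" "mdist N = mdist M" using K by (auto simp: N_def is_pruning_def)
  have dN: "desc N r x = K \<inter> desc M r x" for x by (simp add: N_def desc_submetric)
  let ?S = "stable_points A N r"
  have SK: "?S \<subseteq> K" by (auto simp: stable_points_def)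
  have red: "reduction A (N, r) = (submetric N ?S, r)" "closedin (mtopology_of N) ?S"
    using reduction_eq_stable_points[OF N.compact_tree_axioms A] by auto
  have SS: "submetric N ?S = submetric M ?S"
    using SK by (simp add: N_def Int_absorb1)
  then show "reduction A (N, r) = (submetric M ?S, r)" using red by simp
  have rS: "r \<in> ?S"
    using N.desc_not_root N.root_in unfolding stable_points_def by blast
  have down: "z \<in> ?S" if x: "x \<in> ?S" "z \<in> mspace M" "x \<in> desc M r z" for x z
  proof -
    have z: "z \<in> K" using x SK K unfolding is_pruning_def by blast
    have "descendant_tree (N, r) w \<in> A" if w: "w \<in> K" "w \<noteq> r" "w \<noteq> z" "z \<in> desc N r w" for w
    proof -
      have wM: "w \<in> mspace M" using w K by (auto simp: is_pruning_def)
      have "x \<in> desc M r w" using desc_trans[of w z x] w wM x dN by auto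
      moreover have "w \<noteq> x" using desc_antisym[of w z] w wM x dN by auto
      ultimately show ?thesis using x SK w by (auto simp: stable_points_def dN)
    qed
    then show ?thesis using z by (auto simp: stable_points_def)
  qed
  have lim: "x \<in> ?S" if x: "x \<in> mspace M"
    and *: "\<And>z. \<lbrakk>z \<in> mspace M; z \<noteq> r; z \<noteq> x; x \<in> desc M r z\<rbrakk> \<Longrightarrow> z \<in> ?S" for x
  proof -
    have xK: "x \<in> K" using * SK K x unfolding is_pruning_def by blast
    have "descendant_tree (N, r) z \<in> A" if z: "z \<in> K" "z \<noteq> r" "z \<noteq> x" "x \<in> desc N r z" for z
    proof -
      have zM: "z \<in> mspace M" using z K by (auto simp: is_pruning_def)
      \<comment> \<open>Membership in \<open>?S\<close> speaks only about strict ancestors, so the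
        property at z is read off from a point w strictly between z and x.\<close>
      obtain w where w: "w \<in> desc M r z" "x \<in> desc M r w" "w \<noteq> z" "w \<noteq> x"
        using strict_ancestor_between[OF zM, of x] z dN by auto
      have "w \<in> ?S" using *[of w] w desc_in desc_not_root z zM by auto
      then show ?thesis using w z SK by (auto simp: stable_points_def dN)
    qed
    then show ?thesis using xK by (auto simp: stable_points_def)
  qed
  have "compact_tree (submetric N ?S) r"
  proof (rule N.compact_tree_subtree[OF rS red(2)])
    fix x z assume "x \<in> ?S" "z \<in> mspace N" "x \<in> desc N r z"
    moreover have "K \<subseteq> mspace M" using K by (simp add: is_pruning_def)
    ultimately show "z \<in> ?S" using down[of x z] dN by auto
  qed
  then have tree: "compact_tree (submetric M ?S) r" unfolding SS .
  have "K \<subseteq> mspace M" using K unfolding is_pruning_def by blast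
  then have sub: "?S \<subseteq> mspace M" using SK by (rule order_trans[rotated])
  show "is_pruning M r ?S"
    unfolding is_pruning_def
  proof (intro conjI ballI impI sub tree rS)
    show "z \<in> ?S" if "x \<in> ?S" "z \<in> mspace M" "x \<in> desc M r z" for x z
      using down that .
    show "x \<in> ?S" if "x \<in> mspace M" "\<forall>z\<in>mspace M. z \<noteq> r \<longrightarrow> z \<noteq> x \<longrightarrow> x \<in> desc M r z \<longrightarrow> z \<in> ?S" for x
      using lim[of x] that by blast
  qed
qed

lemma iterated_reduction_pruning:
  fixes M :: "point metric"
  assumes M: "compact_tree M r" and H: "\<And>n. n \<ge> 1 \<Longrightarrow> hereditary (H n)"
  shows "\<exists>K. is_pruning M r K \<and> iterated_reduction H n (M, r) = (submetric M K, r)"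
proof (induction n)
  case 0
  have "is_pruning M r (mspace M)"
    using M compact_tree.root_in[OF M] unfolding is_pruning_def submetric_mspace by blast
  then show ?case by (intro exI[of _ "mspace M"]) simp
next
  case (Suc n)
  then obtain K where "is_pruning M r K" "iterated_reduction H n (M, r) = (submetric M K, r)" by auto
  then show ?case using stable_points_pruning[OF M H[of "Suc n"], of K] by (intro exI[of _ "stable_points (H (Suc n)) (submetric M K) r"]) simp
qed

section \<open>Invariance under isometries and embeddings\<close>

lemma hausdorff_self: "hausdorff Z A A = 0" if "A \<subseteq> mspace Z"
  unfolding hausdorff_def
proof (rule cInf_eq_minimum)
  show "0 \<in> {r. 0 \<le> r \<and> (\<forall>a\<in>A. \<exists>b\<in>A. mdist Z a b \<le> r) \<and> (\<forall>b\<in>A. \<exists>a\<in>A. mdist Z a b \<le> r)}"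
    using that by (auto intro!: bexI)
qed auto

text \<open>The ambient metric space is a copy of X alone, with Y embedded by the inverse isometry;
  the images of the two spaces and of their roots then coincide.\<close>

lemma gh_compact_isometric:
  fixes X :: "'a rooted" and Y :: "'b rooted"
  assumes iso: "rooted_isometric X Y" and root: "snd X \<in> mspace (fst X)"
  shows "gh_compact X Y = 0"
  unfolding gh_compact_def
proof (rule cInf_eq_minimum)
  obtain f where f: "isometric_embedding (fst X) (fst Y) f" "f ` mspace (fst X) = mspace (fst Y)" "f (snd X) = snd Y"
    using iso by (auto simp: rooted_isometric_def)
  define S where "S = (Inl ` mspace (fst X) :: ('a + 'b) set)"
  define D :: "'a + 'b \<Rightarrow> 'a + 'b \<Rightarrow> real" where "D = (\<lambda>a b. mdist (fst X) (projl a) (projl b))"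
  interpret Z: Metric_space S D
  proof
    show "D x y = D y x" for x y by (simp add: D_def mdist_commute)
    show "D x z \<le> D x y + D y z" if "x \<in> S" "y \<in> S" "z \<in> S" for x y z
      using that unfolding S_def D_def by (elim imageE) (simp add: mdist_triangle)
    show "(D x y = 0) = (x = y)" if "x \<in> S" "y \<in> S" for x y
      using that unfolding S_def D_def by (elim imageE) simp
  qed (simp add: D_def)
  have inj: "inj_on f (mspace (fst X))"
  proof (rule inj_onI)
    fix x y assume xy: "x \<in> mspace (fst X)" "y \<in> mspace (fst X)" "f x = f y"
    then have "mdist (fst X) x y = mdist (fst Y) (f y) (f y)"
      using f(1) unfolding isometric_embedding_def by metis
    also have "\<dots> = 0" using f(2) xy by (intro mdist_self) blast
    finally show "x = y" using xy by simp
  qed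
  define g where "g = (\<lambda>y. Inl (inv_into (mspace (fst X)) f y) :: 'a + 'b)"
  have g: "g (f x) = Inl x" if "x \<in> mspace (fst X)" for x
    using that inj by (simp add: g_def)
  have g1: "g ` mspace (fst Y) = S"
    unfolding f(2)[symmetric] S_def image_image using g by auto
  have "isometric_embedding (fst X) (metric (S, D)) Inl"
    unfolding isometric_embedding_def Z.mspace_metric Z.mdist_metric by (simp add: S_def D_def)
  moreover have "isometric_embedding (fst Y) (metric (S, D)) g"
    unfolding isometric_embedding_def Z.mspace_metric Z.mdist_metric g1
    unfolding f(2)[symmetric] using g f(1) by (simp add: isometric_embedding_def D_def)
  moreover have "g (snd Y) = Inl (snd X)" using g[OF root] f(3) by simp
  moreover have "hausdorff (metric (S, D)) (Inl ` mspace (fst X)) (g ` mspace (fst Y)) = 0"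
    unfolding g1 S_def[symmetric] by (rule hausdorff_self) simp
  moreover have "mdist (metric (S, D)) (Inl (snd X)) (Inl (snd X)) = 0"
    unfolding Z.mdist_metric using root by (simp add: D_def)
  ultimately show "0 \<in> {max (hausdorff Z (f ` mspace (fst X)) (g ` mspace (fst Y))) (mdist Z (f (snd X)) (g (snd Y))) |
          (Z :: ('a + 'b) metric) f g.
          isometric_embedding (fst X) Z f \<and> isometric_embedding (fst Y) Z g}"
    by (intro CollectI exI[of _ "metric (S, D)"] exI[of _ Inl] exI[of _ g]) simp
next
  fix r :: real
  assume "r \<in> {max (hausdorff Z (f ` mspace (fst X)) (g ` mspace (fst Y))) (mdist Z (f (snd X)) (g (snd Y))) |
          (Z :: ('a + 'b) metric) f g.
          isometric_embedding (fst X) Z f \<and> isometric_embedding (fst Y) Z g}"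
  then show "0 \<le> r" by (elim CollectE exE conjE) (simp add: le_max_iff_disj)
qed

lemma rooted_isometric_root_ball:
  assumes "rooted_isometric X Y" "snd X \<in> mspace (fst X)"
  shows "rooted_isometric (root_ball X \<rho>) (root_ball Y \<rho>)"
proof -
  obtain f where f: "isometric_embedding (fst X) (fst Y) f" "f ` mspace (fst X) = mspace (fst Y)" "f (snd X) = snd Y"
    using assms by (auto simp: rooted_isometric_def)
  have d: "mdist (fst Y) (f x) (f y) = mdist (fst X) x y" if "x \<in> mspace (fst X)" "y \<in> mspace (fst X)" for x y
    using f(1) that by (auto simp: isometric_embedding_def)
  have im: "f ` mspace (fst (root_ball X \<rho>)) = mspace (fst (root_ball Y \<rho>))"
  proof (intro equalityI subsetI)
    fix y assume "y \<in> f ` mspace (fst (root_ball X \<rho>))"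
    then obtain x where x: "x \<in> mspace (fst X)" "mdist (fst X) (snd X) x \<le> \<rho>" "y = f x"
      by (auto simp: root_ball_def)
    have "f x \<in> mspace (fst Y)" "snd Y \<in> mspace (fst Y)" using f x assms(2) by (metis image_eqI)+
    then show "y \<in> mspace (fst (root_ball Y \<rho>))"
      using x d[OF assms(2) x(1)] f(3) by (simp add: root_ball_def)
  next
    fix y assume y: "y \<in> mspace (fst (root_ball Y \<rho>))"
    then obtain x where x: "x \<in> mspace (fst X)" "y = f x" using f(2) by (auto simp: root_ball_def)
    then have "x \<in> mspace (fst (root_ball X \<rho>))"
      using y d[OF assms(2) x(1)] f(3) assms(2) by (simp add: root_ball_def)
    then show "y \<in> f ` mspace (fst (root_ball X \<rho>))" using x by blast
  qed
  have "\<forall>x\<in>mspace (fst (root_ball X \<rho>)). \<forall>y\<in>mspace (fst (root_ball X \<rho>)).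
      mdist (fst (root_ball Y \<rho>)) (f x) (f y) = mdist (fst (root_ball X \<rho>)) x y"
    using d by (simp add: root_ball_def)
  then have "isometric_embedding (fst (root_ball X \<rho>)) (fst (root_ball Y \<rho>)) f"
    unfolding isometric_embedding_def using im by blast
  moreover have "f (snd (root_ball X \<rho>)) = snd (root_ball Y \<rho>)" using f(3) by (simp add: root_ball_def)
  ultimately show ?thesis unfolding rooted_isometric_def using im by blast
qed

lemma pointed_gh_isometric:
  assumes "rooted_isometric X Y" "snd X \<in> mspace (fst X)"
  shows "pointed_gh X Y = 0"
proof -
  have "gh_compact (root_ball X (real (k + 1))) (root_ball Y (real (k + 1))) = 0" for k
    using assms by (intro gh_compact_isometric rooted_isometric_root_ball) (auto simp: root_ball_def)
  then show ?thesis by (simp add: pointed_gh_def)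
qed

lemma rooted_isometric_sym:
  assumes "rooted_isometric X Y" "snd X \<in> mspace (fst X)"
  shows "rooted_isometric Y X"
proof -
  obtain f where f: "isometric_embedding (fst X) (fst Y) f" "f ` mspace (fst X) = mspace (fst Y)" "f (snd X) = snd Y"
    using assms by (auto simp: rooted_isometric_def)
  have d: "mdist (fst Y) (f x) (f y) = mdist (fst X) x y" if "x \<in> mspace (fst X)" "y \<in> mspace (fst X)" for x y
    using f(1) that by (auto simp: isometric_embedding_def)
  have inj: "inj_on f (mspace (fst X))"
  proof (rule inj_onI)
    fix x y assume xy: "x \<in> mspace (fst X)" "y \<in> mspace (fst X)" "f x = f y"
    then have "mdist (fst X) x y = mdist (fst Y) (f y) (f y)" using d by metis
    also have "\<dots> = 0" using f(2) xy by (intro mdist_self) blast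
    finally show "x = y" using xy by simp
  qed
  let ?g = "inv_into (mspace (fst X)) f"
  have g: "?g (f x) = x" if "x \<in> mspace (fst X)" for x using that inj by simp
  have "?g ` mspace (fst Y) = mspace (fst X)"
    unfolding f(2)[symmetric] image_image using g by simp
  moreover have "\<forall>x\<in>mspace (fst Y). \<forall>y\<in>mspace (fst Y). mdist (fst X) (?g x) (?g y) = mdist (fst Y) x y"
    unfolding f(2)[symmetric] using g d by simp
  moreover have "?g (snd Y) = snd X" using g[OF assms(2)] f(3) by simp
  ultimately show ?thesis
    unfolding rooted_isometric_def isometric_embedding_def by (intro exI[of _ ?g]) blast
qed

lemma rooted_trees_root: "X \<in> rooted_trees \<Longrightarrow> snd X \<in> mspace (fst X)"
  unfolding rooted_trees_def by blast

text \<open>A generating open set contains with a tree everything at small pseudodistance, in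
  particular every isometric copy, and complements and countable unions inherit this. It is needed
  because a branch and its copy inside the whole tree are different members of
  \<open>rooted_trees\<close>.\<close>

lemma sets_borel_trees_isometric:
  assumes "A \<in> sets borel_trees" "X \<in> rooted_trees" "Y \<in> rooted_trees" "rooted_isometric X Y"
  shows "X \<in> A \<longleftrightarrow> Y \<in> A"
proof -
  let ?G = "{U. U \<subseteq> rooted_trees \<and> (\<forall>X\<in>U. \<exists>e>0. \<forall>Y\<in>rooted_trees. pointed_gh X Y < e \<longrightarrow> Y \<in> U)}"
  have "?G \<subseteq> Pow rooted_trees" by blast
  then have "A \<in> sigma_sets rooted_trees ?G"
    using assms(1) unfolding borel_trees_def by (simp only: sets_measure_of)
  then have "\<forall>X\<in>rooted_trees. \<forall>Y\<in>rooted_trees. rooted_isometric X Y \<longrightarrow> X \<in> A \<longrightarrow> Y \<in> A"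
  proof induction
    case (Basic U)
    show ?case
    proof (intro ballI impI)
      fix X Y assume XY: "X \<in> rooted_trees" "Y \<in> rooted_trees" "rooted_isometric X Y" "X \<in> U"
      then have 0: "pointed_gh X Y = 0"
        by (intro pointed_gh_isometric rooted_trees_root)
      have "\<forall>X\<in>U. \<exists>e>0. \<forall>Y\<in>rooted_trees. pointed_gh X Y < e \<longrightarrow> Y \<in> U"
        using Basic by (elim CollectE conjE)
      from bspec[OF this XY(4)] obtain e
        where "e > 0" "\<forall>Y\<in>rooted_trees. pointed_gh X Y < e \<longrightarrow> Y \<in> U"
        by (elim exE conjE)
      then show "Y \<in> U" using 0 XY by simp
    qed
  next
    case Empty
    show ?case by (intro ballI impI) (erule emptyE)
  next
    case (Compl U)
    show ?case
    proof (intro ballI impI)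
      fix X Y assume XY: "X \<in> rooted_trees" "Y \<in> rooted_trees" "rooted_isometric X Y" "X \<in> rooted_trees - U"
      have "rooted_isometric Y X" by (rule rooted_isometric_sym[OF XY(3) rooted_trees_root[OF XY(1)]])
      then show "Y \<in> rooted_trees - U"
        using bspec[OF bspec[OF Compl.IH XY(2)] XY(1)] XY(2,4) by simp
    qed
  next
    case (Union U)
    show ?case
    proof (intro ballI impI)
      fix X Y assume XY: "X \<in> rooted_trees" "Y \<in> rooted_trees" "rooted_isometric X Y" "X \<in> (\<Union>i. U i)"
      then obtain i where "X \<in> U i" by (elim UN_E)
      then have "Y \<in> U i" using Union.IH[of i] XY(1-3) by simp
      then show "Y \<in> (\<Union>i. U i)" by (intro UN_I UNIV_I)
    qed
  qed
  moreover have "rooted_isometric Y X"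
    by (rule rooted_isometric_sym[OF assms(4) rooted_trees_root[OF assms(2)]])
  ultimately show ?thesis using assms(2-4) by metis
qed

text \<open>The model is a branch inside a larger tree. The root is exempt: the root of the branch
  corresponds to a point at which other branches may be attached, so descendants do not match
  there.\<close>

definition descendant_embedding :: "('a \<Rightarrow> 'b) \<Rightarrow> 'a metric \<Rightarrow> 'a \<Rightarrow> 'b metric \<Rightarrow> 'b \<Rightarrow> bool" where
  "descendant_embedding f M r N s \<longleftrightarrow>
     (\<forall>x\<in>mspace M - {r}. f x \<in> mspace N - {s} \<and> f ` desc M r x = desc N s (f x)) \<and>
     (\<forall>x\<in>mspace M - {r}. \<forall>y\<in>mspace M - {r}. mdist N (f x) (f y) = mdist M x y)"

lemma descendant_embedding_isometric:
  assumes "compact_tree M r" "descendant_embedding f M r N s" "x \<in> mspace M" "x \<noteq> r"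
  shows "rooted_isometric (descendant_tree (M, r) x) (descendant_tree (N, s) (f x))"
proof -
  interpret compact_tree M r by fact
  have sub: "desc M r x \<subseteq> mspace M - {r}" using desc_in desc_not_root assms by blast
  have "f ` desc M r x = desc N s (f x)" using assms by (auto simp: descendant_embedding_def)
  moreover have "desc N s (f x) \<subseteq> mspace N" by (auto simp: desc_def)
  moreover have "desc M r x \<inter> mspace M = desc M r x" using sub by blast
  ultimately show ?thesis
    unfolding rooted_isometric_def isometric_embedding_def descendant_tree_eq
    using assms(2) sub by (intro exI[of _ f]) (auto simp: descendant_embedding_def subset_eq)
qed

lemma descendant_embedding_inj:
  assumes "descendant_embedding f M r N s"
  shows "inj_on f (mspace M - {r})"
proof (rule inj_onI)
  fix x y assume xy: "x \<in> mspace M - {r}" "y \<in> mspace M - {r}" "f x = f y"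
  then have "mdist M x y = mdist N (f y) (f y)"
    using assms unfolding descendant_embedding_def by metis
  also have "\<dots> = 0"
    using assms xy unfolding descendant_embedding_def by (intro mdist_self) blast
  finally show "x = y" using xy by simp
qed

text \<open>The ancestors of \<open>f x\<close> are images of ancestors of x or lie below such
  images. Those of the second kind have a descendant tree containing that of some \<open>f z\<close>
  with the property, so heredity gives it to them.\<close>

lemma stable_points_descendant_embedding:
  fixes M N :: "point metric"
  assumes M: "compact_tree M r" and N: "compact_tree N s" and f: "descendant_embedding f M r N s"
    and A: "hereditary A" and x: "x \<in> mspace M" "x \<noteq> r"
  shows "x \<in> stable_points A M r \<longleftrightarrow> f x \<in> stable_points A N s"
proof -
  interpret M: compact_tree M r by fact
  interpret N: compact_tree N s by fact
  have fM: "f z \<in> mspace N" "f z \<noteq> s" "f ` desc M r z = desc N s (f z)" if "z \<in> mspace M" "z \<noteq> r" for z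
    using f that by (auto simp: descendant_embedding_def)
  have inA: "descendant_tree (M, r) z \<in> A \<longleftrightarrow> descendant_tree (N, s) (f z) \<in> A" if z: "z \<in> mspace M" "z \<noteq> r" for z
  proof (rule sets_borel_trees_isometric)
    show "A \<in> sets borel_trees" using A by (simp add: hereditary_def)
    show "descendant_tree (M, r) z \<in> rooted_trees"
      unfolding descendant_tree_eq using M.compact_tree_descendant z by (intro compact_tree_in_rooted_trees) auto
    show "descendant_tree (N, s) (f z) \<in> rooted_trees"
      unfolding descendant_tree_eq using N.compact_tree_descendant fM z by (intro compact_tree_in_rooted_trees) auto
  qed (rule descendant_embedding_isometric[OF M f z])
  have inj: "inj_on f (mspace M - {r})" using descendant_embedding_inj f .
  show ?thesis
  proof
    assume *: "x \<in> stable_points A M r"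
    \<comment> \<open>Any point strictly between the root and x serves: the height of its image
      separates the two kinds of ancestors of \<open>f x\<close>.\<close>
    obtain z where z: "z \<in> mspace M" "z \<noteq> r" "z \<noteq> x" "x \<in> desc M r z"
      using M.strict_ancestor_between[of r x] M.desc_in M.desc_root x M.root_in by metis
    have "descendant_tree (N, s) w \<in> A" if w: "w \<in> mspace N" "w \<noteq> s" "w \<noteq> f x" "f x \<in> desc N s w" for w
    proof (cases "mdist N s (f z) \<le> mdist N s w")
      case True
      have "f x \<in> desc N s (f z)" using fM z by blast
      then have "w \<in> desc N s (f z)" using N.desc_linear[of "f z" w "f x"] w True fM z by auto
      then obtain z' where z': "z' \<in> desc M r z" "w = f z'" using fM z by blast
      then have z'M: "z' \<in> mspace M" "z' \<noteq> r" using M.desc_in M.desc_not_root z by auto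
      have "f x \<in> f ` desc M r z'" using w z' fM z'M by auto
      then obtain x' where x': "x' \<in> desc M r z'" "f x = f x'" by blast
      then have "x' = x" using inj_onD[OF inj, of x' x] x M.desc_in M.desc_not_root z'M by auto
      then have "descendant_tree (M, r) z' \<in> A" using * x' z' z'M w by (auto simp: stable_points_def)
      then show ?thesis using inA z' z'M by simp
    next
      case False
      have fx: "f x \<in> desc N s (f z)" using fM z by blast
      have "f z \<in> desc N s w"
        using N.desc_linear[of w "f z" "f x"] w False fM z fx by auto
      moreover have "descendant_tree (M, r) z \<in> A" using * z by (auto simp: stable_points_def)
      then have "descendant_tree (N, s) (f z) \<in> A" using inA z by simp
      ultimately show ?thesis using hereditary_descendant[OF N A] w by blast
    qed
    then show "f x \<in> stable_points A N s" using fM x by (simp add: stable_points_def)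
  next
    assume *: "f x \<in> stable_points A N s"
    have "descendant_tree (M, r) z \<in> A" if z: "z \<in> mspace M" "z \<noteq> r" "z \<noteq> x" "x \<in> desc M r z" for z
    proof -
      have "f z \<noteq> f x" using inj_onD[OF inj, of z x] z x by auto
      moreover have "f x \<in> desc N s (f z)" using fM z by blast
      ultimately have "descendant_tree (N, s) (f z) \<in> A" using * fM z by (simp add: stable_points_def)
      then show ?thesis using inA z by simp
    qed
    then show "x \<in> stable_points A M r" using x by (simp add: stable_points_def)
  qed
qed

text \<open>A reduction step retains x exactly when it retains \<open>f x\<close>, so f is again a
  descendant embedding between the two pruned trees and the next step can be compared in the same
  way.\<close>

lemma iterated_reduction_descendant_embedding:
  fixes M N :: "point metric"
  assumes M: "compact_tree M r" and N: "compact_tree N s" and f: "descendant_embedding f M r N s"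
    and H: "\<And>n. n \<ge> 1 \<Longrightarrow> hereditary (H n)"
  shows "\<exists>K L. is_pruning M r K \<and> iterated_reduction H n (M, r) = (submetric M K, r) \<and>
      is_pruning N s L \<and> iterated_reduction H n (N, s) = (submetric N L, s) \<and>
      (\<forall>x\<in>mspace M - {r}. x \<in> K \<longleftrightarrow> f x \<in> L)"
proof (induction n)
  case 0
  have "is_pruning M r (mspace M)" "is_pruning N s (mspace N)"
    using M compact_tree.root_in[OF M] N compact_tree.root_in[OF N]
    unfolding is_pruning_def submetric_mspace by blast+
  moreover have "\<forall>x\<in>mspace M - {r}. x \<in> mspace M \<longleftrightarrow> f x \<in> mspace N"
    using f unfolding descendant_embedding_def by blast
  ultimately show ?case by (intro exI[of _ "mspace M"] exI[of _ "mspace N"]) simp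
next
  case (Suc n)
  then obtain K L where K: "is_pruning M r K" "iterated_reduction H n (M, r) = (submetric M K, r)"
    and L: "is_pruning N s L" "iterated_reduction H n (N, s) = (submetric N L, s)"
    and KL: "\<And>x. x \<in> mspace M - {r} \<Longrightarrow> x \<in> K \<longleftrightarrow> f x \<in> L" by blast
  have A: "hereditary (H (Suc n))" using H by simp
  have KM: "K \<subseteq> mspace M" "compact_tree (submetric M K) r" using K unfolding is_pruning_def by blast+
  have LN: "L \<subseteq> mspace N" "compact_tree (submetric N L) s" using L unfolding is_pruning_def by blast+
  have [simp]: "mspace (submetric M K) = K" "mspace (submetric N L) = L" using KM LN by auto
  have emb: "descendant_embedding f (submetric M K) r (submetric N L) s"
    unfolding descendant_embedding_def
  proof (intro conjI ballI)
    fix x assume x: "x \<in> mspace (submetric M K) - {r}"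
    then have xM: "x \<in> mspace M - {r}" using KM by auto
    have fx: "f x \<in> mspace N - {s}" "f ` desc M r x = desc N s (f x)"
      using f xM unfolding descendant_embedding_def by blast+
    show "f x \<in> mspace (submetric N L) - {s}" using fx KL[OF xM] x by simp
    have "desc M r x \<subseteq> mspace M - {r}"
      using compact_tree.desc_in[OF M] compact_tree.desc_not_root[OF M] xM by blast
    then have "f ` (K \<inter> desc M r x) = L \<inter> f ` desc M r x" using KL by blast
    then show "f ` desc (submetric M K) r x = desc (submetric N L) s (f x)"
      using fx by (simp add: desc_submetric)
    fix y assume "y \<in> mspace (submetric M K) - {r}"
    then have "y \<in> mspace M - {r}" using KM by auto
    then show "mdist (submetric N L) (f x) (f y) = mdist (submetric M K) x y"
      using f xM unfolding descendant_embedding_def by simp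
  qed
  let ?K = "stable_points (H (Suc n)) (submetric M K) r" and ?L = "stable_points (H (Suc n)) (submetric N L) s"
  have "x \<in> ?K \<longleftrightarrow> f x \<in> ?L" if x: "x \<in> mspace M - {r}" for x
  proof (cases "x \<in> K")
    case True
    then show ?thesis using stable_points_descendant_embedding[OF KM(2) LN(2) emb A] x by simp
  next
    case False
    then have "f x \<notin> L" using KL x by blast
    then show ?thesis using False by (simp add: stable_points_def)
  qed
  then show ?case
    using stable_points_pruning[OF M A K(1)] stable_points_pruning[OF N A L(1)] K(2) L(2)
    by (intro exI[of _ ?K] exI[of _ ?L]) simp
qed

section \<open>The shape of a tree from the heights of its meets\<close>

text \<open>
  For points \<open>x\<close>, \<open>y\<close> of a rooted tree, \<open>G x y\<close> is the height of their meet, in particular \<open>G x x\<close>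
  is the height of \<open>x\<close>.
\<close>

definition meet_kernel :: "('a \<Rightarrow> 'a \<Rightarrow> real) \<Rightarrow> 'a set \<Rightarrow> bool" where
  "meet_kernel G U \<longleftrightarrow>
     (\<forall>x\<in>U. \<forall>y\<in>U. G x y = G y x \<and> G x y \<le> G x x \<and> (G x x = G x y \<and> G y y = G x y \<longrightarrow> x = y)) \<and>
     (\<forall>x\<in>U. \<forall>y\<in>U. \<forall>z\<in>U. min (G x y) (G y z) \<le> G x z)"

text \<open>For a meet kernel the relation \<open>c < G x y\<close> is an equivalence on the points
  higher than c; its classes are the parts into which the tree falls above height c.\<close>

definition branches :: "('a \<Rightarrow> 'a \<Rightarrow> real) \<Rightarrow> real \<Rightarrow> 'a set \<Rightarrow> 'a set set" where
  "branches G c B = (\<lambda>x. {y \<in> B. c < G x y}) ` {x \<in> B. c < G x x}"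

text \<open>
  \<open>branch_shape G a B t\<close>: the set \<open>B\<close> consists of the points of height greater than \<open>a\<close> of a planted
  tree rooted at height \<open>a\<close>, whose stem ends at height \<open>c\<close>, and \<open>t\<close> is the shape above the stem.
\<close>

inductive branch_shape :: "('a \<Rightarrow> 'a \<Rightarrow> real) \<Rightarrow> real \<Rightarrow> 'a set \<Rightarrow> ctree \<Rightarrow> bool" for G where
  "\<lbrakk>a < c; \<And>s. a < s \<Longrightarrow> s \<le> c \<Longrightarrow> \<exists>x\<in>B. G x x = s; \<And>x. x \<in> B \<Longrightarrow> a < G x x;
    \<And>x y. x \<in> B \<Longrightarrow> y \<in> B \<Longrightarrow> min c (min (G x x) (G y y)) \<le> G x y;
    finite (branches G c B); card (branches G c B) \<noteq> 1;
    \<And>C. C \<in> branches G c B \<Longrightarrow> branch_shape G c C (\<tau> C)\<rbrakk> \<Longrightarrow>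
   branch_shape G a B (Node (image_mset \<tau> (mset_set (branches G c B))))"

lemma branch_shape_reduced: "branch_shape G a B t \<Longrightarrow> reduced t"
  by (induction rule: branch_shape.induct) (auto intro!: reduced.intros)

lemma branches_subset: "C \<in> branches G c B \<Longrightarrow> C \<subseteq> B"
  by (auto simp: branches_def)

lemma meet_kernel_subset: "meet_kernel G U \<Longrightarrow> V \<subseteq> U \<Longrightarrow> meet_kernel G V"
  unfolding meet_kernel_def by blast

lemma meet_kernel_image:
  assumes G: "meet_kernel G U" and \<phi>: "\<And>x y. x \<in> U \<Longrightarrow> y \<in> U \<Longrightarrow> G' (\<phi> x) (\<phi> y) = G x y"
  shows "meet_kernel G' (\<phi> ` U)"
  unfolding meet_kernel_def
proof (intro conjI ballI impI; elim imageE)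
  fix p q x y assume xy: "p = \<phi> x" "x \<in> U" "q = \<phi> y" "y \<in> U"
  note eq = \<phi>[OF xy(2,4)] \<phi>[OF xy(4,2)] \<phi>[OF xy(2,2)] \<phi>[OF xy(4,4)]
  have *: "G x y = G y x" "G x y \<le> G x x" "G x x = G x y \<and> G y y = G x y \<longrightarrow> x = y"
    using G xy(2,4) unfolding meet_kernel_def by blast+
  show "G' p q = G' q p" "G' p q \<le> G' p p" using * eq xy by simp_all
  show "p = q" if "G' p p = G' p q \<and> G' q q = G' p q"
  proof -
    have "G x x = G x y \<and> G y y = G x y" using that unfolding xy(1,3) eq .
    then show ?thesis using *(3) xy(1,3) by simp
  qed
next
  fix p q r x y z assume xyz: "p = \<phi> x" "x \<in> U" "q = \<phi> y" "y \<in> U" "r = \<phi> z" "z \<in> U"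
  have "min (G x y) (G y z) \<le> G x z" using G xyz(2,4,6) unfolding meet_kernel_def by blast
  then show "min (G' p q) (G' q r) \<le> G' p r"
    using \<phi>[OF xyz(2,4)] \<phi>[OF xyz(4,6)] \<phi>[OF xyz(2,6)] xyz by simp
qed

lemma branches_eq_iff:
  assumes "meet_kernel G B" "x \<in> B" "y \<in> B" "c < G x x" "c < G y y"
  shows "{z \<in> B. c < G x z} = {z \<in> B. c < G y z} \<longleftrightarrow> c < G x y"
proof
  assume "{z \<in> B. c < G x z} = {z \<in> B. c < G y z}"
  then show "c < G x y" using assms by blast
next
  have tr: "c < G u w" if "u \<in> B" "v \<in> B" "w \<in> B" "c < G u v" "c < G v w" for u v w
  proof -
    have "min (G u v) (G v w) \<le> G u w" using assms(1) that unfolding meet_kernel_def by blast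
    then show ?thesis using that by linarith
  qed
  assume *: "c < G x y"
  then have "c < G y x" using assms(1-3) unfolding meet_kernel_def by metis
  then show "{z \<in> B. c < G x z} = {z \<in> B. c < G y z}" using tr * assms by blast
qed

text \<open>If c were below \<open>c'\<close>, then \<open>chain\<close> would make the meet of any
  two points higher than c itself higher than c, so there would be one branch at most;
  \<open>attained\<close> provides one, but the number of branches at c is not 1. Applied in both
  directions, this fixes the height at which the stem ends.\<close>

lemma branch_stem_le:
  assumes G: "meet_kernel G B"
    and card: "card (branches G c B) \<noteq> 1" and fin: "finite (branches G c B)"
    and attained: "\<And>s. a < s \<Longrightarrow> s \<le> c' \<Longrightarrow> \<exists>x\<in>B. G x x = s" and "a < c'"
    and chain: "\<And>x y. x \<in> B \<Longrightarrow> y \<in> B \<Longrightarrow> min c' (min (G x x) (G y y)) \<le> G x y"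
  shows "c' \<le> c"
proof (rule ccontr)
  assume "\<not> c' \<le> c"
  obtain x where x: "x \<in> B" "G x x = c'" using attained[of c'] \<open>a < c'\<close> by auto
  then have "{y \<in> B. c < G x y} \<in> branches G c B" using \<open>\<not> c' \<le> c\<close> by (auto simp: branches_def)
  moreover from this have "card (branches G c B) \<noteq> 0" using fin by auto
  ultimately obtain C D where "C \<in> branches G c B" "D \<in> branches G c B" "C \<noteq> D"
    using card by (metis card_1_singleton_iff One_nat_def is_singletonI' is_singleton_altdef empty_iff)
  then obtain y z where yz: "y \<in> B" "z \<in> B" "c < G y y" "c < G z z"
    and "{w \<in> B. c < G y w} \<noteq> {w \<in> B. c < G z w}" by (auto simp: branches_def)
  then have "\<not> c < G y z" using branches_eq_iff[OF G] by blast
  moreover have "min c' (min (G y y) (G z z)) \<le> G y z" using chain yz by blast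
  ultimately show False using yz \<open>\<not> c' \<le> c\<close> by auto
qed

lemma branch_shape_unique:
  assumes "branch_shape G a B t" "branch_shape G a B t'" "meet_kernel G B"
  shows "t = t'"
  using assms
proof (induction arbitrary: t' rule: branch_shape.induct)
  case (1 a c B \<tau>)
  from "1.prems"(1) obtain c' \<tau>' where 2: "t' = Node (image_mset \<tau>' (mset_set (branches G c' B)))"
    "a < c'" "\<And>s. a < s \<Longrightarrow> s \<le> c' \<Longrightarrow> \<exists>x\<in>B. G x x = s"
    "\<And>x y. x \<in> B \<Longrightarrow> y \<in> B \<Longrightarrow> min c' (min (G x x) (G y y)) \<le> G x y"
    "finite (branches G c' B)" "card (branches G c' B) \<noteq> 1"
    "\<And>C. C \<in> branches G c' B \<Longrightarrow> branch_shape G c' C (\<tau>' C)"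
    by (cases rule: branch_shape.cases) blast
  have "c' \<le> c" by (rule branch_stem_le[OF "1.prems"(2) 1(6,5) 2(3,2,4)])
  moreover have "c \<le> c'" by (rule branch_stem_le[OF "1.prems"(2) 2(6,5) 1(2,1,4)])
  ultimately have [simp]: "c' = c" by simp
  have "\<tau> C = \<tau>' C" if C: "C \<in> branches G c B" for C
    using "1.IH"[OF C] 2(7)[of C] C meet_kernel_subset[OF "1.prems"(2) branches_subset[OF C]] by simp
  then have "image_mset \<tau> (mset_set (branches G c B)) = image_mset \<tau>' (mset_set (branches G c B))"
    using 1(5) by (intro image_mset_cong) simp
  then show ?case using 2(1) by simp
qed

lemma branches_image:
  assumes \<phi>: "inj_on \<phi> B" "\<And>x y. x \<in> B \<Longrightarrow> y \<in> B \<Longrightarrow> G' (\<phi> x) (\<phi> y) = G x y"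
  shows "branches G' c (\<phi> ` B) = (`) \<phi> ` branches G c B"
proof -
  have 1: "{x \<in> \<phi> ` B. c < G' x x} = \<phi> ` {x \<in> B. c < G x x}" using \<phi>(2) by auto
  have 2: "{y \<in> \<phi> ` B. c < G' (\<phi> x) y} = \<phi> ` {y \<in> B. c < G x y}" if "x \<in> B" for x using \<phi>(2) that by auto
  show ?thesis unfolding branches_def 1 image_image using 2 by (intro image_cong) auto
qed

lemma branch_shape_image:
  assumes "branch_shape G a B t" "inj_on \<phi> B" "\<And>x y. x \<in> B \<Longrightarrow> y \<in> B \<Longrightarrow> G' (\<phi> x) (\<phi> y) = G x y"
  shows "branch_shape G' a (\<phi> ` B) t"
  using assms
proof (induction rule: branch_shape.induct)
  case (1 a c B \<tau>)
  note \<phi> = "1.prems"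
  have br: "branches G' c (\<phi> ` B) = (`) \<phi> ` branches G c B" using branches_image[of \<phi> B G' G] \<phi> by blast
  have inj: "inj_on ((`) \<phi>) (branches G c B)"
    using inj_on_image_Pow[OF \<phi>(1)] by (rule inj_on_subset) (use branches_subset in blast)
  define \<tau>' where "\<tau>' = (\<lambda>C. \<tau> (inv_into B \<phi> ` C))"
  have \<tau>': "\<tau>' (\<phi> ` C) = \<tau> C" if "C \<in> branches G c B" for C
    using branches_subset[OF that] \<phi>(1) by (simp add: \<tau>'_def)
  have "branch_shape G' a (\<phi> ` B) (Node (image_mset \<tau>' (mset_set (branches G' c (\<phi> ` B)))))"
  proof (rule branch_shape.intros)
    show "\<exists>x\<in>\<phi> ` B. G' x x = s" if "a < s" "s \<le> c" for s
      using 1(2)[OF that] \<phi>(2) by auto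
    show "min c (min (G' x x) (G' y y)) \<le> G' x y" if "x \<in> \<phi> ` B" "y \<in> \<phi> ` B" for x y
      using that 1(4) \<phi>(2) by auto
    show "card (branches G' c (\<phi> ` B)) \<noteq> 1" using 1(6) inj by (simp add: br card_image)
    show "branch_shape G' c C (\<tau>' C)" if "C \<in> branches G' c (\<phi> ` B)" for C
    proof -
      obtain D where D: "D \<in> branches G c B" "C = \<phi> ` D" using \<open>C \<in> _\<close> br by auto
      have "branch_shape G' c (\<phi> ` D) (\<tau> D)"
        using branches_subset[OF D(1)] \<phi>
        by (intro "1.IH"[OF D(1)]) (auto intro: inj_on_subset)
      then show ?thesis using \<tau>'[OF D(1)] D(2) by simp
    qed
  qed (use 1 \<phi> br in auto)
  also have "image_mset \<tau>' (mset_set (branches G' c (\<phi> ` B))) = image_mset \<tau> (mset_set (branches G c B))"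
    unfolding br image_mset_mset_set[OF inj, symmetric] image_mset.compositionality
    using \<tau>' 1(5) by (intro image_mset_cong) simp
  finally show ?case .
qed

text \<open>This is how a vertex with one surviving child disappears: S is the edge below it, and
  the stem of B is prolonged downwards. The points of S are too low to take part in the branches at
  the end of the stem.\<close>

lemma branch_shape_stem_extend:
  assumes t: "branch_shape G b B t" and ab: "a < b"
    and stem: "\<And>s. a < s \<Longrightarrow> s \<le> b \<Longrightarrow> \<exists>x\<in>S. G x x = s" "\<And>x. x \<in> S \<Longrightarrow> a < G x x \<and> G x x \<le> b"
    and chain: "\<And>x y. x \<in> S \<Longrightarrow> y \<in> S \<union> B \<Longrightarrow> G x y = min (G x x) (G y y) \<and> G y x = min (G x x) (G y y)"
  shows "branch_shape G a (S \<union> B) t"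
  using t
proof cases
  case (1 c \<tau>)
  have "{x \<in> S \<union> B. c < G x x} = {x \<in> B. c < G x x}" using stem(2) 1(2) by fastforce
  moreover have "{y \<in> S \<union> B. c < G x y} = {y \<in> B. c < G x y}" if "x \<in> B" for x
    using chain[of _ x] stem(2) 1(2) that by fastforce
  ultimately have br: "branches G c (S \<union> B) = branches G c B"
    unfolding branches_def by (intro image_cong) auto
  have "branch_shape G a (S \<union> B) (Node (image_mset \<tau> (mset_set (branches G c (S \<union> B)))))"
  proof (rule branch_shape.intros)
    show "\<exists>x\<in>S \<union> B. G x x = s" if "a < s" "s \<le> c" for s
      using stem(1)[of s] 1(3)[of s] that by (cases "s \<le> b") auto
    show "a < G x x" if "x \<in> S \<union> B" for x using stem(2)[of x] 1(4)[of x] that ab by auto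
    show "min c (min (G x x) (G y y)) \<le> G x y" if "x \<in> S \<union> B" "y \<in> S \<union> B" for x y
      using 1(5)[of x y] chain[of x y] chain[of y x] that by auto
  qed (use 1 ab br in auto)
  then show ?thesis using 1 br by simp
qed

section \<open>Metric trees in Ulam-Harris coordinates\<close>

lemma family_snoc: "u @ [i] \<in> family N \<longleftrightarrow> u \<in> family N \<and> i < N u"
  by (auto intro: family.intros elim: family.cases)

lemma family_append: "u @ v \<in> family N \<longleftrightarrow> u \<in> family N \<and> v \<in> family (\<lambda>w. N (u @ w))"
proof (induction v rule: rev_induct)
  case Nil
  then show ?case by (simp add: family.intros)
next
  case (snoc i v)
  then show ?case using family_snoc[of "u @ v" i N] by (auto simp: family_snoc)
qed

lemma family_Cons: "j # v \<in> family N \<longleftrightarrow> j < N [] \<and> v \<in> family (\<lambda>w. N (j # w))"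
  using family_append[of "[j]" v N] family_snoc[of "[]" j N] by (simp add: family.intros)

lemma family_prefix: "v \<in> family N \<Longrightarrow> prefix u v \<Longrightarrow> u \<in> family N"
  by (auto simp: prefix_def family_append)

lemma family_sub_finite: "finite (family N) \<Longrightarrow> u \<in> family N \<Longrightarrow> finite (family (\<lambda>w. N (u @ w)))"
  by (rule finite_surj[of "family N" _ "drop (length u)"])
     (auto simp: image_iff family_append intro!: bexI[of _ "u @ _"])

definition tree_points :: "(nat list \<Rightarrow> nat) \<Rightarrow> (nat list \<Rightarrow> real) \<Rightarrow> point set" where
  "tree_points N l = {(u, s). u \<in> family N \<and> 0 < s \<and> s \<le> l u}"

text \<open>The length common to two root paths, edge by edge. Summing over the prefixes of the
  first label is enough, since the first path covers nothing elsewhere.\<close>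

definition meet :: "(nat list \<Rightarrow> real) \<Rightarrow> point \<Rightarrow> point \<Rightarrow> real" where
  "meet l x y = (\<Sum>w\<in>{w. prefix w (fst x)}. min (covered l x w) (covered l y w))"

lemma finite_prefixes [simp]: "finite {w. prefix w u}"
  using finite_set[of "prefixes u"] by (simp only: set_prefixes_eq)

lemma covered_eq_0: "\<not> prefix w (fst x) \<Longrightarrow> covered l x w = 0"
  by (auto simp: covered_def)

text \<open>Weaker than membership in a tree: no family is involved and \<open>snd x = 0\<close> is
  allowed, so that the root is included and the condition survives the removal of a prefix from the
  label.\<close>

definition edge_point :: "(nat list \<Rightarrow> real) \<Rightarrow> point \<Rightarrow> bool" where
  "edge_point l x \<longleftrightarrow> 0 \<le> snd x \<and> snd x \<le> l (fst x) \<and> (\<forall>w. strict_prefix w (fst x) \<longrightarrow> 0 < l w)"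

lemma covered_nonneg: "edge_point l x \<Longrightarrow> 0 \<le> covered l x w"
  by (auto simp: covered_def edge_point_def less_imp_le)

lemma meet_sum:
  assumes "edge_point l x" "edge_point l y" "finite W" "{w. prefix w (fst x)} \<subseteq> W \<or> {w. prefix w (fst y)} \<subseteq> W"
  shows "meet l x y = (\<Sum>w\<in>W. min (covered l x w) (covered l y w))"
proof -
  have 0: "min (covered l x w) (covered l y w) = 0" if "\<not> prefix w (fst x) \<or> \<not> prefix w (fst y)" for w
    using that covered_nonneg[OF assms(1), of w] covered_nonneg[OF assms(2), of w] covered_eq_0 by fastforce
  have "meet l x y = (\<Sum>w\<in>{w. prefix w (fst x)} \<union> W. min (covered l x w) (covered l y w))"
    unfolding meet_def by (intro sum.mono_neutral_left) (use 0 assms in auto)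
  also have "\<dots> = (\<Sum>w\<in>W. min (covered l x w) (covered l y w))"
    by (intro sum.mono_neutral_right) (use 0 assms in auto)
  finally show ?thesis .
qed

lemma meet_commute: "edge_point l x \<Longrightarrow> edge_point l y \<Longrightarrow> meet l x y = meet l y x"
  using meet_sum[of l x y "{w. prefix w (fst y)}"] by (simp add: meet_def min.commute)

lemma meet_self: "meet l x x = (\<Sum>w\<in>{w. prefix w (fst x)}. covered l x w)"
  by (simp add: meet_def)

lemma meet_le: "meet l x y \<le> meet l x x"
  unfolding meet_self meet_def by (intro sum_mono) simp

text \<open>On every edge \<open>|a - b| = a + b - 2 * min a b\<close>; hence \<open>meet\<close> is
  the Gromov product at the root.\<close>

lemma path_dist_meet:
  assumes "edge_point l x" "edge_point l y"
  shows "path_dist l x y = meet l x x + meet l y y - 2 * meet l x y"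
proof -
  let ?W = "{w. prefix w (fst x) \<or> prefix w (fst y)}"
  have f: "finite ?W" using finite_UnI[OF finite_prefixes[of "fst x"] finite_prefixes[of "fst y"]]
    by (simp add: Un_def)
  have "\<bar>a - b\<bar> = min a a + min b b - 2 * min a b" for a b :: real by (simp add: min_def)
  then have "path_dist l x y = (\<Sum>w\<in>?W. min (covered l x w) (covered l x w) +
      min (covered l y w) (covered l y w) - 2 * min (covered l x w) (covered l y w))"
    unfolding path_dist_def by simp
  also have "\<dots> = meet l x x + meet l y y - 2 * meet l x y"
  proof -
    have "{w. prefix w (fst x)} \<subseteq> ?W" "{w. prefix w (fst y)} \<subseteq> ?W" by auto
    then show ?thesis
      using meet_sum[OF assms(1,1) f] meet_sum[OF assms(2,2) f] meet_sum[OF assms f]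
      by (simp add: sum.distrib sum_subtractf sum_distrib_left)
  qed
  finally show ?thesis .
qed

text \<open>The pieces of the root path of y shared with x and with z are both initial pieces of
  that path, so one contains the other. Violations on both sides would occur at comparable labels,
  and reaching the longer label means covering the shorter one completely.\<close>

lemma covered_comparable:
  assumes "edge_point l x" "edge_point l y" "edge_point l z"
  shows "(\<forall>w. min (covered l x w) (covered l y w) \<le> covered l z w) \<or>
         (\<forall>w. min (covered l y w) (covered l z w) \<le> covered l x w)"
proof (rule ccontr)
  assume "\<not> ?thesis"
  then obtain w w' where w: "covered l z w < min (covered l x w) (covered l y w)"
    and w': "covered l x w' < min (covered l y w') (covered l z w')" by (auto simp: not_le)
  have le: "covered l a v \<le> l v" if "edge_point l a" "covered l a v > 0" for a v
    using that by (auto simp: covered_def edge_point_def split: if_splits)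
  have full: "covered l a v = l v" if "strict_prefix v v'" "0 < covered l a v'" "edge_point l a" for a v v'
    using that by (auto simp: covered_def split: if_splits)
  have nn: "0 \<le> covered l x w'" "0 \<le> covered l z w"
    using covered_nonneg assms by auto
  have "prefix w (fst y)" "prefix w' (fst y)"
    using w w' nn covered_eq_0[of w y l] covered_eq_0[of w' y l] by fastforce+
  then consider "w = w'" | "strict_prefix w w'" | "strict_prefix w' w"
    using prefix_same_cases by (metis strict_prefixI)
  then show False
  proof cases
    case 1
    then show False using w w' by auto
  next
    case 2
    then have "covered l z w = l w" using full[OF 2, of z] w' nn assms by auto
    then show False using w le[of x w] nn assms by auto
  next
    case 3
    then have "covered l x w' = l w'" using full[OF 3, of x] w nn assms by auto
    then show False using w' le[of z w'] nn assms by auto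
  qed
qed

lemma meet_ultrametric:
  assumes "edge_point l x" "edge_point l y" "edge_point l z"
  shows "min (meet l x y) (meet l y z) \<le> meet l x z"
  using covered_comparable[OF assms]
proof
  assume *: "\<forall>w. min (covered l x w) (covered l y w) \<le> covered l z w"
  have "meet l x y \<le> meet l x z" unfolding meet_def by (intro sum_mono) (use * in auto)
  then show ?thesis by simp
next
  assume *: "\<forall>w. min (covered l y w) (covered l z w) \<le> covered l x w"
  have "meet l z y \<le> meet l z x" unfolding meet_def
    by (intro sum_mono) (use * in \<open>auto simp: min.commute\<close>)
  then show ?thesis using meet_commute assms by (simp add: min.coboundedI2)
qed

text \<open>The positive piece covered on the last edge of each point forces its label to be a
  prefix of the other one; a pair \<open>(u, 0)\<close> with nonempty u would be at distance 0 from
  the top of the edge below.\<close>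

lemma path_dist_eq_0:
  assumes "edge_point l x" "edge_point l y" "0 < snd x \<or> x = ([], 0)" "0 < snd y \<or> y = ([], 0)"
    and "path_dist l x y = 0"
  shows "x = y"
proof -
  let ?W = "{w. prefix w (fst x) \<or> prefix w (fst y)}"
  have f: "finite ?W" using finite_UnI[OF finite_prefixes[of "fst x"] finite_prefixes[of "fst y"]]
    by (simp add: Un_def)
  have eq: "covered l x w = covered l y w" if "w \<in> ?W" for w
    using assms(5) that f sum_nonneg_eq_0_iff[OF f, of "\<lambda>w. \<bar>covered l x w - covered l y w\<bar>"]
    by (auto simp: path_dist_def)
  have 1: "prefix (fst y) (fst x)"
  proof (rule ccontr)
    assume n: "\<not> prefix (fst y) (fst x)"
    then have "snd y = 0" using eq[of "fst y"] covered_eq_0[OF n] by (simp add: covered_def)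
    then show False using assms n by auto
  qed
  have 2: "prefix (fst x) (fst y)"
  proof (rule ccontr)
    assume n: "\<not> prefix (fst x) (fst y)"
    then have "snd x = 0" using eq[of "fst x"] covered_eq_0[OF n] by (simp add: covered_def)
    then show False using assms n by auto
  qed
  have "fst x = fst y" using 1 2 prefix_order.antisym by blast
  moreover from this have "snd x = snd y" using eq[of "fst x"] by (simp add: covered_def)
  ultimately show ?thesis by (simp add: prod_eq_iff)
qed

lemma prefixes_Cons: "{w. prefix w (j # u)} = insert [] ((#) j ` {w. prefix w u})"
  by (auto simp: prefix_Cons)

lemma edge_point_Cons:
  "edge_point l (j # u, s) \<longleftrightarrow> 0 < l [] \<and> edge_point (\<lambda>w. l (j # w)) (u, s)"
proof -
  have "strict_prefix w (j # u) \<longleftrightarrow> w = [] \<or> (\<exists>v. w = j # v \<and> strict_prefix v u)" for w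
    by (auto simp: strict_prefix_def prefix_Cons)
  then show ?thesis by (auto simp: edge_point_def)
qed

lemma meet_Cons_Cons:
  assumes "edge_point l (j # u, s)" "edge_point l (k # v, s')"
  shows "meet l (j # u, s) (k # v, s') =
    l [] + (if j = k then meet (\<lambda>w. l (j # w)) (u, s) (v, s') else 0)"
proof -
  have "meet l (j # u, s) (k # v, s') =
      (\<Sum>w\<in>insert [] ((#) j ` {w. prefix w u}). min (covered l (j # u, s) w) (covered l (k # v, s') w))"
    by (simp only: meet_def prefixes_Cons fst_conv)
  also have "\<dots> = l [] + (\<Sum>w\<in>(#) j ` {w. prefix w u}. min (covered l (j # u, s) w) (covered l (k # v, s') w))"
    by (subst sum.insert) (auto simp: covered_def)
  also have "(\<Sum>w\<in>(#) j ` {w. prefix w u}. min (covered l (j # u, s) w) (covered l (k # v, s') w)) =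
      (\<Sum>w\<in>{w. prefix w u}. min (covered l (j # u, s) (j # w)) (covered l (k # v, s') (j # w)))"
    by (subst sum.reindex) auto
  also have "\<dots> = (if j = k then meet (\<lambda>w. l (j # w)) (u, s) (v, s') else 0)"
  proof (cases "j = k")
    case True
    have "covered l (j # u, s) (j # w) = covered (\<lambda>w. l (j # w)) (u, s) w" for u s w
      by (auto simp: covered_def strict_prefix_def)
    then show ?thesis using True by (simp add: meet_def)
  next
    case False
    have "min (covered l (j # u, s) (j # w)) (covered l (k # v, s') (j # w)) = 0" for w
      using covered_nonneg[OF assms(1), of "j # w"] covered_eq_0[of "j # w" "(k # v, s')" l] False by simp
    then show ?thesis using False by simp
  qed
  finally show ?thesis .
qed

lemma meet_Nil: "edge_point l y \<Longrightarrow> meet l ([], s) y = min s (covered l y [])"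
proof -
  have "{w. prefix w []} = {[]}" by auto
  then show ?thesis by (simp add: meet_def covered_def)
qed

lemma meet_root: "edge_point l y \<Longrightarrow> meet l ([], 0) y = 0"
  using covered_nonneg[of l y "[]"] by (simp add: meet_Nil)

lemma edge_point_append:
  "edge_point l (u @ v, s) \<longleftrightarrow> (\<forall>w. strict_prefix w u \<longrightarrow> 0 < l w) \<and> edge_point (\<lambda>w. l (u @ w)) (v, s)"
    if "v = [] \<or> 0 < l u"
  using that
proof (induction u arbitrary: l)
  case Nil
  then show ?case by simp
next
  case (Cons j u)
  have "strict_prefix w (j # u) \<longleftrightarrow> w = [] \<or> (\<exists>v. w = j # v \<and> strict_prefix v u)" for w
    by (auto simp: strict_prefix_def prefix_Cons)
  then show ?case using Cons.IH[of "\<lambda>w. l (j # w)"] Cons.prems by (auto simp: edge_point_Cons)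
qed

definition base_height :: "(nat list \<Rightarrow> real) \<Rightarrow> nat list \<Rightarrow> real" where
  "base_height l u = (\<Sum>w\<in>{w. strict_prefix w u}. l w)"

lemma strict_prefixes_snoc: "{w. strict_prefix w (u @ [i])} = insert u {w. strict_prefix w u}"
  by (auto simp: strict_prefix_def)

lemma finite_strict_prefixes [simp]: "finite {w. strict_prefix w u}"
  by (rule finite_subset[OF _ finite_prefixes[of u]]) auto

lemma base_height_snoc: "base_height l (u @ [i]) = base_height l u + l u"
  by (simp add: base_height_def strict_prefixes_snoc)

lemma base_height_Nil [simp]: "base_height l [] = 0"
  by (simp add: base_height_def)

lemma base_height_Cons: "base_height l (j # u) = l [] + base_height (\<lambda>w. l (j # w)) u"
proof (induction u rule: rev_induct)
  case Nil
  show ?case using base_height_snoc[of l "[]" j] by simp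
next
  case (snoc i u)
  then show ?case using base_height_snoc[of l "j # u" i] base_height_snoc[of "\<lambda>w. l (j # w)" u i] by simp
qed

lemma meet_append_append:
  assumes "edge_point l (u @ v, s)" "edge_point l (u @ v', s')"
  shows "meet l (u @ v, s) (u @ v', s') = base_height l u + meet (\<lambda>w. l (u @ w)) (v, s) (v', s')"
  using assms
proof (induction u arbitrary: l)
  case Nil
  then show ?case by simp
next
  case (Cons j u)
  then show ?case using meet_Cons_Cons[of l j "u @ v" s j "u @ v'" s'] Cons.IH[of "\<lambda>w. l (j # w)"]
    by (simp add: edge_point_Cons base_height_Cons)
qed

section \<open>Finite metric trees as compact rooted real trees\<close>

locale finite_metric_tree =
  fixes N :: "nat list \<Rightarrow> nat" and l :: "nat list \<Rightarrow> real"
  assumes finite_family: "finite (family N)"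
    and length_pos: "u \<in> family N \<Longrightarrow> 0 < l u"
begin

abbreviation "points \<equiv> insert ([], 0) (tree_points N l)"

lemma edge_point: "x \<in> points \<Longrightarrow> edge_point l x"
  using length_pos family_prefix length_pos[OF family.intros(1)]
  by (auto simp: edge_point_def tree_points_def strict_prefix_def)

lemma Metric_space: "Metric_space points (path_dist l)"
proof
  show "0 \<le> path_dist l x y" for x y by (simp add: path_dist_def sum_nonneg)
  show "path_dist l x y = path_dist l y x" for x y
    by (simp add: path_dist_def abs_minus_commute disj_commute)
  have pos: "0 < snd x \<or> x = ([], 0)" if "x \<in> points" for x
    using that by (auto simp: tree_points_def)
  show "(path_dist l x y = 0) = (x = y)" if "x \<in> points" "y \<in> points" for x y
    using path_dist_eq_0[OF edge_point edge_point pos pos, OF that that] by (auto simp: path_dist_def)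
  show "path_dist l x z \<le> path_dist l x y + path_dist l y z" if "x \<in> points" "y \<in> points" "z \<in> points" for x y z
  proof -
    note e = that[THEN edge_point]
    show ?thesis
      unfolding path_dist_meet[OF e(1,3)] path_dist_meet[OF e(1,2)] path_dist_meet[OF e(2,3)]
      using meet_ultrametric[OF e] meet_le[of l y x] meet_le[of l y z] meet_commute[OF e(1,2)] by linarith
  qed
qed

definition "M = metric (points, path_dist l)"

lemma metric_tree_eq: "metric_tree N l = (M, ([], 0))"
  by (simp add: metric_tree_def M_def tree_points_def)

lemma mspace_M [simp]: "mspace M = points"
  unfolding M_def by (rule Metric_space.mspace_metric[OF Metric_space])

lemma mdist_M: "mdist M = path_dist l"
  unfolding M_def by (rule Metric_space.mdist_metric[OF Metric_space])

lemma root_edge_point: "edge_point l ([], 0)"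
  using edge_point by simp

lemma mdist_root: "x \<in> points \<Longrightarrow> mdist M ([], 0) x = meet l x x"
  unfolding mdist_M path_dist_meet[OF root_edge_point edge_point]
  using meet_root[OF edge_point] meet_root[OF root_edge_point] by simp

lemma gprod_M: "\<lbrakk>x \<in> points; y \<in> points\<rbrakk> \<Longrightarrow> gprod M ([], 0) x y = meet l x y"
  unfolding gprod_def mdist_root using mdist_M path_dist_meet[OF edge_point edge_point] by simp

lemma meet_kernel_points: "meet_kernel (meet l) points"
  unfolding meet_kernel_def
proof (intro conjI ballI impI)
  fix x y assume xy: "x \<in> points" "y \<in> points"
  show "meet l x y = meet l y x" "meet l x y \<le> meet l x x"
    using meet_commute edge_point xy meet_le by auto
  assume "meet l x x = meet l x y \<and> meet l y y = meet l x y"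
  then have "mdist M x y = 0" using path_dist_meet[OF edge_point edge_point] xy by (simp add: mdist_M)
  then show "x = y" using xy mdist_zero[of x M y] by simp
next
  fix x y z assume "x \<in> points" "y \<in> points" "z \<in> points"
  then show "min (meet l x y) (meet l y z) \<le> meet l x z"
    by (intro meet_ultrametric edge_point)
qed

end

lemma covered_Nil_pos: "edge_point l x \<Longrightarrow> 0 < snd x \<Longrightarrow> 0 < covered l x []"
  by (cases "fst x") (auto simp: covered_def edge_point_def)

lemma meet_pos:
  assumes "edge_point l x" "edge_point l y" "0 < snd x" "0 < snd y"
  shows "0 < meet l x y"
  unfolding meet_def
  by (rule sum_pos2[of _ "[]"])
     (use assms covered_Nil_pos covered_nonneg in \<open>auto simp: min.bounded_iff\<close>)

text \<open>\<open>meet l x y\<close> is termwise at most \<open>meet l x x\<close>, so equality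
  holds in every term, in particular on the last edge of x.\<close>

lemma covered_le_of_meet_eq:
  assumes "meet l x y = meet l x x"
  shows "snd x \<le> covered l y (fst x)"
proof -
  have "(\<Sum>w\<in>{w. prefix w (fst x)}. covered l x w - min (covered l x w) (covered l y w)) = 0"
    using assms by (simp add: meet_self sum_subtractf) (simp add: meet_def)
  then have "covered l x (fst x) - min (covered l x (fst x)) (covered l y (fst x)) = 0"
    by (subst (asm) sum_nonneg_eq_0_iff) auto
  then show ?thesis by (simp add: covered_def min_def split: if_splits)
qed

lemma meet_eq_of_covered_le:
  assumes "\<And>w. covered l x w \<le> covered l y w"
  shows "meet l x y = meet l x x"
  using assms by (simp add: meet_def min_absorb1)

context finite_metric_tree begin

lemma tree_points_subset: "x \<in> tree_points N l \<Longrightarrow> x \<in> points"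
  by simp

lemma desc_iff_meet:
  assumes "x \<in> points" "y \<in> points"
  shows "y \<in> desc M ([], 0) x \<longleftrightarrow> meet l x y = meet l x x"
  using assms mdist_root[of x] mdist_root[of y] path_dist_meet[OF assms[THEN edge_point]]
  by (auto simp: desc_def mdist_M)

lemma desc_iff:
  assumes x: "x \<in> tree_points N l" and y: "y \<in> points"
  shows "y \<in> desc M ([], 0) x \<longleftrightarrow> fst x = fst y \<and> snd x \<le> snd y \<or> strict_prefix (fst x) (fst y)"
proof -
  have x1: "0 < snd x" "snd x \<le> l (fst x)" using x by (auto simp: tree_points_def)
  show ?thesis
    unfolding desc_iff_meet[OF tree_points_subset[OF x] y]
  proof
    assume "meet l x y = meet l x x"
    then have "snd x \<le> covered l y (fst x)" by (rule covered_le_of_meet_eq)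
    then show "fst x = fst y \<and> snd x \<le> snd y \<or> strict_prefix (fst x) (fst y)"
      using x1 by (auto simp: covered_def split: if_splits)
  next
    assume *: "fst x = fst y \<and> snd x \<le> snd y \<or> strict_prefix (fst x) (fst y)"
    have "covered l x w \<le> covered l y w" for w
    proof (cases "strict_prefix w (fst x)")
      case True
      then have "strict_prefix w (fst y)" using * by (auto intro: prefix_order.less_trans)
      then show ?thesis using True by (auto simp: covered_def)
    next
      case False
      then show ?thesis
        using * x1 covered_nonneg[OF edge_point[OF y], of w] by (auto simp: covered_def split: if_splits)
    qed
    then show "meet l x y = meet l x x" by (rule meet_eq_of_covered_le)
  qed
qed

lemma meet_self_eq: "(u, s) \<in> tree_points N l \<Longrightarrow> meet l (u, s) (u, s) = base_height l u + s"
proof -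
  assume "(u, s) \<in> tree_points N l"
  then have e: "edge_point l (u @ [], s)" using edge_point tree_points_subset by simp
  have "edge_point (\<lambda>w. l (u @ w)) ([], s)" using e by (simp add: edge_point_def)
  then have "meet (\<lambda>w. l (u @ w)) ([], s) ([], s) = s" by (simp add: meet_Nil covered_def)
  then show ?thesis using meet_append_append[OF e e] by simp
qed

text \<open>The lower end of the edge leading to u. The pair \<open>(u, 0)\<close> is no point of
  the tree unless u is empty; the top of the parent edge takes its place.\<close>

definition bottom :: "nat list \<Rightarrow> point" where
  "bottom u = (if u = [] then ([], 0) else (butlast u, l (butlast u)))"

lemma bottom_in: "u \<in> family N \<Longrightarrow> bottom u \<in> points"
proof (cases u rule: rev_cases)
  case (snoc v i)
  then show "u \<in> family N \<Longrightarrow> bottom u \<in> points"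
    using length_pos[of v] by (auto simp: bottom_def tree_points_def family_snoc)
qed (simp add: bottom_def)

lemma covered_bottom: "covered l (bottom u) w = covered l (u, 0) w"
  by (cases u rule: rev_cases) (auto simp: bottom_def covered_def strict_prefix_def)

lemma path_dist_edge:
  assumes "u \<in> family N" "0 \<le> s" "s \<le> l u" "0 \<le> t" "t \<le> l u"
  shows "path_dist l (if s = 0 then bottom u else (u, s)) (if t = 0 then bottom u else (u, t)) = \<bar>s - t\<bar>"
proof -
  define x where "x = (if s = 0 then bottom u else (u, s))"
  define y where "y = (if t = 0 then bottom u else (u, t))"
  have "covered l x w = covered l (u, s) w" "covered l y w = covered l (u, t) w" for w
    by (simp_all add: x_def y_def covered_bottom)
  then have c: "\<bar>covered l x w - covered l y w\<bar> = (if w = u then \<bar>s - t\<bar> else 0)" for w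
    by (simp add: covered_def)
  have p: "prefix (fst x) u" "prefix (fst y) u" by (auto simp: x_def y_def bottom_def prefixeq_butlast)
  have "path_dist l x y = (\<Sum>w\<in>{w. prefix w u}. \<bar>covered l x w - covered l y w\<bar>)"
    unfolding path_dist_def
  proof (rule sum.mono_neutral_left)
    show "{w. prefix w (fst x) \<or> prefix w (fst y)} \<subseteq> {w. prefix w u}"
      using p by (auto intro: prefix_order.trans)
    show "\<forall>w\<in>{w. prefix w u} - {w. prefix w (fst x) \<or> prefix w (fst y)}. \<bar>covered l x w - covered l y w\<bar> = 0"
      using covered_eq_0[of _ x l] covered_eq_0[of _ y l] by simp
  qed simp
  also have "\<dots> = \<bar>s - t\<bar>" by (simp add: c)
  finally show ?thesis by (simp add: x_def y_def)
qed

text \<open>The tree is a finite union of edges, and each edge, completed by its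
  \<open>bottom\<close>, is an isometric image of a compact interval.\<close>

lemma compact_space_M: "compact_space (mtopology_of M)"
proof -
  interpret MS: Metric_space "mspace M" "mdist M" by (rule Metric_space_mspace_mdist)
  define f where "f u s = (if s = 0 then bottom u else (u, s))" for u and s :: real
  have f_in: "f u s \<in> points" if "u \<in> family N" "0 \<le> s" "s \<le> l u" for u s
    using bottom_in that by (auto simp: f_def tree_points_def)
  have d: "mdist M (f u s) (f u t) = \<bar>s - t\<bar>" if "u \<in> family N" "0 \<le> s" "s \<le> l u" "0 \<le> t" "t \<le> l u" for u s t
    using path_dist_edge[OF that] by (simp add: mdist_M f_def)
  have "compactin (mtopology_of M) (f u ` {0..l u})" if u: "u \<in> family N" for u
  proof (rule image_compactin)
    show "compactin (top_of_set {0..l u}) {0..l u}"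
      by (simp add: compactin_subtopology compactin_euclidean_iff)
    show "continuous_map (top_of_set {0..l u}) (mtopology_of M) (f u)"
      unfolding mtopology_of_def MS.continuous_map_to_metric
    proof (intro ballI allI impI)
      fix s e :: real assume s: "s \<in> topspace (top_of_set {0..l u})" and "0 < e"
      have "openin (top_of_set {0..l u}) ({0..l u} \<inter> ball s e)" by (simp add: openin_open_Int)
      moreover have "\<forall>t\<in>{0..l u} \<inter> ball s e. f u t \<in> MS.mball (f u s) e"
        unfolding MS.in_mball using f_in[OF u] d[OF u] s by (auto simp: dist_real_def)
      ultimately show "\<exists>U. openin (top_of_set {0..l u}) U \<and> s \<in> U \<and> (\<forall>t\<in>U. f u t \<in> MS.mball (f u s) e)"
        using s \<open>0 < e\<close> by (intro exI[of _ "{0..l u} \<inter> ball s e"]) auto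
    qed
  qed
  then have "compactin (mtopology_of M) (\<Union>u\<in>family N. f u ` {0..l u})"
    using finite_family by (intro compactin_Union) auto
  also have "(\<Union>u\<in>family N. f u ` {0..l u}) = points"
  proof (intro equalityI subsetI)
    fix x assume "x \<in> points"
    then consider "x = ([], 0)" | u s where "x = (u, s)" "u \<in> family N" "0 < s" "s \<le> l u"
      by (auto simp: tree_points_def)
    then show "x \<in> (\<Union>u\<in>family N. f u ` {0..l u})"
    proof cases
      case 1
      then have "x = f [] 0" by (simp add: f_def bottom_def)
      then show ?thesis using family.intros(1) length_pos[OF family.intros(1)] by force
    next
      case 2
      then have "x = f u s" by (simp add: f_def)
      then show ?thesis using 2(2-4) by (intro UN_I[of u] image_eqI[of _ _ s]) auto
    qed
  next
    fix x assume "x \<in> (\<Union>u\<in>family N. f u ` {0..l u})"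
    then show "x \<in> points"
    proof (elim UN_E imageE)
      fix u s assume "u \<in> family N" "s \<in> {0..l u}" "x = f u s"
      then show "x \<in> points" using f_in[of u s] by (simp only: atLeastAtMost_iff)
    qed
  qed
  finally show ?thesis by (simp add: compact_space_def)
qed

text \<open>Induction along the label: the ancestor lies on the last edge or is an ancestor of the
  top of the edge below.\<close>

lemma ancestor_exists_M:
  assumes "x \<in> points" "0 \<le> t" "t \<le> mdist M ([], 0) x"
  shows "\<exists>y\<in>points. mdist M ([], 0) y = t \<and> mdist M y x = mdist M ([], 0) x - t"
proof (cases "t = 0")
  case True
  then show ?thesis using mdist_self[of "([], 0)" M] by (intro bexI[of _ "([], 0)"]) auto
next
  case False
  have "x \<noteq> ([], 0)" using False assms mdist_self[of "([], 0)" M] by auto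
  then obtain u s where us: "x = (u, s)" "(u, s) \<in> tree_points N l" using assms by (cases x) auto
  have "\<exists>y\<in>points. mdist M ([], 0) y = t \<and> mdist M y (u, s) = mdist M ([], 0) (u, s) - t"
    using us(2) assms(3) unfolding us(1)
  proof (induction u arbitrary: s rule: rev_induct)
    case Nil
    then have "(([], t) :: point) \<in> tree_points N l"
      using meet_self_eq[OF Nil(1)] mdist_root assms(2) False by (auto simp: tree_points_def)
    then show ?case
      using Nil path_dist_edge[of "[]" t s] False assms(2) meet_self_eq[of "[]"] mdist_root
      by (intro bexI[of _ "([], t)"]) (auto simp: tree_points_def mdist_M)
  next
    case (snoc i u)
    have h: "mdist M ([], 0) (u @ [i], s) = base_height l u + l u + s"
      using mdist_root[OF tree_points_subset[OF snoc(2)]] meet_self_eq[OF snoc(2)] by (simp add: base_height_snoc)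
    have f: "u @ [i] \<in> family N" "u \<in> family N" "0 < s" "s \<le> l (u @ [i])"
      using snoc(2) by (auto simp: tree_points_def family_snoc)
    have up: "(u, l u) \<in> tree_points N l" using f length_pos by (simp add: tree_points_def)
    have hu: "mdist M ([], 0) (u, l u) = base_height l u + l u"
      using mdist_root[OF tree_points_subset[OF up]] meet_self_eq[OF up] by simp
    show ?case
    proof (cases "t \<le> base_height l u + l u")
      case True
      obtain y where y: "y \<in> points" "mdist M ([], 0) y = t" "mdist M y (u, l u) = mdist M ([], 0) (u, l u) - t"
        using snoc(1)[OF up] hu True by auto
      have "mdist M (u, l u) (u @ [i], s) = s"
        using path_dist_edge[OF f(1), of 0 s] f by (simp add: mdist_M bottom_def)
      moreover have "mdist M y (u @ [i], s) \<le> mdist M y (u, l u) + mdist M (u, l u) (u @ [i], s)"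
        using y up snoc(2) by (intro mdist_triangle) auto
      moreover have "mdist M ([], 0) (u @ [i], s) \<le> mdist M ([], 0) y + mdist M y (u @ [i], s)"
        using y snoc(2) by (intro mdist_triangle) auto
      ultimately show ?thesis using y h hu by (intro bexI[of _ y]) auto
    next
      case False
      define r where "r = t - (base_height l u + l u)"
      have r: "0 < r" "r \<le> s" using False snoc(3) h by (auto simp: r_def)
      then have rp: "(u @ [i], r) \<in> tree_points N l" using f by (simp add: tree_points_def)
      have "mdist M ([], 0) (u @ [i], r) = t"
        using mdist_root[OF tree_points_subset[OF rp]] meet_self_eq[OF rp] by (simp add: base_height_snoc r_def)
      moreover have "mdist M (u @ [i], r) (u @ [i], s) = s - r"
        using path_dist_edge[OF f(1), of r s] f r by (simp add: mdist_M)
      ultimately show ?thesis using rp h by (intro bexI[of _ "(u @ [i], r)"]) (auto simp: r_def)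
    qed
  qed
  then show ?thesis using us by simp
qed

lemma compact_tree_M: "compact_tree M ([], 0)"
proof
  show "\<exists>y\<in>mspace M. mdist M ([], 0) y = t \<and> mdist M y x = mdist M ([], 0) x - t"
    if "x \<in> mspace M" "0 \<le> t" "t \<le> mdist M ([], 0) x" for x t
    using ancestor_exists_M that by simp
  show "min (gprod M ([], 0) x y) (gprod M ([], 0) y z) \<le> gprod M ([], 0) x z"
    if "x \<in> mspace M" "y \<in> mspace M" "z \<in> mspace M" for x y z
    using that by (simp only: mspace_M gprod_M) (intro meet_ultrametric edge_point)
qed (use compact_space_M in simp_all)

lemma subtree: "u \<in> family N \<Longrightarrow> finite_metric_tree (\<lambda>w. N (u @ w)) (\<lambda>w. l (u @ w))"
  using finite_family length_pos family_sub_finite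
  by (auto simp: finite_metric_tree_def family_append)

text \<open>Prefixing labels with u raises every meet by the constant
  \<open>base_height l u\<close>, so distances and the descendant relation are unchanged.\<close>

lemma descendant_embedding_subtree:
  assumes u: "u \<in> family N"
  shows "descendant_embedding (\<lambda>(v, s). (u @ v, s))
    (finite_metric_tree.M (\<lambda>w. N (u @ w)) (\<lambda>w. l (u @ w))) ([], 0) M ([], 0)"
proof -
  interpret S: finite_metric_tree "\<lambda>w. N (u @ w)" "\<lambda>w. l (u @ w)" using subtree[OF u] .
  let ?f = "\<lambda>(v, s). (u @ v, s) :: point"
  have S: "S.points - {([], 0)} = tree_points (\<lambda>w. N (u @ w)) (\<lambda>w. l (u @ w))"
    by (auto simp: tree_points_def)
  have f_in: "?f x \<in> tree_points N l \<longleftrightarrow> x \<in> tree_points (\<lambda>w. N (u @ w)) (\<lambda>w. l (u @ w))" for x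
    using u by (cases x) (simp add: tree_points_def family_append)
  have f_meet: "meet l (?f x) (?f y) = base_height l u + meet (\<lambda>w. l (u @ w)) x y"
    if "x \<in> tree_points (\<lambda>w. N (u @ w)) (\<lambda>w. l (u @ w))" "y \<in> tree_points (\<lambda>w. N (u @ w)) (\<lambda>w. l (u @ w))" for x y
    using that[THEN f_in[THEN iffD2]] meet_append_append edge_point tree_points_subset
    by (cases x, cases y) (simp add: split_beta)
  have root: "([], 0) \<notin> tree_points N' l'" for N' l' by (simp add: tree_points_def)
  show ?thesis
    unfolding descendant_embedding_def S.mspace_M mspace_M S
  proof (intro conjI ballI)
    fix x assume x: "x \<in> tree_points (\<lambda>w. N (u @ w)) (\<lambda>w. l (u @ w))"
    have fx: "?f x \<in> tree_points N l" using x f_in by blast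
    then show "?f x \<in> points - {([], 0)}" using root[of N l] by auto
    have dS: "y \<in> desc S.M ([], 0) x \<longleftrightarrow> ?f y \<in> desc M ([], 0) (?f x)"
      if y: "y \<in> tree_points (\<lambda>w. N (u @ w)) (\<lambda>w. l (u @ w))" for y
      using S.desc_iff_meet[OF S.tree_points_subset[OF x] S.tree_points_subset[OF y]]
        desc_iff_meet[OF tree_points_subset[OF fx] tree_points_subset[OF f_in[THEN iffD2, OF y]]]
        f_meet[OF x y] f_meet[OF x x] by simp
    show "?f ` desc S.M ([], 0) x = desc M ([], 0) (?f x)"
    proof (intro equalityI subsetI)
      fix z assume "z \<in> ?f ` desc S.M ([], 0) x"
      then obtain y where y: "y \<in> desc S.M ([], 0) x" "z = ?f y" by blast
      have "y \<noteq> ([], 0)"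
        using compact_tree.desc_not_root[OF S.compact_tree_M _ y(1)] x root by auto
      then have "y \<in> tree_points (\<lambda>w. N (u @ w)) (\<lambda>w. l (u @ w))"
        using y(1) by (simp add: desc_def)
      then show "z \<in> desc M ([], 0) (?f x)" using dS y by simp
    next
      fix z assume z: "z \<in> desc M ([], 0) (?f x)"
      have zp: "z \<in> points" using z by (simp add: desc_def)
      have "?f x \<noteq> ([], 0)" using fx root by metis
      then have "z \<noteq> ([], 0)"
        using compact_tree.desc_not_root[OF compact_tree_M _ z] fx by auto
      then have zt: "z \<in> tree_points N l" using zp by simp
      have "prefix (u @ fst x) (fst z)"
        using desc_iff[OF fx zp] z by (auto simp: split_beta strict_prefix_def)
      then obtain v where v: "fst z = u @ v" by (auto simp: prefix_def)
      have zf: "z = ?f (v, snd z)" using v by (simp add: prod_eq_iff)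
      then have "(v, snd z) \<in> tree_points (\<lambda>w. N (u @ w)) (\<lambda>w. l (u @ w))" using zt f_in by metis
      then have "(v, snd z) \<in> desc S.M ([], 0) x" using dS zf z by metis
      then show "z \<in> ?f ` desc S.M ([], 0) x" using zf by blast
    qed
    fix y assume y: "y \<in> tree_points (\<lambda>w. N (u @ w)) (\<lambda>w. l (u @ w))"
    show "mdist M (?f x) (?f y) = mdist S.M x y"
      unfolding mdist_M S.mdist_M
        path_dist_meet[OF edge_point[OF tree_points_subset[OF f_in[THEN iffD2, OF x]]]
          edge_point[OF tree_points_subset[OF f_in[THEN iffD2, OF y]]]]
        path_dist_meet[OF S.edge_point[OF S.tree_points_subset[OF x]] S.edge_point[OF S.tree_points_subset[OF y]]]
      using f_meet[OF x x] f_meet[OF y y] f_meet[OF x y] by simp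
  qed
qed

end

section \<open>Pruned metric trees\<close>

lemma genealogy_shift: "genealogy N v t \<Longrightarrow> v = u @ v' \<Longrightarrow> genealogy (\<lambda>w. N (u @ w)) v' t"
proof (induction arbitrary: v' rule: genealogy.induct)
  case (1 v ts)
  have "genealogy (\<lambda>w. N (u @ w)) v' (Node (image_mset ts (mset_set {..<N (u @ v')})))"
    by (rule genealogy.intros) (use 1 in auto)
  then show ?case using 1 by simp
qed

lemma genealogy_unshift: "genealogy (\<lambda>w. N (u @ w)) v t \<Longrightarrow> genealogy N (u @ v) t"
proof (induction rule: genealogy.induct)
  case (1 v ts)
  have "genealogy N (u @ v) (Node (image_mset ts (mset_set {..<N (u @ v)})))"
    by (rule genealogy.intros) (use 1 in auto)
  then show ?case .
qed

lemma genealogy_sub: "genealogy N [i] t \<longleftrightarrow> genealogy (\<lambda>w. N (i # w)) [] t"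
  using genealogy_shift[of N "[i]" t "[i]" "[]"] genealogy_unshift[of N "[i]" "[]" t] by auto

lemma genealogy_unique: "genealogy N u t \<Longrightarrow> genealogy N u t' \<Longrightarrow> t = t'"
proof (induction arbitrary: t' rule: genealogy.induct)
  case (1 u ts)
  from 1(3) obtain ts' where t': "t' = Node (image_mset ts' (mset_set {..<N u}))"
    "\<And>i. i < N u \<Longrightarrow> genealogy N (u @ [i]) (ts' i)" by (cases rule: genealogy.cases) auto
  have "image_mset ts (mset_set {..<N u}) = image_mset ts' (mset_set {..<N u})"
    using 1(2) t'(2) by (intro image_mset_cong) auto
  then show ?case using t' by simp
qed

lemma planted_tree_eq: "finite (family N) \<Longrightarrow> genealogy N [] t \<Longrightarrow> planted_tree N = Node {#t#}"
  unfolding planted_tree_def using genealogy_unique by (simp add: the_equality)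

lemma family_sub_psubset:
  assumes "i < N []"
  shows "(#) i ` family (\<lambda>w. N (i # w)) \<subset> family N"
proof
  show "(#) i ` family (\<lambda>w. N (i # w)) \<subseteq> family N" using assms by (auto simp: family_Cons)
  show "(#) i ` family (\<lambda>w. N (i # w)) \<noteq> family N" using family.intros(1)[of N] by auto
qed

text \<open>The family of a child, prefixed with the number of the child, is a proper subset of the
  whole family, so the cardinality decreases. The induction runs over samples \<omega>, whose marks
  may carry more than offspring numbers.\<close>

lemma finite_family_induct [consumes 1]:
  fixes \<omega> :: "nat list \<Rightarrow> 's" and \<nu> :: "'s \<Rightarrow> nat"
  assumes fin: "finite (family (\<nu> \<circ> \<omega>))"
    and step: "\<And>\<omega>. (\<And>i. i < \<nu> (\<omega> []) \<Longrightarrow> P (\<lambda>w. \<omega> (i # w))) \<Longrightarrow> P \<omega>"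
  shows "P \<omega>"
  using fin
proof (induction "card (family (\<nu> \<circ> \<omega>))" arbitrary: \<omega> rule: less_induct)
  case less
  show ?case
  proof (rule step)
    fix i assume i: "i < \<nu> (\<omega> [])"
    have eq: "\<nu> \<circ> (\<lambda>w. \<omega> (i # w)) = (\<lambda>w. (\<nu> \<circ> \<omega>) (i # w))" by auto
    have ps: "(#) i ` family (\<nu> \<circ> (\<lambda>w. \<omega> (i # w))) \<subset> family (\<nu> \<circ> \<omega>)"
      unfolding eq using i by (intro family_sub_psubset) simp
    have "card (family (\<nu> \<circ> (\<lambda>w. \<omega> (i # w)))) < card (family (\<nu> \<circ> \<omega>))"
      using psubset_card_mono[OF less(2) ps] by (simp add: card_image)
    moreover have "finite (family (\<nu> \<circ> (\<lambda>w. \<omega> (i # w))))"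
      using finite_subset[OF psubset_imp_subset[OF ps] less(2)] by (rule finite_imageD) simp
    ultimately show "P (\<lambda>w. \<omega> (i # w))" using less(1) by blast
  qed
qed

text \<open>
  The shape left after discarding the subtrees outside \<open>E\<close>.  If \<open>b\<close> holds, a vertex with exactly one
  surviving child is removed by merging its two adjacent edges.
\<close>

inductive pruned_shape :: "bool \<Rightarrow> ('s \<Rightarrow> nat) \<Rightarrow> (nat list \<Rightarrow> 's) set \<Rightarrow> (nat list \<Rightarrow> 's) \<Rightarrow> ctree \<Rightarrow> bool"
  for b \<nu> E where
  node: "\<lbrakk>I = {i. i < \<nu> (\<omega> []) \<and> (\<lambda>w. \<omega> (i # w)) \<in> E}; b \<Longrightarrow> card I \<noteq> 1;
    \<And>i. i \<in> I \<Longrightarrow> pruned_shape b \<nu> E (\<lambda>w. \<omega> (i # w)) (ts i)\<rbrakk> \<Longrightarrow>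
   pruned_shape b \<nu> E \<omega> (Node (image_mset ts (mset_set I)))"
| merge: "\<lbrakk>b; {i. i < \<nu> (\<omega> []) \<and> (\<lambda>w. \<omega> (i # w)) \<in> E} = {j}; pruned_shape b \<nu> E (\<lambda>w. \<omega> (j # w)) t\<rbrakk> \<Longrightarrow>
   pruned_shape b \<nu> E \<omega> t"

lemma pruned_shape_unique:
  "pruned_shape b \<nu> E \<omega> t \<Longrightarrow> pruned_shape b \<nu> E \<omega> t' \<Longrightarrow> t = t'"
proof (induction arbitrary: t' rule: pruned_shape.induct)
  case (node I \<omega> ts)
  note I = node.hyps(1) and IH = node.IH and card = node.hyps(2)
  from node.prems show ?case
  proof (cases rule: pruned_shape.cases)
    case (node I' ts')
    have "I' = I" using node(2) I by simp
    have "image_mset ts (mset_set I) = image_mset ts' (mset_set I)"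
    proof (rule image_mset_cong)
      fix i assume "i \<in># mset_set I"
      then have "i \<in> I" using I by simp
      then show "ts i = ts' i" using IH node(4) \<open>I' = I\<close> by blast
    qed
    then show ?thesis using node(1) \<open>I' = I\<close> by simp
  next
    case (merge j)
    then have "card I = 1" using I by simp
    then show ?thesis using merge(1) card by simp
  qed
next
  case (merge \<omega> j t)
  note b = merge.hyps(1) and j = merge.hyps(2) and IH = merge.IH
  from merge.prems show ?case
  proof (cases rule: pruned_shape.cases)
    case (node I' ts')
    then have "card I' = 1" using j by simp
    then show ?thesis using node(3) b by simp
  next
    case (merge j')
    then have "j' = j" using j by simp
    then show ?thesis using IH merge(3) by simp
  qed
qed

lemma pruned_shape_exists:
  fixes \<omega> :: "nat list \<Rightarrow> 's"
  assumes "finite (family (\<nu> \<circ> \<omega>))"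
  shows "\<exists>t. pruned_shape b \<nu> E \<omega> t"
  using assms
proof (induction rule: finite_family_induct)
  case (1 \<omega>)
  define I where "I = {i. i < \<nu> (\<omega> []) \<and> (\<lambda>w. \<omega> (i # w)) \<in> E}"
  have "\<forall>i\<in>I. \<exists>t. pruned_shape b \<nu> E (\<lambda>w. \<omega> (i # w)) t" using 1 by (simp add: I_def)
  from bchoice[OF this] obtain ts
    where ts: "\<And>i. i \<in> I \<Longrightarrow> pruned_shape b \<nu> E (\<lambda>w. \<omega> (i # w)) (ts i)" by blast
  show ?case
  proof (cases "b \<and> card I = 1")
    case True
    then obtain j where "I = {j}" by (auto simp: card_1_singleton_iff)
    then show ?thesis using pruned_shape.merge[of b \<nu> \<omega> E j] ts[of j] True by (auto simp: I_def)
  next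
    case False
    then show ?thesis using pruned_shape.node[of I \<nu> \<omega> E b ts] ts I_def by blast
  qed
qed

text \<open>Keeping every subtree and merging nothing gives the plain genealogy, so results on
  \<open>pruned_shape\<close> also serve the Galton-Watson measure.\<close>

lemma genealogy_iff_pruned_shape:
  "genealogy (\<nu> \<circ> \<omega>) [] t \<longleftrightarrow> pruned_shape False \<nu> UNIV \<omega> t"
proof
  have "pruned_shape False \<nu> UNIV \<omega> t" if "genealogy N u t" "N = (\<lambda>w. \<nu> (\<omega>' w))" "\<omega> = (\<lambda>w. \<omega>' (u @ w))" for N u t and \<omega>' \<omega> :: "nat list \<Rightarrow> 'a"
    using that
  proof (induction arbitrary: \<omega> rule: genealogy.induct)
    case (1 u ts)
    have "pruned_shape False \<nu> UNIV \<omega> (Node (image_mset ts (mset_set {..<N u})))"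
      by (rule pruned_shape.node) (use 1 in auto)
    then show ?case .
  qed
  from this[of "\<nu> \<circ> \<omega>" "[]" t \<omega> \<omega>] show "genealogy (\<nu> \<circ> \<omega>) [] t \<Longrightarrow> pruned_shape False \<nu> UNIV \<omega> t"
    by (simp add: comp_def)
next
  show "pruned_shape False \<nu> UNIV \<omega> t \<Longrightarrow> genealogy (\<nu> \<circ> \<omega>) [] t"
  proof (induction rule: pruned_shape.induct)
    case (node I \<omega> ts)
    have I: "I = {..<(\<nu> \<circ> \<omega>) []}" using node(1) by auto
    have "genealogy (\<nu> \<circ> \<omega>) [] (Node (image_mset ts (mset_set {..<(\<nu> \<circ> \<omega>) []})))"
    proof (rule genealogy.intros)
      fix i assume "i < (\<nu> \<circ> \<omega>) []"
      then have "i \<in> I" using I by simp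
      then show "genealogy (\<nu> \<circ> \<omega>) ([] @ [i]) (ts i)"
        using node.IH[of i] by (simp add: genealogy_sub comp_def)
    qed
    then show ?case using I by (simp add: comp_def)
  qed simp
qed

text \<open>A reduced tree has no vertex with exactly one child, so the case of a merge never
  occurs.\<close>

lemma pruned_shape_of_reduced:
  "pruned_shape False \<nu> UNIV \<omega> t \<Longrightarrow> reduced t \<Longrightarrow> pruned_shape True \<nu> UNIV \<omega> t"
proof (induction rule: pruned_shape.induct)
  case (node I \<omega> ts)
  have fin: "finite I" using node(1) by simp
  have r: "size (image_mset ts (mset_set I)) \<noteq> 1" "\<And>i. i \<in> I \<Longrightarrow> reduced (ts i)"
    using node.prems fin by (auto elim: reduced.cases)
  show ?case by (rule pruned_shape.node) (use node r in auto)
qed simp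

text \<open>\<open>c u\<close> is the length of the kept initial piece of the edge to u;
  \<open>cut_full\<close> expresses downward closure across a vertex.\<close>

locale pruned_metric_tree = finite_metric_tree +
  fixes c :: "nat list \<Rightarrow> real"
  assumes cut_nonneg: "u \<in> family N \<Longrightarrow> 0 \<le> c u" and cut_le: "u \<in> family N \<Longrightarrow> c u \<le> l u"
    and cut_full: "u @ [i] \<in> family N \<Longrightarrow> 0 < c (u @ [i]) \<Longrightarrow> c u = l u"
begin

definition branch :: "nat list \<Rightarrow> point set" where
  "branch u = {(v, s). v \<in> family N \<and> prefix u v \<and> 0 < s \<and> s \<le> c v}"

lemma branch_tree_points: "branch u \<subseteq> tree_points N l"
  using cut_le by (force simp: branch_def tree_points_def)

lemma cut_prefix: "u @ v \<in> family N \<Longrightarrow> 0 < c (u @ v) \<Longrightarrow> v \<noteq> [] \<Longrightarrow> c u = l u"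
proof (induction v rule: rev_induct)
  case (snoc i v)
  have v: "u @ v \<in> family N" "c (u @ v) = l (u @ v)"
    using snoc cut_full[of "u @ v" i] by (auto simp: family_snoc simp flip: append_assoc)
  show ?case
  proof (cases "v = []")
    case False
    then show ?thesis using snoc v length_pos[of "u @ v"] by simp
  qed (use v in simp)
qed simp

lemma branch_cases:
  assumes "x \<in> branch u"
  obtains (stem) s where "x = (u, s)" "0 < s" "s \<le> c u"
  | (above) i where "x \<in> branch (u @ [i])" "i < N u" "0 < c (u @ [i])" "c u = l u"
proof -
  obtain v s where x: "x = (u @ v, s)" "u @ v \<in> family N" "0 < s" "s \<le> c (u @ v)"
    using assms by (auto simp: branch_def prefix_def)
  show ?thesis
  proof (cases v)
    case Nil
    then show ?thesis using x stem by simp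
  next
    case (Cons i w)
    have f: "u @ [i] \<in> family N" using x Cons family_prefix by (metis append_Cons append_Nil append_assoc prefixI)
    have "0 < c (u @ [i])"
    proof (cases "w = []")
      case False
      then have "c (u @ [i]) = l (u @ [i])" using cut_prefix[of "u @ [i]" w] x Cons by simp
      then show ?thesis using length_pos f by simp
    qed (use x Cons in simp)
    moreover have "x \<in> branch (u @ [i])" using x Cons by (auto simp: branch_def)
    ultimately show ?thesis using above[of i] f cut_full[OF f] by (simp add: family_snoc)
  qed
qed

lemma branch_mono: "prefix u v \<Longrightarrow> branch v \<subseteq> branch u"
  by (auto simp: branch_def intro: prefix_order.trans)

lemma edge_point_branch: "x \<in> branch u \<Longrightarrow> edge_point l x"
  using branch_tree_points edge_point by blast

lemma meet_stem:
  assumes "x \<in> branch u" "fst x = u" "y \<in> branch u"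
  shows "meet l x y = base_height l u + min (snd x) (if fst y = u then snd y else l u)"
    and "meet l y x = base_height l u + min (snd x) (if fst y = u then snd y else l u)"
proof -
  obtain s where x: "x = (u @ [], s)" using assms by (cases x) auto
  obtain v s' where y: "y = (u @ v, s')" using assms by (cases y) (auto simp: branch_def prefix_def)
  have e: "edge_point l (u @ [], s)" "edge_point l (u @ v, s')"
    using edge_point_branch[OF assms(1)] edge_point_branch[OF assms(3)] x y by simp_all
  have p: "v = [] \<or> 0 < l u"
    using assms(3) y length_pos[of u] family_prefix[of "u @ v" N u] by (auto simp: branch_def)
  have "edge_point (\<lambda>w. l (u @ w)) (v, s')" using e(2) unfolding edge_point_append[of v l u, OF p] by (rule conjunct2)
  then show *: "meet l x y = base_height l u + min (snd x) (if fst y = u then snd y else l u)"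
    using meet_append_append[OF e] x y by (cases v) (auto simp: meet_Nil covered_def)
  show "meet l y x = base_height l u + min (snd x) (if fst y = u then snd y else l u)"
    unfolding *[symmetric] by (rule meet_commute[OF edge_point_branch[OF assms(3)] edge_point_branch[OF assms(1)]])
qed

lemma meet_above:
  assumes "x \<in> branch (u @ [i])" "y \<in> branch (u @ [j])"
  shows "if i = j then base_height l u + l u < meet l x y else meet l x y = base_height l u + l u"
proof -
  obtain v s where x: "x = (u @ i # v, s)" "0 < s"
  proof -
    obtain w s where "x = (w, s)" by (cases x)
    moreover from this obtain v where "w = (u @ [i]) @ v" using assms(1) by (auto simp: branch_def elim: prefixE)
    ultimately show ?thesis using assms(1) that[of v s] by (simp add: branch_def)
  qed
  obtain v' s' where y: "y = (u @ j # v', s')" "0 < s'"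
  proof -
    obtain w s where "y = (w, s)" by (cases y)
    moreover from this obtain v where "w = (u @ [j]) @ v" using assms(2) by (auto simp: branch_def elim: prefixE)
    ultimately show ?thesis using assms(2) that[of v s] by (simp add: branch_def)
  qed
  have u: "u \<in> family N" using assms(1) family_prefix[of "u @ i # v" N u] x by (simp add: branch_def)
  have e: "edge_point l (u @ i # v, s)" "edge_point l (u @ j # v', s')"
    using edge_point_branch[OF assms(1)] edge_point_branch[OF assms(2)] x y by simp_all
  have e': "edge_point (\<lambda>w. l (u @ w)) (i # v, s)" "edge_point (\<lambda>w. l (u @ w)) (j # v', s')"
    using e length_pos[OF u] by (simp_all add: edge_point_append)
  have "meet l x y = base_height l u + (l u + (if i = j then meet (\<lambda>w. l (u @ i # w)) (v, s) (v', s') else 0))"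
    using meet_append_append[OF e] meet_Cons_Cons[OF e'] x y by simp
  moreover have "0 < meet (\<lambda>w. l (u @ i # w)) (v, s) (v', s')" if "i = j"
    using e' that x y by (intro meet_pos) (auto simp: edge_point_Cons)
  ultimately show ?thesis by auto
qed

lemma branch_height:
  assumes x: "x \<in> branch u"
  shows "base_height l u < meet l x x"
  using x
proof (cases rule: branch_cases)
  case (stem s)
  then show ?thesis using meet_stem(1)[of x u x] x by simp
next
  case (above i)
  have "0 < l u" using x length_pos[of u] family_prefix[of _ N u] by (force simp: branch_def)
  then show ?thesis using meet_above[OF above(1) above(1)] by simp
qed

text \<open>If the edge to u is cut before its end, both sides are empty, because
  \<open>cut_full\<close> leaves no child. Otherwise the points above the end are separated by the
  child they descend from, as meets across different children have exactly the height of the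
  end.\<close>

lemma branches_branch:
  assumes u: "u \<in> family N"
  shows "branches (meet l) (base_height l u + c u) (branch u) =
    (\<lambda>i. branch (u @ [i])) ` {i. i < N u \<and> 0 < c (u @ [i])}"
proof (intro equalityI subsetI)
  have cls: "{y \<in> branch u. base_height l u + l u < meet l x y} = branch (u @ [i])"
    if "x \<in> branch (u @ [i])" for x i
  proof (intro equalityI subsetI)
    fix y assume y: "y \<in> {y \<in> branch u. base_height l u + l u < meet l x y}"
    then have "y \<in> branch u" by simp
    then show "y \<in> branch (u @ [i])"
    proof (cases rule: branch_cases)
      case (stem s)
      have "x \<in> branch u" using that branch_mono[of u "u @ [i]"] by auto
      then have "meet l x y \<le> base_height l u + s"
        using meet_stem(2)[of y u x] y stem by simp
      then show ?thesis using y stem cut_le[OF u] by simp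
    next
      case (above j)
      then show ?thesis using meet_above[OF that above(1)] y by (auto split: if_splits)
    qed
  next
    fix y assume "y \<in> branch (u @ [i])"
    then show "y \<in> {y \<in> branch u. base_height l u + l u < meet l x y}"
      using meet_above[OF that, of y i] branch_mono[of u "u @ [i]"] by auto
  qed
  {
    fix C assume "C \<in> branches (meet l) (base_height l u + c u) (branch u)"
    then obtain x where x: "x \<in> branch u" "base_height l u + c u < meet l x x"
      "C = {y \<in> branch u. base_height l u + c u < meet l x y}" by (auto simp: branches_def)
    from x(1) show "C \<in> (\<lambda>i. branch (u @ [i])) ` {i. i < N u \<and> 0 < c (u @ [i])}"
    proof (cases rule: branch_cases)
      case (stem s)
      then show ?thesis using x meet_stem(1)[of x u x] by simp
    next
      case (above i)
      then show ?thesis using x(3) cls[OF above(1)] by auto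
    qed
  next
    fix C assume "C \<in> (\<lambda>i. branch (u @ [i])) ` {i. i < N u \<and> 0 < c (u @ [i])}"
    then obtain i where i: "i < N u" "0 < c (u @ [i])" "C = branch (u @ [i])" by auto
    have ui: "u @ [i] \<in> family N" using i u by (simp add: family_snoc)
    define x where "x = (u @ [i], c (u @ [i]))"
    have x: "x \<in> branch (u @ [i])" using ui i by (simp add: x_def branch_def)
    have full: "c u = l u" using cut_full[OF ui] i by simp
    have "x \<in> branch u" using x branch_mono[of u "u @ [i]"] by auto
    moreover have "base_height l u + c u < meet l x x" using meet_above[OF x x] full by simp
    ultimately show "C \<in> branches (meet l) (base_height l u + c u) (branch u)"
      using cls[OF x] i(3) full unfolding branches_def by (intro image_eqI[of _ _ x]) auto
  }
qed

lemma inj_branch: "inj_on (\<lambda>i. branch (u @ [i])) {i. i < N u \<and> 0 < c (u @ [i])}" if u: "u \<in> family N"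
proof (rule inj_onI)
  fix i j assume ij: "i \<in> {i. i < N u \<and> 0 < c (u @ [i])}" "branch (u @ [i]) = branch (u @ [j])"
  have "(u @ [i], c (u @ [i])) \<in> branch (u @ [i])" using ij(1) u by (simp add: branch_def family_snoc)
  then have "(u @ [i], c (u @ [i])) \<in> branch (u @ [j])" using ij(2) by simp
  then have "prefix (u @ [j]) (u @ [i])" by (simp add: branch_def)
  then show "i = j" by simp
qed

text \<open>The sample \<omega> descends to subtrees while N, l and c keep describing the whole
  tree; the label u connects the two. A \<open>node\<close> ends the stem at height
  \<open>base_height l u + c u\<close>, also when the edge is cut inside and I is empty; a
  \<open>merge\<close> absorbs the edge to u into the stem of its only surviving child.\<close>

lemma branch_shape_branch:
  fixes \<omega> :: "nat list \<Rightarrow> 's" and \<nu> :: "'s \<Rightarrow> nat"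
  assumes t: "pruned_shape True \<nu> E \<omega> t" and "\<omega> = (\<lambda>w. \<omega>\<^sub>0 (u @ w))"
    and N: "N = \<nu> \<circ> \<omega>\<^sub>0"
    and E: "\<And>u. u \<in> family N \<Longrightarrow> (\<lambda>w. \<omega>\<^sub>0 (u @ w)) \<in> E \<longleftrightarrow> 0 < c u"
    and "u \<in> family N" "0 < c u"
  shows "branch_shape (meet l) (base_height l u) (branch u) t"
  using t assms(2,5,6)
proof (induction arbitrary: u rule: pruned_shape.induct)
  case (node I \<omega> ts)
  let ?c = "base_height l u + c u"
  have I: "I = {i. i < N u \<and> 0 < c (u @ [i])}"
  proof -
    have "(\<lambda>w. \<omega> (i # w)) \<in> E \<longleftrightarrow> 0 < c (u @ [i])" if "i < N u" for i
      using E[of "u @ [i]"] node.prems that by (simp add: family_snoc)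
    moreover have "\<nu> (\<omega> []) = N u" using node.prems N by simp
    ultimately show ?thesis using node(1) by auto
  qed
  have br: "branches (meet l) ?c (branch u) = (\<lambda>i. branch (u @ [i])) ` I"
    using branches_branch[OF node.prems(2)] I by simp
  have inj: "inj_on (\<lambda>i. branch (u @ [i])) I" using inj_branch[OF node.prems(2)] I by simp
  define \<tau> where "\<tau> C = ts (inv_into I (\<lambda>i. branch (u @ [i])) C)" for C
  have \<tau>: "\<tau> (branch (u @ [i])) = ts i" if "i \<in> I" for i
    using inv_into_f_f[OF inj that] by (simp add: \<tau>_def)
  have fin: "finite I" using I by simp
  have "branch_shape (meet l) (base_height l u) (branch u)
      (Node (image_mset \<tau> (mset_set (branches (meet l) ?c (branch u)))))"
  proof (rule branch_shape.intros)
    show "base_height l u < ?c" using node.prems by simp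
    show "\<exists>x\<in>branch u. meet l x x = s" if "base_height l u < s" "s \<le> ?c" for s
    proof (rule bexI[of _ "(u, s - base_height l u)"])
      show *: "(u, s - base_height l u) \<in> branch u" using that node.prems by (simp add: branch_def)
      show "meet l (u, s - base_height l u) (u, s - base_height l u) = s" using meet_stem(1)[OF * _ *] by simp
    qed
    show "base_height l u < meet l x x" if "x \<in> branch u" for x using branch_height that .
    show "min ?c (min (meet l x x) (meet l y y)) \<le> meet l x y" if x: "x \<in> branch u" and y: "y \<in> branch u" for x y
      using x
    proof (cases rule: branch_cases)
      case (stem s)
      have hx: "meet l x x = base_height l u + s" using meet_stem(1)[of x u x] x stem by simp
      show ?thesis
      proof (cases "fst y = u")
        case True
        then show ?thesis using meet_stem(1)[of y u y] meet_stem(1)[of x u y] x y stem hx by (simp add: min_le_iff_disj linear)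
      next
        case False
        then show ?thesis using meet_stem(1)[of x u y] x y stem hx cut_le[OF node.prems(2)] by simp
      qed
    next
      case (above i)
      from y show ?thesis
      proof (cases rule: branch_cases)
        case (stem s)
        then have "meet l y y = base_height l u + s" "meet l x y = base_height l u + min s (if fst x = u then snd x else l u)"
          using meet_stem(1)[of y u y] meet_stem(2)[of y u x] x y by simp_all
        moreover have "fst x \<noteq> u" using above by (auto simp: branch_def)
        ultimately show ?thesis using stem cut_le[OF node.prems(2)] by simp
      next
        case (above j)
        then show ?thesis using meet_above[OF \<open>x \<in> branch (u @ [i])\<close> above(1)] by (auto split: if_splits)
      qed
    qed
    show "finite (branches (meet l) ?c (branch u))" using fin br by simp
    show "card (branches (meet l) ?c (branch u)) \<noteq> 1" using node(2) br inj by (simp add: card_image)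
    show "branch_shape (meet l) ?c C (\<tau> C)" if C: "C \<in> branches (meet l) ?c (branch u)" for C
    proof -
      obtain i where i: "i \<in> I" "C = branch (u @ [i])" using br C by auto
      have ui: "u @ [i] \<in> family N" "0 < c (u @ [i])" using i I node.prems by (auto simp: family_snoc)
      have "branch_shape (meet l) (base_height l (u @ [i])) (branch (u @ [i])) (ts i)"
        using node.IH[OF i(1), of "u @ [i]"] node.prems ui by simp
      then show ?thesis using \<tau>[OF i(1)] i(2) cut_full[OF ui] by (simp add: base_height_snoc)
    qed
  qed
  also have "image_mset \<tau> (mset_set (branches (meet l) ?c (branch u))) = image_mset ts (mset_set I)"
    unfolding br image_mset_mset_set[OF inj, symmetric] image_mset.compositionality
    using \<tau> fin by (intro image_mset_cong) simp
  finally show ?case .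
next
  case (merge \<omega> j t)
  have I: "{i. i < N u \<and> 0 < c (u @ [i])} = {j}"
  proof -
    have "(\<lambda>w. \<omega> (i # w)) \<in> E \<longleftrightarrow> 0 < c (u @ [i])" if "i < N u" for i
      using E[of "u @ [i]"] merge.prems that by (simp add: family_snoc)
    moreover have "\<nu> (\<omega> []) = N u" using merge.prems N by simp
    ultimately show ?thesis using merge(2) by auto
  qed
  have uj: "u @ [j] \<in> family N" "0 < c (u @ [j])" using I merge.prems by (auto simp: family_snoc)
  have full: "c u = l u" using cut_full uj by simp
  define S where "S = {x \<in> branch u. fst x = u}"
  have U: "branch u = S \<union> branch (u @ [j])"
  proof (intro equalityI subsetI)
    fix x assume x: "x \<in> branch u"
    then show "x \<in> S \<union> branch (u @ [j])"
    proof (cases rule: branch_cases)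
      case (above i)
      then have "i = j" using I by blast
      then show ?thesis using above by simp
    qed (use x in \<open>simp add: S_def\<close>)
  qed (use branch_mono[of u "u @ [j]"] in \<open>auto simp: S_def\<close>)
  have t: "branch_shape (meet l) (base_height l (u @ [j])) (branch (u @ [j])) t"
    using merge.IH[of "u @ [j]"] merge.prems uj by simp
  have "branch_shape (meet l) (base_height l u) (S \<union> branch (u @ [j])) t"
  proof (rule branch_shape_stem_extend[OF t])
    show "base_height l u < base_height l (u @ [j])"
      using length_pos merge.prems by (simp add: base_height_snoc)
    show "\<exists>x\<in>S. meet l x x = s" if "base_height l u < s" "s \<le> base_height l (u @ [j])" for s
    proof (rule bexI[of _ "(u, s - base_height l u)"])
      have *: "(u, s - base_height l u) \<in> branch u"
        using that merge.prems full by (simp add: branch_def base_height_snoc)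
      then show "(u, s - base_height l u) \<in> S" by (simp add: S_def)
      show "meet l (u, s - base_height l u) (u, s - base_height l u) = s" using meet_stem(1)[OF * _ *] by simp
    qed
    show "base_height l u < meet l x x \<and> meet l x x \<le> base_height l (u @ [j])" if "x \<in> S" for x
      using that meet_stem(1)[of x u x] full by (auto simp: S_def branch_def base_height_snoc)
    show "meet l x y = min (meet l x x) (meet l y y) \<and> meet l y x = min (meet l x x) (meet l y y)"
      if x: "x \<in> S" and y: "y \<in> S \<union> branch (u @ [j])" for x y
    proof -
      have xu: "x \<in> branch u" "fst x = u" using x by (simp_all add: S_def)
      have yu: "y \<in> branch u" using y U by blast
      have sx: "snd x \<le> l u" using xu full by (auto simp: branch_def)
      show ?thesis
      proof (cases "fst y = u")
        case True
        then show ?thesis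
          using meet_stem[OF xu yu] meet_stem(1)[OF xu xu(1)] meet_stem(1)[OF yu _ yu] xu(2) by (simp add: min_add_distrib_right)
      next
        case False
        then have "y \<in> branch (u @ [j])" using y by (auto simp: S_def)
        then have "base_height l u + l u < meet l y y" using meet_above[of y u j y j] by simp
        then show ?thesis
          using meet_stem[OF xu yu] meet_stem(1)[OF xu xu(1)] False sx by simp
      qed
    qed
  qed
  then show ?case using U by simp
qed

end

section \<open>Shapes of metric trees\<close>

lemma meet_Cons_stem:
  assumes "edge_point l ([], s)" "edge_point l (j # v, s')"
  shows "meet l ([], s) (j # v, s') = s" "meet l (j # v, s') ([], s) = s"
proof -
  have "s \<le> l []" using assms(1) by (simp add: edge_point_def)
  then show "meet l ([], s) (j # v, s') = s" using meet_Nil[OF assms(2)] by (simp add: covered_def)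
  then show "meet l (j # v, s') ([], s) = s" using meet_commute[OF assms] by simp
qed

text \<open>Glues the metric trees realizing the branches on top of an edge realizing the stem.\<close>

lemma branch_shape_metric_tree:
  assumes "branch_shape G a B t" "meet_kernel G B"
  shows "\<exists>N l f. finite_metric_tree N l \<and> genealogy N [] t \<and> f ` B = tree_points N l \<and>
    (\<forall>x\<in>B. \<forall>y\<in>B. G x y = a + meet l (f x) (f y))"
  using assms
proof (induction rule: branch_shape.induct)
  case (1 a c B \<tau>)
  let ?Cl = "branches G c B"
  have ker: "meet_kernel G B" by fact
  have sym: "G x y = G y x" and le: "G x y \<le> G x x" if "x \<in> B" "y \<in> B" for x y
    using ker that unfolding meet_kernel_def by blast+
  have "\<forall>C\<in>?Cl. \<exists>R. finite_metric_tree (fst R) (fst (snd R)) \<and> genealogy (fst R) [] (\<tau> C) \<and>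
      snd (snd R) ` C = tree_points (fst R) (fst (snd R)) \<and>
      (\<forall>x\<in>C. \<forall>y\<in>C. G x y = c + meet (fst (snd R)) (snd (snd R) x) (snd (snd R) y))"
  proof
    fix C assume C: "C \<in> ?Cl"
    obtain N l f where "finite_metric_tree N l" "genealogy N [] (\<tau> C)" "f ` C = tree_points N l"
      "\<forall>x\<in>C. \<forall>y\<in>C. G x y = c + meet l (f x) (f y)"
      using "1.IH"[OF C meet_kernel_subset[OF ker branches_subset[OF C]]] by blast
    then show "\<exists>R. finite_metric_tree (fst R) (fst (snd R)) \<and> genealogy (fst R) [] (\<tau> C) \<and>
      snd (snd R) ` C = tree_points (fst R) (fst (snd R)) \<and>
      (\<forall>x\<in>C. \<forall>y\<in>C. G x y = c + meet (fst (snd R)) (snd (snd R) x) (snd (snd R) y))"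
      by (intro exI[of _ "(N, l, f)"]) simp
  qed
  from bchoice[OF this] obtain R where R0: "\<forall>C\<in>?Cl. finite_metric_tree (fst (R C)) (fst (snd (R C))) \<and>
      genealogy (fst (R C)) [] (\<tau> C) \<and>
      snd (snd (R C)) ` C = tree_points (fst (R C)) (fst (snd (R C))) \<and>
      (\<forall>x\<in>C. \<forall>y\<in>C. G x y = c + meet (fst (snd (R C))) (snd (snd (R C)) x) (snd (snd (R C)) y))"
    by (elim exE)
  note R = bspec[OF R0, THEN conjunct1] bspec[OF R0, THEN conjunct2, THEN conjunct1]
    bspec[OF R0, THEN conjunct2, THEN conjunct2, THEN conjunct1]
  note R' = bspec[OF R0, THEN conjunct2, THEN conjunct2, THEN conjunct2]
  have R4: "G x y = c + meet (fst (snd (R C))) (snd (snd (R C)) x) (snd (snd (R C)) y)"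
    if "C \<in> ?Cl" "x \<in> C" "y \<in> C" for C x y
    using R'[OF that(1)] that(2,3) by simp
  define m where "m = card ?Cl"
  \<comment> \<open>The branches are numbered arbitrarily to serve as children; since
    \<open>ctree\<close> uses multisets, the numbering does not affect the shape.\<close>
  obtain e where e: "bij_betw e {..<m} ?Cl"
    using ex_bij_betw_nat_finite[OF 1(5)] by (auto simp: m_def atLeast0LessThan)
  have eC: "e j \<in> ?Cl" if "j < m" for j using e that by (auto simp: bij_betw_def)
  define N where "N u = (case u of [] \<Rightarrow> m | j # v \<Rightarrow> fst (R (e j)) v)" for u
  define l where "l u = (case u of [] \<Rightarrow> c - a | j # v \<Rightarrow> fst (snd (R (e j))) v)" for u
  have N: "N [] = m" "(\<lambda>v. N (j # v)) = fst (R (e j))" for j by (auto simp: N_def)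
  have l: "l [] = c - a" "(\<lambda>v. l (j # v)) = fst (snd (R (e j)))" for j by (auto simp: l_def)
  have fam: "j # v \<in> family N \<longleftrightarrow> j < m \<and> v \<in> family (fst (R (e j)))" for j v
    using N by (simp add: family_Cons)
  have fin_fam: "finite (family N)"
  proof (rule finite_subset)
    show "family N \<subseteq> insert [] (\<Union>j<m. (#) j ` family (fst (R (e j))))"
    proof
      fix u assume "u \<in> family N"
      show "u \<in> insert [] (\<Union>j<m. (#) j ` family (fst (R (e j))))"
      proof (cases u)
        case (Cons j v)
        then have "j < m" "v \<in> family (fst (R (e j)))" using \<open>u \<in> family N\<close> fam[of j v] by simp_all
        then show ?thesis unfolding Cons by (intro insertI2 UN_I[of j] imageI) simp_all
      qed simp
    qed
    show "finite (insert [] (\<Union>j<m. (#) j ` family (fst (R (e j)))))"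
      using R(1) eC by (auto simp: finite_metric_tree_def)
  qed
  have l_pos: "0 < l u" if "u \<in> family N" for u
  proof (cases u)
    case Nil
    then show ?thesis using l 1(1) by simp
  next
    case (Cons j v)
    then show ?thesis
      using that fam R(1)[OF eC, of j] by (auto simp: l_def finite_metric_tree_def)
  qed
  interpret T: finite_metric_tree N l by unfold_locales (use fin_fam l_pos in auto)
  define cl where "cl x = {y \<in> B. c < G x y}" for x
  define idx where "idx x = inv_into {..<m} e (cl x)" for x
  have cl: "cl x \<in> ?Cl" "x \<in> cl x" "idx x < m" "e (idx x) = cl x" if "x \<in> B" "c < G x x" for x
  proof -
    show *: "cl x \<in> ?Cl" using that by (auto simp: cl_def branches_def)
    show "x \<in> cl x" using that by (simp add: cl_def)
    have "cl x \<in> e ` {..<m}" using * e by (simp add: bij_betw_def)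
    then show "idx x < m" "e (idx x) = cl x"
      using inv_into_into[of "cl x" e "{..<m}"] f_inv_into_f[of "cl x" e "{..<m}"] by (auto simp: idx_def)
  qed
  have cl_eq: "cl x = cl y \<longleftrightarrow> c < G x y" if "x \<in> B" "y \<in> B" "c < G x x" "c < G y y" for x y
    using branches_eq_iff[OF ker that] by (simp add: cl_def)
  define f where "f x = (if G x x \<le> c then ([], G x x - a) else
      (idx x # fst (snd (snd (R (cl x))) x), snd (snd (snd (R (cl x))) x)))" for x
  have f_stem: "f x = ([], G x x - a)" if "G x x \<le> c" for x using that by (simp add: f_def)
  have f_above: "f x = (idx x # fst (snd (snd (R (cl x))) x), snd (snd (snd (R (cl x))) x))" if "c < G x x" for x
    using that by (simp add: f_def)
  have f_in: "f x \<in> tree_points N l" if x: "x \<in> B" for x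
  proof (cases "G x x \<le> c")
    case True
    then show ?thesis
      using 1(3)[OF x] family.intros(1)[of N] by (simp add: f_stem tree_points_def l)
  next
    case False
    then have gt: "c < G x x" by simp
    note cx = cl[OF x gt]
    have "snd (snd (R (cl x))) x \<in> tree_points (fst (R (cl x))) (fst (snd (R (cl x))))"
      using R(3)[OF cx(1)] cx(2) by blast
    then show ?thesis
      unfolding f_above[OF gt] using cx fam[of "idx x"] by (auto simp: tree_points_def l_def)
  qed
  have e_f: "edge_point l (f x)" if "x \<in> B" for x
    using T.edge_point[OF T.tree_points_subset[OF f_in[OF that]]] .
  have meet_f: "G x y = a + meet l (f x) (f y)" if x: "x \<in> B" and y: "y \<in> B" for x y
  proof -
    have chain: "min c (min (G x x) (G y y)) \<le> G x y" using 1(4)[OF x y] .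
    have ub: "G x y \<le> G x x" "G x y \<le> G y y" using le[OF x y] le[OF y x] sym[OF x y] by auto
    show ?thesis
    proof (cases "G x x \<le> c")
      case xs: True
      show ?thesis
      proof (cases "G y y \<le> c")
        case True
        have "meet l (f x) (f y) = min (G x x - a) (G y y - a)"
          using meet_Nil[of l "f y" "G x x - a"] e_f[OF y] True xs by (simp add: f_stem covered_def)
        then show ?thesis using chain ub True xs by (simp add: min_def split: if_splits)
      next
        case False
        then show ?thesis
          using meet_Cons_stem(1)[of l "G x x - a"] e_f[OF x] e_f[OF y] f_stem[OF xs] f_above[of y] chain ub xs by simp
      qed
    next
      case xa: False
      show ?thesis
      proof (cases "G y y \<le> c")
        case True
        then show ?thesis
          using meet_Cons_stem(2)[of l "G y y - a"] e_f[OF x] e_f[OF y] f_stem[OF True] f_above[of x] chain ub xa by simp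
      next
        case False
        then have gt: "c < G x x" "c < G y y" using xa by auto
        note cx = cl[OF x gt(1)] and cy = cl[OF y gt(2)]
        have "cl x = cl y" if "idx x = idx y" using arg_cong[OF that, of e] cx(4) cy(4) by simp
        then have idx: "idx x = idx y \<longleftrightarrow> c < G x y"
          unfolding cl_eq[OF x y gt, symmetric] by (auto simp: idx_def)
        have "edge_point l (idx x # fst (snd (snd (R (cl x))) x), snd (snd (snd (R (cl x))) x))"
          "edge_point l (idx y # fst (snd (snd (R (cl y))) y), snd (snd (snd (R (cl y))) y))"
          using e_f[OF x] e_f[OF y] gt by (simp_all add: f_above)
        note mm = meet_Cons_Cons[OF this]
        have lx: "(\<lambda>w. l (idx x # w)) = fst (snd (R (cl x)))" using l(2)[of "idx x"] cx(4) by simp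
        have m: "meet l (f x) (f y) = c - a + (if idx x = idx y then
            meet (fst (snd (R (cl x)))) (snd (snd (R (cl x))) x) (snd (snd (R (cl y))) y) else 0)"
          using mm unfolding f_above[OF gt(1)] f_above[OF gt(2)] lx l(1) prod.collapse .
        show ?thesis
        proof (cases "c < G x y")
          case True
          then have "cl x = cl y" using cl_eq[OF x y gt] by simp
          then show ?thesis using m idx True R4[OF cx(1,2), of y] cy(2) by simp
        next
          case False
          then show ?thesis using m idx chain gt by auto
        qed
      qed
    qed
  qed
  have "f ` B = tree_points N l"
  proof (intro equalityI subsetI)
    fix p assume p: "p \<in> tree_points N l"
    show "p \<in> f ` B"
    proof (cases "fst p")
      case Nil
      then have "0 < snd p" "snd p \<le> c - a" using p by (auto simp: tree_points_def l)
      then obtain x where x: "x \<in> B" "G x x = a + snd p" using 1(2)[of "a + snd p"] by auto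
      then have "f x = p" using Nil \<open>snd p \<le> c - a\<close> f_stem[of x] by (simp add: prod_eq_iff)
      then show ?thesis using x by blast
    next
      case (Cons j v)
      then have j: "j < m" and "(v, snd p) \<in> tree_points (fst (R (e j))) (fst (snd (R (e j))))"
        using p fam by (auto simp: tree_points_def l_def)
      then have "(v, snd p) \<in> snd (snd (R (e j))) ` e j" using R(3)[OF eC[OF j]] by simp
      then obtain x where x: "x \<in> e j" "(v, snd p) = snd (snd (R (e j))) x" by blast
      obtain z where z: "z \<in> B" "c < G z z" "e j = cl z" using eC[OF j] by (auto simp: branches_def cl_def)
      have xB: "x \<in> B" and "c < G z x" using x(1) z(3) by (auto simp: cl_def)
      then have gt: "c < G x x" using le[OF xB z(1)] sym[OF xB z(1)] by simp
      have "cl x = e j" using cl_eq[OF z(1) xB z(2) gt] \<open>c < G z x\<close> z(3) by simp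
      then have "idx x = j" using e j by (simp add: idx_def bij_betw_def)
      then have "f x = p" using f_above[OF gt] \<open>cl x = e j\<close> x(2) Cons by (metis fst_conv prod.collapse snd_conv)
      then show ?thesis using xB by blast
    qed
  qed (use f_in in blast)
  moreover have "genealogy N [] (Node (image_mset \<tau> (mset_set ?Cl)))"
  proof -
    have "genealogy N [] (Node (image_mset (\<lambda>j. \<tau> (e j)) (mset_set {..<N []})))"
    proof (rule genealogy.intros)
      fix i assume "i < N []"
      then show "genealogy N ([] @ [i]) (\<tau> (e i))" using R(2)[OF eC, of i] N by (simp add: genealogy_sub)
    qed
    moreover have "image_mset \<tau> (mset_set ?Cl) = image_mset (\<lambda>j. \<tau> (e j)) (mset_set {..<N []})"
    proof -
      have "mset_set ?Cl = image_mset e (mset_set {..<m})"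
        using e by (simp add: bij_betw_def image_mset_mset_set)
      then show ?thesis by (simp add: N(1) image_mset.compositionality comp_def)
    qed
    ultimately show ?thesis by simp
  qed
  ultimately show ?case using T.finite_metric_tree_axioms meet_f by blast
qed

lemma mdist_gprod: "mdist M x y = gprod M r x x + gprod M r y y - 2 * gprod M r x y"
  if "x \<in> mspace M" "y \<in> mspace M"
proof -
  have "2 * gprod M r x y = mdist M r x + mdist M r y - mdist M x y" for x y by (simp add: gprod_def)
  from this[of x y] this[of x x] this[of y y] that show ?thesis by simp
qed

lemma (in finite_metric_tree) rooted_isometric_gprod:
  assumes iso: "rooted_isometric X (metric_tree N l)" and root: "snd X \<in> mspace (fst X)"
  obtains \<phi> where "inj_on \<phi> (tree_points N l)" "\<phi> ` tree_points N l = mspace (fst X) - {snd X}"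
    "\<And>x y. x \<in> tree_points N l \<Longrightarrow> y \<in> tree_points N l \<Longrightarrow> gprod (fst X) (snd X) (\<phi> x) (\<phi> y) = meet l x y"
proof -
  have "rooted_isometric (metric_tree N l) X" using rooted_isometric_sym[OF iso root] .
  then obtain f where f: "isometric_embedding M (fst X) f" "f ` points = mspace (fst X)" "f ([], 0) = snd X"
    by (auto simp: rooted_isometric_def metric_tree_eq)
  have d: "mdist (fst X) (f x) (f y) = mdist M x y" if "x \<in> points" "y \<in> points" for x y
    using f(1) that unfolding isometric_embedding_def mspace_M by blast
  have inj: "inj_on f points"
  proof (rule inj_onI)
    fix x y assume xy: "x \<in> points" "y \<in> points" "f x = f y"
    then have "mdist M x y = mdist (fst X) (f y) (f y)" using d by metis
    also have "\<dots> = 0" using f(2) xy by (intro mdist_self) blast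
    finally show "x = y" using xy mdist_zero[of x M y] by simp
  qed
  show ?thesis
  proof (rule that[of f])
    show "inj_on f (tree_points N l)" using inj by (rule inj_on_subset) auto
    have eq: "tree_points N l = points - {([], 0)}" by (auto simp: tree_points_def)
    have "f ` (points - {([], 0)}) = f ` points - f ` {([], 0)}"
      by (rule inj_on_image_set_diff[OF inj]) auto
    then show "f ` tree_points N l = mspace (fst X) - {snd X}"
      unfolding eq[symmetric] f(2) by (simp add: f(3))
    fix x y assume xy: "x \<in> tree_points N l" "y \<in> tree_points N l"
    have "gprod (fst X) (snd X) (f x) (f y) = gprod M ([], 0) x y"
      using d xy f(3) unfolding gprod_def by (metis insertI1 insertI2)
    then show "gprod (fst X) (snd X) (f x) (f y) = meet l x y" using gprod_M xy by simp
  qed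
qed

text \<open>Nothing is cut: the results on pruned trees are used with \<open>c = l\<close> and every
  subtree kept.\<close>

lemma (in finite_metric_tree) branch_shape_metric:
  assumes t: "genealogy N [] t" "reduced t"
  shows "branch_shape (meet l) 0 (tree_points N l) t"
proof -
  interpret P: pruned_metric_tree N l l
    by unfold_locales (use length_pos in \<open>auto intro: less_imp_le\<close>)
  have "genealogy (id \<circ> N) [] t" using t by simp
  then have "pruned_shape True id UNIV N t"
    using genealogy_iff_pruned_shape pruned_shape_of_reduced t(2) by blast
  then have "branch_shape (meet l) (base_height l []) (P.branch []) t"
    by (rule P.branch_shape_branch[where \<omega>\<^sub>0 = N]) (use length_pos family.intros(1) in auto)
  moreover have "P.branch [] = tree_points N l" by (auto simp: P.branch_def tree_points_def)
  ultimately show ?thesis by simp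
qed

lemma genealogy_exists: "finite (family N) \<Longrightarrow> \<exists>t. genealogy N [] t"
  using pruned_shape_exists[of id N False UNIV] genealogy_iff_pruned_shape[of id N] by simp

lemma has_shape_branch_shape:
  assumes shape: "has_shape X \<tau>" and root: "snd X \<in> mspace (fst X)" and ne: "\<not> is_empty_tree X"
  obtains t where "\<tau> = Node {#t#}" "reduced t" "branch_shape (gprod (fst X) (snd X)) 0 (mspace (fst X) - {snd X}) t"
    "meet_kernel (gprod (fst X) (snd X)) (mspace (fst X) - {snd X})"
proof -
  obtain N l where Nl: "finite (family N)" "\<forall>u\<in>family N. 0 < l u" "planted_tree N = \<tau>"
    "rooted_isometric X (metric_tree N l)" and pl: "\<tau> \<in> planted_trees"
    using shape ne by (auto simp: has_shape_def)
  interpret finite_metric_tree N l by unfold_locales (use Nl in auto)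
  obtain t where t: "genealogy N [] t" using genealogy_exists finite_family by blast
  then have \<tau>: "\<tau> = Node {#t#}" using planted_tree_eq[OF finite_family t] Nl(3) by simp
  then have red: "reduced t" using pl by (auto simp: planted_trees_def)
  obtain \<phi> where \<phi>: "inj_on \<phi> (tree_points N l)" "\<phi> ` tree_points N l = mspace (fst X) - {snd X}"
    "\<And>x y. x \<in> tree_points N l \<Longrightarrow> y \<in> tree_points N l \<Longrightarrow> gprod (fst X) (snd X) (\<phi> x) (\<phi> y) = meet l x y"
    using rooted_isometric_gprod[OF Nl(4) root] by blast
  have bs: "branch_shape (gprod (fst X) (snd X)) 0 (\<phi> ` tree_points N l) t"
    by (rule branch_shape_image[OF branch_shape_metric[OF t red] \<phi>(1,3)])
  have ker: "meet_kernel (meet l) (tree_points N l)"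
    using meet_kernel_subset[OF meet_kernel_points] by blast
  have "meet_kernel (gprod (fst X) (snd X)) (\<phi> ` tree_points N l)"
    by (rule meet_kernel_image[OF ker]) (rule \<phi>(3))
  then show ?thesis using that \<tau> red bs \<phi>(2) by simp
qed

text \<open>Both shapes are read off from the same meet heights on X itself, where
  \<open>branch_shape_unique\<close> applies.\<close>

lemma has_shape_unique:
  assumes "has_shape X \<tau>" "has_shape X \<tau>'" "snd X \<in> mspace (fst X)" "\<not> is_empty_tree X"
  shows "\<tau> = \<tau>'"
proof -
  obtain t where t: "\<tau> = Node {#t#}" "branch_shape (gprod (fst X) (snd X)) 0 (mspace (fst X) - {snd X}) t"
    "meet_kernel (gprod (fst X) (snd X)) (mspace (fst X) - {snd X})"
    using has_shape_branch_shape[OF assms(1,3,4)] by metis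
  obtain t' where t': "\<tau>' = Node {#t'#}" "branch_shape (gprod (fst X) (snd X)) 0 (mspace (fst X) - {snd X}) t'"
    using has_shape_branch_shape[OF assms(2,3,4)] by metis
  show ?thesis using branch_shape_unique[OF t(2) t'(2) t(3)] t(1) t'(1) by simp
qed

text \<open>\<open>shape\<close> is a definite description. Existence comes from realizing the
  branches by a metric tree: meet heights determine distances, so the realization is an isometry.
  Uniqueness is \<open>has_shape_unique\<close>.\<close>

lemma shape_eq_of_branch_shape:
  assumes bs: "branch_shape (gprod (fst X) (snd X)) 0 (mspace (fst X) - {snd X}) t"
    and ker: "meet_kernel (gprod (fst X) (snd X)) (mspace (fst X) - {snd X})"
    and root: "snd X \<in> mspace (fst X)" and ne: "\<not> is_empty_tree X"
  shows "shape X = Node {#t#}"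
proof -
  obtain N l f where R: "finite_metric_tree N l" "genealogy N [] t" "f ` (mspace (fst X) - {snd X}) = tree_points N l"
    and f': "\<forall>x\<in>mspace (fst X) - {snd X}. \<forall>y\<in>mspace (fst X) - {snd X}.
      gprod (fst X) (snd X) x y = 0 + meet l (f x) (f y)"
    using branch_shape_metric_tree[OF bs ker] by (elim exE conjE)
  have f: "gprod (fst X) (snd X) x y = 0 + meet l (f x) (f y)"
    if "x \<in> mspace (fst X) - {snd X}" "y \<in> mspace (fst X) - {snd X}" for x y
    using bspec[OF bspec[OF f' that(1)] that(2)] .
  interpret finite_metric_tree N l by fact
  define h where "h x = (if x = snd X then ([], 0) else f x)" for x
  have im: "h ` mspace (fst X) = points"
  proof -
    have "h ` mspace (fst X) = insert (h (snd X)) (h ` (mspace (fst X) - {snd X}))" using root by blast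
    also have "h ` (mspace (fst X) - {snd X}) = f ` (mspace (fst X) - {snd X})" by (rule image_cong) (auto simp: h_def)
    finally show ?thesis using R(3) by (simp add: h_def)
  qed
  have fin: "f x \<in> points" if "x \<in> mspace (fst X) - {snd X}" for x using R(3) that by blast
  have g0: "gprod (fst X) (snd X) (snd X) y = 0" "gprod (fst X) (snd X) y (snd X) = 0" if "y \<in> mspace (fst X)" for y
    using that root mdist_commute[of "fst X" y] by (simp_all add: gprod_def)
  have g: "gprod (fst X) (snd X) x y = meet l (h x) (h y)" if "x \<in> mspace (fst X)" "y \<in> mspace (fst X)" for x y
  proof -
    have "meet l ([], 0) z = 0 \<and> meet l z ([], 0) = 0" if "z \<in> points" for z
      using meet_root[OF edge_point[OF that]] meet_commute[OF edge_point[OF that] root_edge_point] by simp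
    then show ?thesis using g0 f fin that by (auto simp: h_def)
  qed
  have hin: "h x \<in> points" if "x \<in> mspace (fst X)" for x using im that by blast
  have "mdist M (h x) (h y) = mdist (fst X) x y" if "x \<in> mspace (fst X)" "y \<in> mspace (fst X)" for x y
    using mdist_gprod[OF that, of "snd X"] g that path_dist_meet[OF edge_point[OF hin] edge_point[OF hin], OF that]
    by (simp add: mdist_M)
  then have iso: "rooted_isometric X (metric_tree N l)"
    unfolding rooted_isometric_def isometric_embedding_def metric_tree_eq
    using im by (intro exI[of _ h]) (simp add: h_def)
  have "has_shape X (Node {#t#})"
    unfolding has_shape_def
    using iso planted_tree_eq[OF finite_family R(2)] finite_family length_pos branch_shape_reduced[OF bs]
    by (auto simp: planted_trees_def)
  then show ?thesis
    unfolding shape_def using has_shape_unique root ne by (intro the_equality) blast+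
qed

section \<open>Reductions of random trees\<close>

text \<open>Downward closure makes the kept part of an edge an initial piece, and the last clause of
  \<open>is_pruning\<close> adds its supremum, so one length per edge describes L off the
  root.\<close>

lemma (in finite_metric_tree) pruning_cut:
  assumes L: "is_pruning M ([], 0) L"
  shows "\<exists>c. pruned_metric_tree N l c \<and> L - {([], 0)} = {(u, s). u \<in> family N \<and> 0 < s \<and> s \<le> c u}"
proof -
  have LM: "L \<subseteq> points" using is_pruning_subset[OF L] by simp
  have down: "z \<in> L" if "x \<in> L" "z \<in> points" "x \<in> desc M ([], 0) z" for x z
    using L that unfolding is_pruning_def mspace_M by blast
  have lim: "x \<in> L" if "x \<in> points" "\<And>z. \<lbrakk>z \<in> points; z \<noteq> ([], 0); z \<noteq> x; x \<in> desc M ([], 0) z\<rbrakk> \<Longrightarrow> z \<in> L" for x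
    using L that unfolding is_pruning_def mspace_M by blast
  have TP: "tree_points N l = points - {([], 0)}" by (auto simp: tree_points_def)
  define S where "S u = {s. (u, s) \<in> L \<and> (u, s) \<in> tree_points N l}" for u
  define c where "c u = (if S u = {} then 0 else Sup (S u))" for u
  have S: "u \<in> family N" "0 < s" "s \<le> l u" if "s \<in> S u" for s u
    using that by (auto simp: S_def tree_points_def)
  have bdd: "bdd_above (S u)" for u using S(3) by (intro bdd_aboveI[of _ "l u"])
  have S_le: "s \<le> c u" if "s \<in> S u" for s u
    using that bdd cSup_upper[of s "S u"] by (auto simp: c_def)
  have S_down: "s' \<in> S u" if "s \<in> S u" "0 < s'" "s' \<le> s" for s s' u
  proof -
    have t: "(u, s) \<in> L" "(u, s) \<in> points" "(u, s') \<in> tree_points N l"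
      using that S[OF that(1)] by (auto simp: S_def tree_points_def)
    then have "(u, s) \<in> desc M ([], 0) (u, s')" using desc_iff[of "(u, s')" "(u, s)"] that by simp
    then show ?thesis using down[of "(u, s)" "(u, s')"] t by (simp add: S_def)
  qed
  have c_in: "c u \<in> S u" if ne: "S u \<noteq> {}" for u
  proof -
    obtain s where s: "s \<in> S u" using ne by blast
    have c: "0 < c u" "c u \<le> l u" "c u = Sup (S u)"
      using S_le[OF s] S[OF s] ne cSup_least[OF ne, of "l u"] S(3) by (auto simp: c_def)
    have ct: "(u, c u) \<in> tree_points N l" using c S[OF s] by (simp add: tree_points_def)
    have "(u, c u) \<in> L"
    proof (rule lim)
      show "(u, c u) \<in> points" using ct by simp
      fix z assume z: "z \<in> points" "z \<noteq> ([], 0)" "z \<noteq> (u, c u)" "(u, c u) \<in> desc M ([], 0) z"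
      have zt: "z \<in> tree_points N l" using z by simp
      from desc_iff[OF zt, of "(u, c u)"] ct z(4)
      consider "fst z = u" "snd z \<le> c u" | "strict_prefix (fst z) u" by auto
      \<comment> \<open>Every strict ancestor of the upper end is an ancestor of some kept point of
        the same edge, hence kept.\<close>
      then obtain s' where s': "s' \<in> S u" "fst z = u \<and> snd z \<le> s' \<or> strict_prefix (fst z) u"
      proof cases
        case 1
        then have "snd z < Sup (S u)" using z(3) c by (simp add: prod_eq_iff)
        then obtain s' where "s' \<in> S u" "snd z < s'" using less_cSupD[OF ne] by blast
        then show ?thesis using that 1 by auto
      next
        case 2
        then show ?thesis using that s by blast
      qed
      then have "(u, s') \<in> desc M ([], 0) z"
        using desc_iff[OF zt, of "(u, s')"] by (auto simp: S_def)
      then show "z \<in> L" using down[of "(u, s')" z] s' z by (simp add: S_def)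
    qed
    then show ?thesis using ct by (simp add: S_def)
  qed
  have c0: "0 < c u \<longleftrightarrow> S u \<noteq> {}" for u
    using S(2)[OF c_in[of u]] by (cases "S u = {}") (auto simp: c_def)
  have S_iff: "s \<in> S u \<longleftrightarrow> 0 < s \<and> s \<le> c u" for s u
  proof
    assume "0 < s \<and> s \<le> c u"
    then have s: "0 < s" "s \<le> c u" by auto
    then have "S u \<noteq> {}" using c0[of u] by simp
    then show "s \<in> S u" using S_down[OF c_in, of u s] s by blast
  qed (use S S_le in blast)
  have L_eq: "L - {([], 0)} = {(u, s). u \<in> family N \<and> 0 < s \<and> s \<le> c u}"
  proof -
    have "L - {([], 0)} = {(u, s). s \<in> S u}" using LM TP by (auto simp: S_def)
    also have "\<dots> = {(u, s). u \<in> family N \<and> 0 < s \<and> s \<le> c u}" using S(1) S_iff by blast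
    finally show ?thesis .
  qed
  have "pruned_metric_tree N l c"
  proof unfold_locales
    fix u
    show "0 \<le> c u" using c0[of u] by (cases "S u = {}") (auto simp: c_def)
    show "c u \<le> l u" if "u \<in> family N"
      using S(3)[OF c_in[of u]] length_pos[OF that] by (cases "S u = {}") (auto simp: c_def)
    show "c u = l u" if ui: "u @ [i] \<in> family N" "0 < c (u @ [i])" for i
    proof -
      have u: "u \<in> family N" using ui by (simp add: family_snoc)
      have ci: "c (u @ [i]) \<in> S (u @ [i])" using c_in c0 ui by blast
      have lt: "(u, l u) \<in> tree_points N l" using u length_pos by (simp add: tree_points_def)
      have "(u @ [i], c (u @ [i])) \<in> desc M ([], 0) (u, l u)"
        using ci desc_iff[OF lt, of "(u @ [i], c (u @ [i]))"] by (auto simp: S_def strict_prefix_def)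
      then have "(u, l u) \<in> L" using ci down[of "(u @ [i], c (u @ [i]))"] lt by (auto simp: S_def)
      then have lS: "l u \<in> S u" using lt by (simp add: S_def)
      then have "c u \<in> S u" using c_in by blast
      then show ?thesis using S_le[OF lS] S(3)[of "c u" u] by simp
    qed
  qed
  then show ?thesis using L_eq by blast
qed

definition survivors :: "(nat \<Rightarrow> point rooted set) \<Rightarrow> nat \<Rightarrow> (nat list \<Rightarrow> nat \<times> real) set" where
  "survivors H n = {\<omega>. \<not> is_empty_tree (iterated_reduction H n (random_tree \<omega>))}"

text \<open>The last claim is the locality of survival: what the reductions do to the subtree at u,
  taken as a tree of its own, decides whether they leave anything of the edge to u in the whole
  tree. The subtree embeds off the root, and both trees are reduced in parallel.\<close>

lemma random_tree_pruning:
  fixes \<omega> :: "nat list \<Rightarrow> nat \<times> real"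
  assumes fin: "finite (family (fst \<circ> \<omega>))" and pos: "\<And>u. 0 < snd (\<omega> u)"
    and H: "\<And>n. n \<ge> 1 \<Longrightarrow> hereditary (H n)"
  obtains c L where "pruned_metric_tree (fst \<circ> \<omega>) (snd \<circ> \<omega>) c"
    "iterated_reduction H n (random_tree \<omega>) = (submetric (fst (random_tree \<omega>)) L, ([], 0))"
    "([], 0) \<in> L" "L - {([], 0)} = pruned_metric_tree.branch (fst \<circ> \<omega>) c []"
    "\<And>u. u \<in> family (fst \<circ> \<omega>) \<Longrightarrow> (\<lambda>w. \<omega> (u @ w)) \<in> survivors H n \<longleftrightarrow> 0 < c u"
proof -
  interpret T: finite_metric_tree "fst \<circ> \<omega>" "snd \<circ> \<omega>" by unfold_locales (use fin pos in auto)
  have rt: "random_tree \<omega> = (T.M, ([], 0))" using fin by (simp add: random_tree_def T.metric_tree_eq)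
  have "\<exists>L. is_pruning T.M ([], 0) L \<and> iterated_reduction H n (T.M, ([], 0)) = (submetric T.M L, ([], 0))"
    by (rule iterated_reduction_pruning[OF T.compact_tree_M]) (rule H)
  then obtain L where L: "is_pruning T.M ([], 0) L"
    "iterated_reduction H n (T.M, ([], 0)) = (submetric T.M L, ([], 0))"
    by (elim exE conjE)
  obtain c where c: "pruned_metric_tree (fst \<circ> \<omega>) (snd \<circ> \<omega>) c"
    "L - {([], 0)} = {(u, s). u \<in> family (fst \<circ> \<omega>) \<and> 0 < s \<and> s \<le> c u}"
    using T.pruning_cut[OF L(1)] by blast
  interpret P: pruned_metric_tree "fst \<circ> \<omega>" "snd \<circ> \<omega>" c by fact
  have branch: "L - {([], 0)} = P.branch []" using c(2) by (simp add: P.branch_def)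
  have rL: "([], 0) \<in> L" and LM: "L \<subseteq> T.points"
    using is_pruning_subset[OF L(1)] is_pruning_root[OF L(1)] by simp_all
  have "(\<lambda>w. \<omega> (u @ w)) \<in> survivors H n \<longleftrightarrow> 0 < c u" if u: "u \<in> family (fst \<circ> \<omega>)" for u
  proof -
    define N' where "N' = (\<lambda>w. (fst \<circ> \<omega>) (u @ w))"
    define l' where "l' = (\<lambda>w. (snd \<circ> \<omega>) (u @ w))"
    interpret S: finite_metric_tree N' l' using T.subtree[OF u] unfolding N'_def l'_def .
    have comp: "fst \<circ> (\<lambda>w. \<omega> (u @ w)) = N'" "snd \<circ> (\<lambda>w. \<omega> (u @ w)) = l'"
      by (auto simp: N'_def l'_def)
    have rtS: "random_tree (\<lambda>w. \<omega> (u @ w)) = (S.M, ([], 0))"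
      unfolding random_tree_def comp using S.finite_family by (simp only: if_True S.metric_tree_eq)
    have "\<exists>K L'. is_pruning S.M ([], 0) K \<and>
      iterated_reduction H n (S.M, ([], 0)) = (submetric S.M K, ([], 0)) \<and>
      is_pruning T.M ([], 0) L' \<and> iterated_reduction H n (T.M, ([], 0)) = (submetric T.M L', ([], 0)) \<and>
      (\<forall>x\<in>mspace S.M - {([], 0)}. x \<in> K \<longleftrightarrow> (case x of (v, s) \<Rightarrow> (u @ v, s)) \<in> L')"
      by (rule iterated_reduction_descendant_embedding[OF S.compact_tree_M T.compact_tree_M
          T.descendant_embedding_subtree[OF u, folded N'_def l'_def]]) (rule H)
    then obtain K L' where KL: "is_pruning S.M ([], 0) K"
      "iterated_reduction H n (S.M, ([], 0)) = (submetric S.M K, ([], 0))"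
      "is_pruning T.M ([], 0) L'" "iterated_reduction H n (T.M, ([], 0)) = (submetric T.M L', ([], 0))"
      "\<forall>x\<in>mspace S.M - {([], 0)}. x \<in> K \<longleftrightarrow> (case x of (v, s) \<Rightarrow> (u @ v, s)) \<in> L'"
      by (elim exE conjE)
    have "submetric T.M L = submetric T.M L'" using L(2) KL(4) by simp
    then have "mspace (submetric T.M L) = mspace (submetric T.M L')" by simp
    \<comment> \<open>The parallel reduction yields its own set \<open>L'\<close>; both subsets
      induce the same reduced space, so they have the same points.\<close>
    then have LL: "L' = L" using LM is_pruning_subset[OF KL(3)] by (simp add: Int_absorb2)
    have KS: "K \<subseteq> S.points" "([], 0) \<in> K"
      using is_pruning_subset[OF KL(1)] is_pruning_root[OF KL(1)] by simp_all
    have "(\<lambda>w. \<omega> (u @ w)) \<in> survivors H n \<longleftrightarrow> K \<noteq> {([], 0)}"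
      using KS KL(2) by (simp add: survivors_def rtS is_empty_tree_def Int_absorb2)
    also have "\<dots> \<longleftrightarrow> (\<exists>v s. (v, s) \<in> K - {([], 0)})" using KS(2) by auto
    also have "\<dots> \<longleftrightarrow> (\<exists>v s. (v, s) \<in> mspace S.M - {([], 0)} \<and> (u @ v, s) \<in> L - {([], 0)})"
    proof -
      have "(v, s) \<in> K - {([], 0)} \<longleftrightarrow> (v, s) \<in> mspace S.M - {([], 0)} \<and> (u @ v, s) \<in> L - {([], 0)}" for v s
      proof (cases "(v, s) \<in> mspace S.M - {([], 0)}")
        case True
        then have "(v, s) \<in> K \<longleftrightarrow> (u @ v, s) \<in> L" using bspec[OF KL(5) True] LL by simp
        moreover have "(u @ v, s) \<noteq> ([], 0)" using True by (auto simp: tree_points_def)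
        ultimately show ?thesis using True by simp
      next
        case False
        then show ?thesis using KS by auto
      qed
      then show ?thesis by simp
    qed
    also have "\<dots> \<longleftrightarrow> 0 < c u"
    proof
      have l0: "l' [] = snd (\<omega> u)" by (simp add: l'_def)
      assume "0 < c u"
      then have "(u @ [], c u) \<in> L - {([], 0)}" "([], c u) \<in> mspace S.M - {([], 0)}"
        using c(2) u P.cut_le[OF u] family.intros(1) by (auto simp: tree_points_def l0)
      then show "\<exists>v s. (v, s) \<in> mspace S.M - {([], 0)} \<and> (u @ v, s) \<in> L - {([], 0)}" by blast
    next
      assume "\<exists>v s. (v, s) \<in> mspace S.M - {([], 0)} \<and> (u @ v, s) \<in> L - {([], 0)}"
      then obtain v s where "u @ v \<in> family (fst \<circ> \<omega>)" "0 < c (u @ v)" using c(2) by auto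
      then show "0 < c u" using P.cut_prefix[of u v] T.length_pos[OF u] by (cases "v = []") auto
    qed
    finally show ?thesis .
  qed
  then show ?thesis using that[OF c(1), of L] L(2) rL branch rt by simp
qed

lemma survivors_child:
  assumes "finite (family (fst \<circ> \<omega>))" "\<And>u. 0 < snd (\<omega> u)" "\<And>n. n \<ge> 1 \<Longrightarrow> hereditary (H n)"
    and i: "i < fst (\<omega> [])" "(\<lambda>w. \<omega> (i # w)) \<in> survivors H n"
  shows "\<omega> \<in> survivors H n"
proof (rule random_tree_pruning[of \<omega> H n])
  show "finite (family (fst \<circ> \<omega>))" "\<And>u. 0 < snd (\<omega> u)" "\<And>n. n \<ge> 1 \<Longrightarrow> hereditary (H n)"
    using assms(1-3) by blast+
next
  fix c L
  assume P: "pruned_metric_tree (fst \<circ> \<omega>) (snd \<circ> \<omega>) c"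
    and E: "\<And>u. u \<in> family (fst \<circ> \<omega>) \<Longrightarrow> (\<lambda>w. \<omega> (u @ w)) \<in> survivors H n \<longleftrightarrow> 0 < c u"
  interpret P: pruned_metric_tree "fst \<circ> \<omega>" "snd \<circ> \<omega>" c by fact
  have f: "[] @ [i] \<in> family (fst \<circ> \<omega>)" using i(1) by (simp only: family_snoc family.intros(1)) simp
  then have "0 < c ([] @ [i])" using E[of "[i]"] i(2) by simp
  then have "0 < c []" using P.cut_full[OF f] P.length_pos[OF family.intros(1)] by simp
  then show ?thesis using E[OF family.intros(1)] by simp
qed

lemma shape_of_survivor:
  assumes "finite (family (fst \<circ> \<omega>))" "\<And>u. 0 < snd (\<omega> u)" "\<And>n. n \<ge> 1 \<Longrightarrow> hereditary (H n)"
    and \<omega>: "\<omega> \<in> survivors H n" and t: "pruned_shape True fst (survivors H n) \<omega> t"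
  shows "shape (iterated_reduction H n (random_tree \<omega>)) = Node {#t#}"
proof (rule random_tree_pruning[of \<omega> H n])
  show "finite (family (fst \<circ> \<omega>))" "\<And>u. 0 < snd (\<omega> u)" "\<And>n. n \<ge> 1 \<Longrightarrow> hereditary (H n)"
    using assms(1-3) by blast+
next
  fix c L
  assume P: "pruned_metric_tree (fst \<circ> \<omega>) (snd \<circ> \<omega>) c"
    and R: "iterated_reduction H n (random_tree \<omega>) = (submetric (fst (random_tree \<omega>)) L, ([], 0))"
    and L: "([], 0) \<in> L" "L - {([], 0)} = pruned_metric_tree.branch (fst \<circ> \<omega>) c []"
    and E: "\<And>u. u \<in> family (fst \<circ> \<omega>) \<Longrightarrow> (\<lambda>w. \<omega> (u @ w)) \<in> survivors H n \<longleftrightarrow> 0 < c u"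
  interpret P: pruned_metric_tree "fst \<circ> \<omega>" "snd \<circ> \<omega>" c by fact
  have rt: "random_tree \<omega> = (P.M, ([], 0))" using assms(1) by (simp add: random_tree_def P.metric_tree_eq)
  let ?X = "iterated_reduction H n (random_tree \<omega>)"
  have sub: "P.branch [] \<subseteq> P.points" using P.branch_tree_points by blast
  then have "L \<subseteq> P.points" using L by blast
  then have X: "fst ?X = submetric P.M L" "snd ?X = ([], 0)" "mspace (fst ?X) = L"
    using R rt by (simp_all add: Int_absorb2)
  have gX: "gprod (fst ?X) (snd ?X) = gprod P.M ([], 0)" by (intro ext) (simp add: gprod_def X)
  have g: "gprod (fst ?X) (snd ?X) (id x) (id y) = meet (snd \<circ> \<omega>) x y" if "x \<in> P.branch []" "y \<in> P.branch []" for x y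
    unfolding gX id_apply by (rule P.gprod_M[OF subsetD[OF sub that(1)] subsetD[OF sub that(2)]])
  have "0 < c []" using E[OF family.intros(1)] \<omega> by simp
  then have bs: "branch_shape (meet (snd \<circ> \<omega>)) (base_height (snd \<circ> \<omega>) []) (P.branch []) t"
    by (intro P.branch_shape_branch[OF t, where \<omega>\<^sub>0 = \<omega>]) (use E family.intros(1) in simp_all)
  have ker: "meet_kernel (meet (snd \<circ> \<omega>)) (P.branch [])"
    using meet_kernel_subset[OF P.meet_kernel_points sub] .
  have set: "mspace (fst ?X) - {snd ?X} = id ` P.branch []" using X L by simp
  show ?thesis
  proof (rule shape_eq_of_branch_shape)
    have "branch_shape (gprod (fst ?X) (snd ?X)) (base_height (snd \<circ> \<omega>) []) (id ` P.branch []) t"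
      by (rule branch_shape_image[OF bs]) (simp, rule g)
    then show "branch_shape (gprod (fst ?X) (snd ?X)) 0 (mspace (fst ?X) - {snd ?X}) t"
      unfolding set by simp
    show "meet_kernel (gprod (fst ?X) (snd ?X)) (mspace (fst ?X) - {snd ?X})"
      unfolding set by (rule meet_kernel_image[OF ker]) (rule g)
    show "snd ?X \<in> mspace (fst ?X)" using X L by simp
    show "\<not> is_empty_tree ?X" using \<omega> by (simp add: survivors_def)
  qed
qed

section \<open>Recursion for the law of the pruned shape\<close>

text \<open>Trees are layered by depth, and finite multisets over a countable layer are images of
  lists. Countability makes \<open>planted_tree\<close> measurable and turns sets of shapes into
  countable unions of events.\<close>

lemma countable_ctree: "countable (UNIV :: ctree set)"
proof -
  define C where "C = rec_nat {} (\<lambda>_ A. Node ` {M. set_mset M \<subseteq> A})"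
  have C_simps: "C 0 = {}" "C (Suc d) = Node ` {M. set_mset M \<subseteq> C d}" for d by (simp_all add: C_def)
  have c: "countable (C d)" for d
  proof (induction d)
    case (Suc d)
    have "{M. set_mset M \<subseteq> C d} = mset ` lists (C d)"
    proof (intro equalityI subsetI)
      fix M assume "M \<in> {M. set_mset M \<subseteq> C d}"
      moreover obtain xs where "M = mset xs" by (metis ex_mset)
      ultimately show "M \<in> mset ` lists (C d)" by (auto simp: in_lists_conv_set)
    qed auto
    then show ?case using Suc by (simp add: C_simps)
  qed (simp add: C_simps)
  have mono: "C d \<subseteq> C (Suc d)" for d by (induction d) (auto simp: C_simps)
  then have mono': "d \<le> d' \<Longrightarrow> C d \<subseteq> C d'" for d d' by (rule lift_Suc_mono_le)
  have "\<exists>d. t \<in> C d" for t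
  proof (induction t)
    case (Node M)
    then have "\<forall>t\<in>set_mset M. \<exists>d. t \<in> C d" by blast
    from bchoice[OF this] obtain d where d: "\<forall>t\<in>set_mset M. t \<in> C (d t)" by blast
    obtain D where D: "\<forall>t\<in>set_mset M. d t \<le> D" using finite_nat_set_iff_bounded_le[of "d ` set_mset M"] by auto
    then have "set_mset M \<subseteq> C D" using d mono' by blast
    then show ?case by (intro exI[of _ "Suc D"]) (simp add: C_simps)
  qed
  then have "(UNIV :: ctree set) = (\<Union>d. C d)" by blast
  moreover have "countable (\<Union>d. C d)" using c by (intro countable_UN) auto
  ultimately show ?thesis by (rule ssubst)
qed

text \<open>The ways of distributing the shapes in M over the children in J. Extensional functions
  represent each distribution exactly once, so that they can be counted.\<close>

definition arrangements :: "nat set \<Rightarrow> 'a multiset \<Rightarrow> (nat \<Rightarrow> 'a) set" where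
  "arrangements J M = {\<sigma> \<in> J \<rightarrow>\<^sub>E set_mset M. image_mset \<sigma> (mset_set J) = M}"

lemma finite_arrangements: "finite J \<Longrightarrow> finite (arrangements J M)"
  unfolding arrangements_def by (rule finite_subset[OF _ finite_PiE[of J "\<lambda>_. set_mset M"]]) auto

lemma arrangements_size: "\<sigma> \<in> arrangements J M \<Longrightarrow> card J = size M"
  by (auto simp: arrangements_def)

lemma card_arrangements:
  assumes J: "finite J" "card J = size M"
  shows "card (arrangements J M) = card (arrangements {..<size M} M)"
proof -
  obtain e where e: "bij_betw e {..<size M} J"
    using ex_bij_betw_nat_finite[OF J(1)] J(2) by (auto simp: atLeast0LessThan)
  let ?g = "inv_into {..<size M} e"
  have g: "bij_betw ?g J {..<size M}" using bij_betw_inv_into[OF e] .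
  have *: "(\<lambda>\<sigma>. restrict (\<sigma> \<circ> h) B) ` arrangements A M \<subseteq> arrangements B M"
    if h: "bij_betw h B A" for h :: "nat \<Rightarrow> nat" and A B
  proof
    fix \<rho> assume "\<rho> \<in> (\<lambda>\<sigma>. restrict (\<sigma> \<circ> h) B) ` arrangements A M"
    then obtain \<sigma> where \<sigma>: "\<sigma> \<in> arrangements A M" "\<rho> = restrict (\<sigma> \<circ> h) B" by blast
    have hB: "h x \<in> A" if "x \<in> B" for x using h that by (auto simp: bij_betw_def)
    have "image_mset \<rho> (mset_set B) = image_mset (\<sigma> \<circ> h) (mset_set B)"
    proof (cases "finite B")
      case True
      then show ?thesis unfolding \<sigma>(2) by (intro image_mset_cong) simp
    qed simp
    also have "\<dots> = image_mset \<sigma> (mset_set A)"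
      using h by (simp add: multiset.map_comp[symmetric] image_mset_mset_set bij_betw_def)
    finally show "\<rho> \<in> arrangements B M"
      using \<sigma> hB by (auto simp: arrangements_def PiE_iff)
  qed
  have "bij_betw (\<lambda>\<sigma>. restrict (\<sigma> \<circ> e) {..<size M}) (arrangements J M) (arrangements {..<size M} M)"
  proof (rule bij_betw_byWitness[where f' = "\<lambda>\<sigma>. restrict (\<sigma> \<circ> ?g) J"])
    show "\<forall>\<sigma>\<in>arrangements J M. restrict (restrict (\<sigma> \<circ> e) {..<size M} \<circ> ?g) J = \<sigma>"
    proof
      fix \<sigma> assume \<sigma>: "\<sigma> \<in> arrangements J M"
      show "restrict (restrict (\<sigma> \<circ> e) {..<size M} \<circ> ?g) J = \<sigma>"
      proof (rule extensionalityI[of _ J])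
        show "\<sigma> \<in> extensional J" using \<sigma> by (auto simp: arrangements_def PiE_def)
        fix x assume x: "x \<in> J"
        then have "?g x \<in> {..<size M}" "e (?g x) = x"
          using g e f_inv_into_f[of x e "{..<size M}"] by (auto simp: bij_betw_def)
        then show "restrict (restrict (\<sigma> \<circ> e) {..<size M} \<circ> ?g) J x = \<sigma> x" using x by simp
      qed simp
    qed
    show "\<forall>\<sigma>\<in>arrangements {..<size M} M. restrict (restrict (\<sigma> \<circ> ?g) J \<circ> e) {..<size M} = \<sigma>"
    proof
      fix \<sigma> assume \<sigma>: "\<sigma> \<in> arrangements {..<size M} M"
      show "restrict (restrict (\<sigma> \<circ> ?g) J \<circ> e) {..<size M} = \<sigma>"
      proof (rule extensionalityI[of _ "{..<size M}"])
        show "\<sigma> \<in> extensional {..<size M}" using \<sigma> by (auto simp: arrangements_def PiE_def)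
        fix x assume x: "x \<in> {..<size M}"
        then have "e x \<in> J" "?g (e x) = x" using e by (auto simp: bij_betw_def)
        then show "restrict (restrict (\<sigma> \<circ> ?g) J \<circ> e) {..<size M} x = \<sigma> x" using x by simp
      qed simp
    qed
  qed (use * e g in blast)+
  then show ?thesis by (rule bij_betw_same_card)
qed

text \<open>The marks are left abstract because two sample spaces occur: bare offspring numbers for
  \<open>GW\<close>, and pairs with edge lengths for the metric tree.\<close>

locale offspring_space = M0: prob_space M0 for M0 :: "'s measure" +
  fixes \<nu> :: "'s \<Rightarrow> nat" and q :: "nat pmf"
  assumes measurable_\<nu> [measurable]: "\<nu> \<in> measurable M0 (count_space UNIV)"
    and \<nu>_law: "M0.prob {x \<in> space M0. \<nu> x = k} = pmf q k"
begin

definition P :: "(nat list \<Rightarrow> 's) measure" where "P = (\<Pi>\<^sub>M u\<in>UNIV. M0)"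

abbreviation child :: "nat \<Rightarrow> (nat list \<Rightarrow> 's) \<Rightarrow> nat list \<Rightarrow> 's" where
  "child i \<omega> \<equiv> \<lambda>w. \<omega> (i # w)"

sublocale P: prob_space P
  unfolding P_def by (rule prob_space_PiM) (rule M0.prob_space_axioms)

lemma space_P: "space P = {\<omega>. \<forall>u. \<omega> u \<in> space M0}"
  by (auto simp: P_def space_PiM PiE_def)

lemma measurable_coord [measurable]: "(\<lambda>\<omega>. \<omega> u) \<in> measurable P M0"
  unfolding P_def by (rule measurable_component_singleton) simp

lemma measurable_child [measurable]: "child i \<in> measurable P P"
proof -
  have "(\<lambda>\<omega> w. \<omega> (i # w)) \<in> measurable P (\<Pi>\<^sub>M u\<in>UNIV. M0)"
    by (rule measurable_PiM_single') (auto simp: space_P)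
  then show ?thesis by (simp add: P_def)
qed

lemma child_space: "\<omega> \<in> space P \<Longrightarrow> child i \<omega> \<in> space P"
  by (auto simp: space_P)

lemma distr_child: "distr P P (child i) = P"
  using distr_PiM_reindex[of UNIV "\<lambda>_. M0" "(#) i" UNIV] M0.prob_space_axioms
  by (simp add: P_def restrict_UNIV)

lemma prob_child: "B \<in> sets P \<Longrightarrow> P.prob {\<omega> \<in> space P. child i \<omega> \<in> B} = P.prob B"
  using measure_distr[OF measurable_child, of B i] distr_child[of i]
  by (simp add: vimage_def Int_def conj_commute)

lemma prob_root: "P.prob {\<omega> \<in> space P. \<nu> (\<omega> []) = k} = pmf q k"
proof -
  have "distr P M0 (\<lambda>\<omega>. \<omega> []) = M0"
    unfolding P_def by (rule distr_PiM_component) (auto intro: M0.prob_space_axioms)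
  moreover have "P.prob ((\<lambda>\<omega>. \<omega> []) -` {x \<in> space M0. \<nu> x = k} \<inter> space P) =
      measure (distr P M0 (\<lambda>\<omega>. \<omega> [])) {x \<in> space M0. \<nu> x = k}"
    by (rule measure_distr[symmetric]) measurable
  moreover have "(\<lambda>\<omega>. \<omega> []) -` {x \<in> space M0. \<nu> x = k} \<inter> space P = {\<omega> \<in> space P. \<nu> (\<omega> []) = k}"
    by (auto simp: space_P)
  ultimately show ?thesis using \<nu>_law by simp
qed

lemma indep_coordinates: "P.indep_vars (\<lambda>_. M0) (\<lambda>u \<omega>. \<omega> u) UNIV"
proof (subst P.indep_vars_iff_distr_eq_PiM)
  have "distr P M0 (\<lambda>\<omega>. \<omega> u) = M0" for u
    unfolding P_def by (rule distr_PiM_component) (auto intro: M0.prob_space_axioms)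
  then show "distr P (\<Pi>\<^sub>M i\<in>UNIV. M0) (\<lambda>x. \<lambda>i\<in>UNIV. x i) = (\<Pi>\<^sub>M i\<in>UNIV. distr P M0 (\<lambda>\<omega>. \<omega> i))"
    by (simp add: restrict_UNIV P_def[symmetric] distr_id)
qed auto

text \<open>The branching property: the root and the subtrees of its children depend on disjoint
  blocks of independent coordinates.\<close>

lemma prob_root_children:
  assumes B: "\<And>i. i < k \<Longrightarrow> B i \<in> sets P"
  shows "P.prob {\<omega> \<in> space P. \<nu> (\<omega> []) = k \<and> (\<forall>i<k. child i \<omega> \<in> B i)} = pmf q k * (\<Prod>i<k. P.prob (B i))"
proof -
  define K where "K j = (case j of None \<Rightarrow> {[]} | Some i \<Rightarrow> range ((#) i))" for j :: "nat option"
  have ind: "P.indep_vars (\<lambda>j. PiM (K j) (\<lambda>_. M0)) (\<lambda>j \<omega>. restrict (\<lambda>u. \<omega> u) (K j)) UNIV"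
    by (rule P.indep_vars_restrict[OF indep_coordinates])
       (auto simp: K_def disjoint_family_on_def split: option.splits)
  define J where "J = insert None (Some ` {..<k})"
  define A where "A j = (case j of None \<Rightarrow> {f \<in> space (PiM (K None) (\<lambda>_. M0)). \<nu> (f []) = k}
    | Some i \<Rightarrow> {f \<in> space (PiM (K (Some i)) (\<lambda>_. M0)). (\<lambda>w. f (i # w)) \<in> B i})" for j
  have mA: "A j \<in> sets (PiM (K j) (\<lambda>_. M0))" if "j \<in> J" for j
  proof (cases j)
    case None
    have "(\<lambda>f. f []) \<in> measurable (PiM (K None) (\<lambda>_. M0)) M0"
      by (rule measurable_component_singleton) (simp add: K_def)
    from measurable_sets[OF measurable_compose[OF this measurable_\<nu>], of "{k}"]
    show ?thesis by (simp add: A_def None vimage_def Int_def conj_commute)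
  next
    case (Some i)
    have "(\<lambda>f w. f (i # w)) \<in> measurable (PiM (K (Some i)) (\<lambda>_. M0)) (\<Pi>\<^sub>M u\<in>UNIV. M0)"
    proof (rule measurable_PiM_single')
      show "(\<lambda>f. f (i # w)) \<in> measurable (PiM (K (Some i)) (\<lambda>_. M0)) M0" for w
        by (rule measurable_component_singleton) (simp add: K_def)
      show "(\<lambda>f w. f (i # w)) \<in> space (PiM (K (Some i)) (\<lambda>_. M0)) \<rightarrow> UNIV \<rightarrow>\<^sub>E space M0"
        by (auto simp: space_PiM K_def PiE_def)
    qed
    then have "(\<lambda>f w. f (i # w)) \<in> measurable (PiM (K (Some i)) (\<lambda>_. M0)) P" by (simp add: P_def)
    from measurable_sets[OF this B[of i]] show ?thesis
      using that Some by (auto simp: A_def J_def vimage_def Int_def conj_commute)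
  qed
  have X: "(\<lambda>\<omega>. restrict (\<lambda>u. \<omega> u) (K j)) -` A j \<inter> space P =
      (case j of None \<Rightarrow> {\<omega> \<in> space P. \<nu> (\<omega> []) = k} | Some i \<Rightarrow> {\<omega> \<in> space P. child i \<omega> \<in> B i})" for j
    by (auto simp: A_def K_def space_P space_PiM split: option.splits)
  have "P.prob (\<Inter>j\<in>J. (\<lambda>\<omega>. restrict (\<lambda>u. \<omega> u) (K j)) -` A j \<inter> space P) =
      (\<Prod>j\<in>J. P.prob ((\<lambda>\<omega>. restrict (\<lambda>u. \<omega> u) (K j)) -` A j \<inter> space P))"
    by (rule P.indep_varsD[OF ind]) (use mA in \<open>auto simp: J_def\<close>)
  also have "(\<Inter>j\<in>J. (\<lambda>\<omega>. restrict (\<lambda>u. \<omega> u) (K j)) -` A j \<inter> space P) =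
      {\<omega> \<in> space P. \<nu> (\<omega> []) = k \<and> (\<forall>i<k. child i \<omega> \<in> B i)}"
    unfolding X by (auto simp: J_def)
  also have "(\<Prod>j\<in>J. P.prob ((\<lambda>\<omega>. restrict (\<lambda>u. \<omega> u) (K j)) -` A j \<inter> space P)) = pmf q k * (\<Prod>i<k. P.prob (B i))"
    unfolding X J_def by (subst prod.insert) (auto simp: prob_root prod.reindex prob_child B)
  finally show ?thesis .
qed

lemma sets_root_children:
  assumes B: "\<And>i. i < k \<Longrightarrow> B i \<in> sets P"
  shows "{\<omega> \<in> space P. \<nu> (\<omega> []) = k \<and> (\<forall>i<k. child i \<omega> \<in> B i)} \<in> sets P"
proof -
  have "{\<omega> \<in> space P. \<nu> (\<omega> []) = k} \<in> sets P" by measurable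
  moreover have "{\<omega> \<in> space P. \<forall>i\<in>{..<k}. child i \<omega> \<in> B i} \<in> sets P"
  proof (rule sets.sets_Collect_finite_All)
    fix i assume "i \<in> {..<k}"
    then have "child i -` B i \<inter> space P \<in> sets P" using measurable_sets[OF measurable_child B] by simp
    then show "{\<omega> \<in> space P. child i \<omega> \<in> B i} \<in> sets P" by (simp add: vimage_def Int_def conj_commute)
  qed simp
  ultimately have "{\<omega> \<in> space P. \<nu> (\<omega> []) = k} \<inter> {\<omega> \<in> space P. \<forall>i\<in>{..<k}. child i \<omega> \<in> B i} \<in> sets P" by (rule sets.Int)
  then show ?thesis by (rule back_subst[of "\<lambda>S. S \<in> sets P"]) auto
qed

end

text \<open>Heredity is asked almost surely, because a sample with infinite family is assigned the
  empty tree although the subtree of a child may be finite and survive.\<close>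

locale pruned_offspring = offspring_space M0 \<nu> q for M0 :: "'s measure" and \<nu> q +
  fixes b :: bool and E :: "(nat list \<Rightarrow> 's) set"
  assumes E_sets [measurable]: "E \<in> sets P"
    and E_hereditary: "AE \<omega> in P. (\<exists>i<\<nu> (\<omega> []). child i \<omega> \<in> E) \<longrightarrow> \<omega> \<in> E"
begin

definition alive :: "(nat list \<Rightarrow> 's) \<Rightarrow> nat set" where
  "alive \<omega> = {i. i < \<nu> (\<omega> []) \<and> child i \<omega> \<in> E}"

text \<open>\<open>Z t\<close> stands for the event of having shape t. It is a parameter because the
  measurability of \<open>shape_event\<close> is obtained by inserting approximating events
  first.\<close>

definition node_event :: "(ctree \<Rightarrow> (nat list \<Rightarrow> 's) set) \<Rightarrow> ctree multiset \<Rightarrow> (nat list \<Rightarrow> 's) set" where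
  "node_event Z M = {\<omega> \<in> space P. \<exists>ts. (\<forall>i\<in>alive \<omega>. child i \<omega> \<in> Z (ts i)) \<and>
     image_mset ts (mset_set (alive \<omega>)) = M}"

definition cell :: "(ctree \<Rightarrow> (nat list \<Rightarrow> 's) set) \<Rightarrow> nat \<Rightarrow> nat set \<Rightarrow> (nat \<Rightarrow> ctree) \<Rightarrow> (nat list \<Rightarrow> 's) set" where
  "cell Z k J \<sigma> = {\<omega> \<in> space P. \<nu> (\<omega> []) = k \<and>
     (\<forall>i<k. child i \<omega> \<in> (if i \<in> J then E \<inter> Z (\<sigma> i) else space P - E))}"

text \<open>The factor for exactly m surviving children, formally the m-th derivative of Q at
  \<open>1 - P.prob E\<close> divided by \<open>m!\<close>.\<close>

definition coeff :: "nat \<Rightarrow> real" where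
  "coeff m = (\<Sum>k. pmf q k * real (k choose m) * (1 - P.prob E) ^ (k - m))"

lemma finite_alive [simp]: "finite (alive \<omega>)"
  by (simp add: alive_def)

lemma alive_cell: "\<omega> \<in> cell Z k J \<sigma> \<Longrightarrow> J \<subseteq> {..<k} \<Longrightarrow> alive \<omega> = J"
  by (auto simp: cell_def alive_def split: if_splits)

lemma node_event_slice:
  "node_event Z M \<inter> {\<omega> \<in> space P. \<nu> (\<omega> []) = k} =
    (\<Union>(J, \<sigma>)\<in>Sigma (Pow {..<k}) (\<lambda>J. arrangements J M). cell Z k J \<sigma>)"
proof (intro equalityI subsetI)
  fix \<omega> assume \<omega>: "\<omega> \<in> node_event Z M \<inter> {\<omega> \<in> space P. \<nu> (\<omega> []) = k}"
  then obtain ts where ts: "\<forall>i\<in>alive \<omega>. child i \<omega> \<in> Z (ts i)" "image_mset ts (mset_set (alive \<omega>)) = M"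
    and sp: "\<omega> \<in> space P" "\<nu> (\<omega> []) = k" by (auto simp: node_event_def)
  define \<sigma> where "\<sigma> = restrict ts (alive \<omega>)"
  have "image_mset \<sigma> (mset_set (alive \<omega>)) = M"
    unfolding ts(2)[symmetric] by (rule image_mset_cong) (simp add: \<sigma>_def)
  moreover have "\<sigma> \<in> alive \<omega> \<rightarrow>\<^sub>E set_mset M"
    unfolding ts(2)[symmetric] by (auto simp: \<sigma>_def)
  ultimately have "\<sigma> \<in> arrangements (alive \<omega>) M" by (simp add: arrangements_def)
  moreover have "alive \<omega> \<subseteq> {..<k}" using sp by (auto simp: alive_def)
  moreover have "\<omega> \<in> cell Z k (alive \<omega>) \<sigma>"
    using sp ts(1) child_space[OF sp(1)] by (auto simp: cell_def \<sigma>_def alive_def)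
  ultimately show "\<omega> \<in> (\<Union>(J, \<sigma>)\<in>Sigma (Pow {..<k}) (\<lambda>J. arrangements J M). cell Z k J \<sigma>)" by blast
next
  fix \<omega> assume "\<omega> \<in> (\<Union>(J, \<sigma>)\<in>Sigma (Pow {..<k}) (\<lambda>J. arrangements J M). cell Z k J \<sigma>)"
  then obtain J \<sigma> where J: "J \<subseteq> {..<k}" "\<sigma> \<in> arrangements J M" "\<omega> \<in> cell Z k J \<sigma>" by blast
  have "alive \<omega> = J" using alive_cell J by blast
  moreover have "\<forall>i\<in>J. child i \<omega> \<in> Z (\<sigma> i)" using J(1,3) by (auto simp: cell_def)
  moreover have "image_mset \<sigma> (mset_set J) = M" using J(2) by (simp add: arrangements_def)
  ultimately show "\<omega> \<in> node_event Z M \<inter> {\<omega> \<in> space P. \<nu> (\<omega> []) = k}"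
    using J(3) by (auto simp: node_event_def cell_def)
qed

lemma arrangement_in: "\<sigma> \<in> arrangements J M \<Longrightarrow> i \<in> J \<Longrightarrow> \<sigma> i \<in># M"
  by (auto simp: arrangements_def)

lemma sets_cell:
  assumes "J \<subseteq> {..<k}" and \<sigma>: "\<sigma> \<in> arrangements J M" and Z: "\<And>t. t \<in># M \<Longrightarrow> Z t \<in> sets P"
  shows "cell Z k J \<sigma> \<in> sets P"
  unfolding cell_def by (rule sets_root_children) (use Z[OF arrangement_in[OF \<sigma>]] in auto)

lemma sets_node_event_slice:
  assumes Z: "\<And>t. t \<in># M \<Longrightarrow> Z t \<in> sets P"
  shows "node_event Z M \<inter> {\<omega> \<in> space P. \<nu> (\<omega> []) = k} \<in> sets P"
  unfolding node_event_slice
proof (rule sets.finite_UN)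
  show "finite (Sigma (Pow {..<k}) (\<lambda>J. arrangements J M))"
    by (intro finite_SigmaI finite_arrangements) (auto intro: finite_subset)
  fix x assume "x \<in> Sigma (Pow {..<k}) (\<lambda>J. arrangements J M)"
  then show "(case x of (J, \<sigma>) \<Rightarrow> cell Z k J \<sigma>) \<in> sets P"
    using Z by (auto intro!: sets_cell[where M = M])
qed

lemma node_event_UN: "node_event Z M = (\<Union>k. node_event Z M \<inter> {\<omega> \<in> space P. \<nu> (\<omega> []) = k})"
  by (auto simp: node_event_def)

lemma sets_node_event:
  assumes Z: "\<And>t. t \<in># M \<Longrightarrow> Z t \<in> sets P"
  shows "node_event Z M \<in> sets P"
  by (subst node_event_UN) (intro sets.countable_UN image_subsetI sets_node_event_slice Z)

lemma prob_cell:
  assumes J: "J \<subseteq> {..<k}" and \<sigma>: "\<sigma> \<in> arrangements J M" and Z: "\<And>t. t \<in># M \<Longrightarrow> Z t \<in> sets P"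
  shows "P.prob (cell Z k J \<sigma>) =
    pmf q k * ((\<Prod>t\<in>#M. P.prob (E \<inter> Z t)) * (1 - P.prob E) ^ (k - size M))"
proof -
  have fin: "finite J" using J finite_subset by blast
  have "P.prob (cell Z k J \<sigma>) =
      pmf q k * (\<Prod>i<k. P.prob (if i \<in> J then E \<inter> Z (\<sigma> i) else space P - E))"
    unfolding cell_def by (rule prob_root_children) (use Z[OF arrangement_in[OF \<sigma>]] in auto)
  also have "(\<Prod>i<k. P.prob (if i \<in> J then E \<inter> Z (\<sigma> i) else space P - E)) =
      (\<Prod>i\<in>J. P.prob (E \<inter> Z (\<sigma> i))) * (\<Prod>i\<in>{..<k} - J. 1 - P.prob E)"
    by (subst prod.subset_diff[OF J]) (auto simp: mult.commute P.prob_compl intro!: arg_cong2[of _ _ _ _ "(*)"] prod.cong)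
  also have "(\<Prod>i\<in>J. P.prob (E \<inter> Z (\<sigma> i))) = (\<Prod>t\<in>#M. P.prob (E \<inter> Z t))"
    using \<sigma> by (auto simp: arrangements_def prod_unfold_prod_mset multiset.map_comp comp_def)
  also have "(\<Prod>i\<in>{..<k} - J. 1 - P.prob E) = (1 - P.prob E) ^ (k - size M)"
    using arrangements_size[OF \<sigma>] J by (simp add: card_Diff_subset fin)
  finally show ?thesis .
qed

lemma sum_card_arrangements:
  "(\<Sum>J\<in>Pow {..<k}. card (arrangements J M)) = (k choose size M) * card (arrangements {..<size M} M)"
proof -
  have "(\<Sum>J\<in>Pow {..<k}. card (arrangements J M)) =
      (\<Sum>J\<in>{J. J \<subseteq> {..<k} \<and> card J = size M}. card (arrangements J M))"
  proof (rule sum.mono_neutral_right)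
    show "\<forall>J\<in>Pow {..<k} - {J. J \<subseteq> {..<k} \<and> card J = size M}. card (arrangements J M) = 0"
    proof
      fix J assume "J \<in> Pow {..<k} - {J. J \<subseteq> {..<k} \<and> card J = size M}"
      then have "arrangements J M = {}" using arrangements_size[of _ J M] by blast
      then show "card (arrangements J M) = 0" by simp
    qed
  qed auto
  also have "\<dots> = (\<Sum>J\<in>{J. J \<subseteq> {..<k} \<and> card J = size M}. card (arrangements {..<size M} M))"
    by (intro sum.cong refl card_arrangements) (auto intro: finite_subset)
  also have "\<dots> = (k choose size M) * card (arrangements {..<size M} M)"
    using n_subsets[of "{..<k}" "size M"] by simp
  finally show ?thesis .
qed

text \<open>Given the offspring number k and the set J of surviving children, the subtrees are
  independent. The number of choices of J with an arrangement factors into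
  \<open>k choose size M\<close> and a count depending on M alone, and the sum over k leaves
  \<open>coeff\<close>.\<close>

lemma prob_node_event:
  assumes Z: "\<And>t. t \<in># M \<Longrightarrow> Z t \<in> sets P"
    and disj: "\<And>t t'. t \<in># M \<Longrightarrow> t' \<in># M \<Longrightarrow> t \<noteq> t' \<Longrightarrow> Z t \<inter> Z t' = {}"
  shows "P.prob (node_event Z M) =
    real (card (arrangements {..<size M} M)) * (\<Prod>t\<in>#M. P.prob (E \<inter> Z t)) * coeff (size M)"
proof -
  define w where "w = (\<Prod>t\<in>#M. P.prob (E \<inter> Z t))"
  define c where "c = real (card (arrangements {..<size M} M))"
  let ?f = "\<lambda>k. pmf q k * real (k choose size M) * (1 - P.prob E) ^ (k - size M)"
  have slice: "P.prob (node_event Z M \<inter> {\<omega> \<in> space P. \<nu> (\<omega> []) = k}) = (c * w) * ?f k" for k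
  proof -
    let ?I = "Sigma (Pow {..<k}) (\<lambda>J. arrangements J M)"
    have finJ: "finite J" if "J \<in> Pow {..<k}" for J using that by (auto intro: finite_subset)
    have "P.prob (node_event Z M \<inter> {\<omega> \<in> space P. \<nu> (\<omega> []) = k}) =
        (\<Sum>x\<in>?I. P.prob (case x of (J, \<sigma>) \<Rightarrow> cell Z k J \<sigma>))"
      unfolding node_event_slice
    proof (rule P.finite_measure_finite_Union)
      show "finite ?I" by (intro finite_SigmaI finite_arrangements finJ) auto
      show "(\<lambda>(J, \<sigma>). cell Z k J \<sigma>) ` ?I \<subseteq> P.events"
        using Z by (auto intro!: sets_cell[where M = M])
      show "disjoint_family_on (\<lambda>(J, \<sigma>). cell Z k J \<sigma>) ?I"
        unfolding disjoint_family_on_def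
      proof (intro ballI impI)
        fix x y assume xy: "x \<in> ?I" "y \<in> ?I" "x \<noteq> y"
        obtain J \<sigma> J' \<sigma>' where e: "x = (J, \<sigma>)" "y = (J', \<sigma>')" by (cases x, cases y)
        have J: "J \<subseteq> {..<k}" "\<sigma> \<in> arrangements J M" "J' \<subseteq> {..<k}" "\<sigma>' \<in> arrangements J' M"
          using xy e by auto
        show "(case x of (J, \<sigma>) \<Rightarrow> cell Z k J \<sigma>) \<inter> (case y of (J, \<sigma>) \<Rightarrow> cell Z k J \<sigma>) = {}"
        proof (rule ccontr)
          assume "\<not> ?thesis"
          then obtain \<omega> where \<omega>: "\<omega> \<in> cell Z k J \<sigma>" "\<omega> \<in> cell Z k J' \<sigma>'" using e by auto
          have JJ: "J' = J" using alive_cell[OF \<omega>(1) J(1)] alive_cell[OF \<omega>(2) J(3)] by simp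
          have "\<sigma> i = \<sigma>' i" if "i \<in> J" for i
          proof (rule ccontr)
            assume "\<sigma> i \<noteq> \<sigma>' i"
            then have "Z (\<sigma> i) \<inter> Z (\<sigma>' i) = {}"
              using disj arrangement_in J that JJ by blast
            moreover have "i < k" using J(1) that by blast
            then have "child i \<omega> \<in> Z (\<sigma> i)" "child i \<omega> \<in> Z (\<sigma>' i)"
            proof -
              have "child i \<omega> \<in> (if i \<in> J then E \<inter> Z (\<sigma> i) else space P - E)"
                "child i \<omega> \<in> (if i \<in> J' then E \<inter> Z (\<sigma>' i) else space P - E)"
                using \<omega> \<open>i < k\<close> unfolding cell_def by blast+
              then show "child i \<omega> \<in> Z (\<sigma> i)" "child i \<omega> \<in> Z (\<sigma>' i)" using that JJ by simp_all
            qed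
            ultimately show False by blast
          qed
          then have "\<sigma> = \<sigma>'"
            using J(2,4) JJ by (intro extensionalityI[of \<sigma> J \<sigma>']) (auto simp: arrangements_def PiE_def)
          then show False using xy e JJ by simp
        qed
      qed
    qed
    also have "\<dots> = (\<Sum>x\<in>?I. pmf q k * (w * (1 - P.prob E) ^ (k - size M)))"
      by (intro sum.cong refl) (auto simp: w_def intro!: prob_cell Z)
    also have "\<dots> = real (card ?I) * (pmf q k * (w * (1 - P.prob E) ^ (k - size M)))"
      by simp
    also have "card ?I = (\<Sum>J\<in>Pow {..<k}. card (arrangements J M))"
      by (rule card_SigmaI) (auto intro!: finite_arrangements finJ)
    also have "\<dots> = (k choose size M) * card (arrangements {..<size M} M)" by (rule sum_card_arrangements)
    finally show ?thesis by (simp add: c_def)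
  qed
  have "(\<lambda>k. P.prob (node_event Z M \<inter> {\<omega> \<in> space P. \<nu> (\<omega> []) = k})) sums P.prob (node_event Z M)"
    by (subst (2) node_event_UN, rule P.finite_measure_UNION)
       (auto simp: disjoint_family_on_def intro!: sets_node_event_slice Z)
  then have s: "(\<lambda>k. (c * w) * ?f k) sums P.prob (node_event Z M)" unfolding slice .
  have "P.prob (node_event Z M) = c * w * coeff (size M)"
  \<comment> \<open>\<open>coeff\<close> is a \<open>suminf\<close> whose convergence is not yet
    known. For a nonzero factor it follows from the slice probabilities; otherwise both sides are
    0.\<close>
  proof (cases "c * w = 0")
    case True
    have "(\<lambda>k. 0) sums P.prob (node_event Z M)" using s unfolding True by simp
    then have "P.prob (node_event Z M) = 0" using sums_unique2[OF _ sums_zero] by blast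
    then show ?thesis unfolding True by simp
  next
    case False
    have "?f sums (P.prob (node_event Z M) / (c * w))" by (rule sums_mult_D[OF s False])
    then have "coeff (size M) = P.prob (node_event Z M) / (c * w)"
      unfolding coeff_def by (rule sums_unique[symmetric])
    then show ?thesis using False by simp
  qed
  then show ?thesis by (simp add: c_def w_def)
qed

definition shape_event :: "ctree \<Rightarrow> (nat list \<Rightarrow> 's) set" where
  "shape_event t = {\<omega> \<in> space P. pruned_shape b \<nu> E \<omega> t}"

lemma shape_event_disjoint: "t \<noteq> t' \<Longrightarrow> shape_event t \<inter> shape_event t' = {}"
  by (auto simp: shape_event_def dest: pruned_shape_unique)

lemma node_event_space: "\<omega> \<in> node_event Z M \<Longrightarrow> \<omega> \<in> space P"
  by (simp add: node_event_def)

text \<open>A merge passes the shape on to the only surviving child, so the event for a tree refers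
  to itself. This self-reference produces the factor \<open>1 - coeff 1\<close> in the
  recursion.\<close>

lemma shape_event_Node:
  "shape_event (Node M) = (if b \<and> size M = 1 then {} else node_event shape_event M) \<union>
     (if b then node_event shape_event {#Node M#} else {})"
proof (intro equalityI subsetI)
  fix \<omega> assume "\<omega> \<in> shape_event (Node M)"
  then have sp: "\<omega> \<in> space P" and "pruned_shape b \<nu> E \<omega> (Node M)" by (auto simp: shape_event_def)
  from this(2) show "\<omega> \<in> (if b \<and> size M = 1 then {} else node_event shape_event M) \<union>
     (if b then node_event shape_event {#Node M#} else {})"
  proof (cases rule: pruned_shape.cases)
    case (node I ts)
    have I: "alive \<omega> = I" using node(2) by (simp add: alive_def)
    have "size M = card I" using node(1) by simp
    moreover have "\<omega> \<in> node_event shape_event M"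
      unfolding node_event_def using sp node(1,4) I child_space[OF sp]
      by (auto simp: shape_event_def intro!: exI[of _ ts])
    ultimately show ?thesis using node(3) by auto
  next
    case (merge j)
    have "alive \<omega> = {j}" using merge(2) by (simp add: alive_def)
    moreover have "child j \<omega> \<in> shape_event (Node M)" using merge(3) child_space[OF sp] by (simp add: shape_event_def)
    ultimately have "\<omega> \<in> node_event shape_event {#Node M#}"
      unfolding node_event_def using sp by (auto intro!: exI[of _ "\<lambda>_. Node M"])
    then show ?thesis using merge(1) by simp
  qed
next
  fix \<omega> assume *: "\<omega> \<in> (if b \<and> size M = 1 then {} else node_event shape_event M) \<union>
     (if b then node_event shape_event {#Node M#} else {})"
  then have sp: "\<omega> \<in> space P" by (auto simp: node_event_def split: if_splits)
  from * consider "\<not> (b \<and> size M = 1)" "\<omega> \<in> node_event shape_event M" | "b" "\<omega> \<in> node_event shape_event {#Node M#}"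
    by (auto split: if_splits)
  then show "\<omega> \<in> shape_event (Node M)"
  proof cases
    case 1
    then obtain ts where ts: "\<forall>i\<in>alive \<omega>. child i \<omega> \<in> shape_event (ts i)" "image_mset ts (mset_set (alive \<omega>)) = M"
      by (auto simp: node_event_def)
    have "pruned_shape b \<nu> E \<omega> (Node (image_mset ts (mset_set (alive \<omega>))))"
    proof (rule pruned_shape.node)
      have "card (alive \<omega>) = size M" by (simp flip: ts(2))
      then show "card (alive \<omega>) \<noteq> 1" if b using 1(1) that by simp
    qed (use ts in \<open>auto simp: alive_def shape_event_def\<close>)
    then show ?thesis using sp ts by (simp add: shape_event_def)
  next
    case 2
    then obtain ts where ts: "\<forall>i\<in>alive \<omega>. child i \<omega> \<in> shape_event (ts i)"
      "image_mset ts (mset_set (alive \<omega>)) = {#Node M#}" by (auto simp: node_event_def)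
    then have "size (image_mset ts (mset_set (alive \<omega>))) = 1" by simp
    then obtain j where j: "alive \<omega> = {j}" by (auto simp: card_1_singleton_iff)
    then have "pruned_shape b \<nu> E (child j \<omega>) (Node M)" using ts by (simp add: shape_event_def)
    then have "pruned_shape b \<nu> E \<omega> (Node M)"
      using pruned_shape.merge[OF 2(1), of \<nu> \<omega> E j] j by (simp add: alive_def)
    then show ?thesis using sp by (simp add: shape_event_def)
  qed
qed

lemma node_event_mono: "(\<And>t. t \<in># M \<Longrightarrow> Z t \<subseteq> Z' t) \<Longrightarrow> node_event Z M \<subseteq> node_event Z' M"
  by (force simp: node_event_def)

text \<open>Because of the self-reference, induction on the tree alone does not reach this event. It
  is exhausted by the events \<open>D d\<close> that fewer than d merges precede the first proper
  vertex.\<close>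

lemma sets_shape_event [measurable]: "shape_event t \<in> sets P"
proof (induction t)
  case (Node M)
  have W: "node_event shape_event M \<in> sets P" by (rule sets_node_event) (use Node in simp)
  show ?case
  proof (cases b)
    case False
    then show ?thesis using W shape_event_Node by simp
  next
    case True
    define W' where "W' = (if size M = 1 then {} else node_event shape_event M)"
    define D where "D = rec_nat {} (\<lambda>_ A. W' \<union> node_event (\<lambda>_. A) {#Node M#})"
    have D: "D 0 = {}" "D (Suc d) = W' \<union> node_event (\<lambda>_. D d) {#Node M#}" for d
      by (simp_all add: D_def)
    have sets_D: "D d \<in> sets P" for d
      by (induction d) (use W in \<open>auto simp: D W'_def intro!: sets_node_event\<close>)
    have D_sub: "D d \<subseteq> shape_event (Node M)" for d
    proof (induction d)
      case (Suc d)
      have "node_event (\<lambda>_. D d) {#Node M#} \<subseteq> node_event shape_event {#Node M#}"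
        by (rule node_event_mono) (use Suc in auto)
      then show ?case unfolding D shape_event_Node W'_def using True by auto
    qed (simp add: D)
    have "\<exists>d. \<omega> \<in> D d" if "pruned_shape b \<nu> E \<omega> t" "t = Node M" "\<omega> \<in> space P" for \<omega> t
      using that
    proof (induction rule: pruned_shape.induct)
      case (node I \<omega> ts)
      have I: "alive \<omega> = I" using node(1) by (simp add: alive_def)
      have M: "M = image_mset ts (mset_set I)" using node.prems by simp
      have "size M \<noteq> 1" using node(2) True M by simp
      moreover have "\<omega> \<in> node_event shape_event M"
        unfolding node_event_def using node I M child_space
        by (auto simp: shape_event_def intro!: exI[of _ ts])
      ultimately show ?case by (intro exI[of _ "Suc 0"]) (simp add: D W'_def)
    next
      case (merge \<omega> j t)
      then obtain d where "child j \<omega> \<in> D d" using child_space by blast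
      moreover have "alive \<omega> = {j}" using merge(2) by (simp add: alive_def)
      ultimately have "\<omega> \<in> node_event (\<lambda>_. D d) {#Node M#}"
        unfolding node_event_def using merge.prems by (auto intro!: exI[of _ "\<lambda>_. Node M"])
      then show ?case by (intro exI[of _ "Suc d"]) (simp add: D)
    qed
    then have "shape_event (Node M) = (\<Union>d. D d)"
      using D_sub by (auto simp: shape_event_def)
    then show ?thesis using sets_D by simp
  qed
qed

definition shape_prob :: "ctree \<Rightarrow> real" where
  "shape_prob t = P.prob (E \<inter> shape_event t)"

text \<open>A nonempty M forces a surviving child, and then the sample lies in E almost surely by
  heredity.\<close>

lemma prob_E_node_event:
  assumes M: "M \<noteq> {#} \<or> E = space P"
  shows "P.prob (E \<inter> node_event shape_event M) =
    real (card (arrangements {..<size M} M)) * (\<Prod>t\<in>#M. shape_prob t) * coeff (size M)"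
proof -
  have "P.prob (E \<inter> node_event shape_event M) = P.prob (node_event shape_event M)"
  proof (rule P.finite_measure_eq_AE)
    show "AE \<omega> in P. \<omega> \<in> E \<inter> node_event shape_event M \<longleftrightarrow> \<omega> \<in> node_event shape_event M"
      using E_hereditary
    proof eventually_elim
      case (elim \<omega>)
      have "\<omega> \<in> E" if "\<omega> \<in> node_event shape_event M"
      proof (cases "E = space P")
        case True
        then show ?thesis using node_event_space[OF that] by (rule ssubst)
      next
        case False
        then have "alive \<omega> \<noteq> {}" using M that by (auto simp: node_event_def)
        then show ?thesis using elim by (auto simp: alive_def)
      qed
      then show ?case by auto
    qed
  qed (auto intro!: sets_node_event)
  also have "\<dots> = real (card (arrangements {..<size M} M)) * (\<Prod>t\<in>#M. shape_prob t) * coeff (size M)"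
    unfolding shape_prob_def by (rule prob_node_event) (auto dest: shape_event_disjoint)
  finally show ?thesis .
qed

lemma card_arrangements_single: "card (arrangements {..<size {#t#}} {#t#}) = 1"
proof -
  have "arrangements {..<size {#t#}} {#t#} = {..<1} \<rightarrow>\<^sub>E {t}"
    by (auto simp: arrangements_def lessThan_Suc PiE_def)
  then show ?thesis by (simp add: card_PiE)
qed

lemma card_arrangements_empty: "card (arrangements {..<size {#}} {#}) = 1"
  by (simp add: arrangements_def)

text \<open>The events with and without a merge are disjoint, as they prescribe different numbers of
  surviving children. The merged part has \<open>coeff 1\<close> times the unknown as its
  probability, and the equation is solved for the unknown.\<close>

lemma shape_prob_Node:
  assumes b: b and M: "size M \<noteq> 1" "M \<noteq> {#}"
  shows "(1 - coeff 1) * shape_prob (Node M) =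
    real (card (arrangements {..<size M} M)) * (\<Prod>t\<in>#M. shape_prob t) * coeff (size M)"
proof -
  have disj: "node_event shape_event M \<inter> node_event shape_event {#Node M#} = {}"
  proof (rule ccontr)
    assume "\<not> ?thesis"
    then obtain \<omega> ts ts' where "image_mset ts (mset_set (alive \<omega>)) = M"
      "image_mset ts' (mset_set (alive \<omega>)) = {#Node M#}" by (auto simp: node_event_def)
    then have "size M = card (alive \<omega>)" "card (alive \<omega>) = 1"
      by (metis size_image_mset size_mset_set, metis size_image_mset size_mset_set size_single)
    then show False using M by simp
  qed
  have "E \<inter> shape_event (Node M) = (E \<inter> node_event shape_event M) \<union> (E \<inter> node_event shape_event {#Node M#})"
    using b M unfolding shape_event_Node by auto
  then have "shape_prob (Node M) = P.prob (E \<inter> node_event shape_event M) + P.prob (E \<inter> node_event shape_event {#Node M#})"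
    unfolding shape_prob_def using disj
    by (simp, intro P.finite_measure_Union) (auto intro!: sets_node_event)
  also have "P.prob (E \<inter> node_event shape_event {#Node M#}) = shape_prob (Node M) * coeff 1"
    using prob_E_node_event[of "{#Node M#}"] card_arrangements_single[of "Node M"] by simp
  finally have "shape_prob (Node M) - shape_prob (Node M) * coeff 1 = P.prob (E \<inter> node_event shape_event M)" by linarith
  then show ?thesis
    unfolding prob_E_node_event[OF disjI1[OF M(2)]] left_diff_distrib mult.commute[of "coeff 1"] mult_1 .
qed

text \<open>How the reductions act inside the stem is unknown, so surviving without a surviving
  child is reached through its complement in E: by heredity this is almost surely the event that
  some child survives, of probability \<open>1 - coeff 0\<close>.\<close>

lemma shape_prob_leaf:
  assumes b: b
  shows "(1 - coeff 1) * shape_prob (Node {#}) = P.prob E - 1 + coeff 0"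
proof -
  have e: "node_event shape_event {#} = {\<omega> \<in> space P. alive \<omega> = {}}"
    by (auto simp: node_event_def mset_set_empty_iff)
  have s0: "node_event shape_event {#} \<in> sets P" by (rule sets_node_event) simp
  have disj: "node_event shape_event {#} \<inter> node_event shape_event {#Node {#}#} = {}"
    by (auto simp: node_event_def)
  have "E \<inter> shape_event (Node {#}) = (E \<inter> node_event shape_event {#}) \<union> (E \<inter> node_event shape_event {#Node {#}#})"
    using b unfolding shape_event_Node by auto
  then have "shape_prob (Node {#}) = P.prob (E \<inter> node_event shape_event {#}) + P.prob (E \<inter> node_event shape_event {#Node {#}#})"
    unfolding shape_prob_def using disj
    by (simp, intro P.finite_measure_Union) (auto intro!: sets_node_event)
  also have "P.prob (E \<inter> node_event shape_event {#Node {#}#}) = shape_prob (Node {#}) * coeff 1"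
    using prob_E_node_event[of "{#Node {#}#}"] card_arrangements_single[of "Node {#}"] by simp
  also have "P.prob (E \<inter> node_event shape_event {#}) = P.prob E - P.prob (E - node_event shape_event {#})"
    using P.finite_measure_Diff'[of E "node_event shape_event {#}"] s0 by simp
  also have "P.prob (E - node_event shape_event {#}) = P.prob (space P - node_event shape_event {#})"
  proof (rule P.finite_measure_eq_AE)
    show "AE \<omega> in P. \<omega> \<in> E - node_event shape_event {#} \<longleftrightarrow> \<omega> \<in> space P - node_event shape_event {#}"
      using E_hereditary AE_space
    proof eventually_elim
      case (elim \<omega>)
      then show ?case unfolding e by (auto simp: alive_def)
    qed
  qed (use s0 in auto)
  also have "\<dots> = 1 - P.prob (node_event shape_event {#})" using s0 by (rule P.prob_compl)
  also have "P.prob (node_event shape_event {#}) = coeff 0"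
    using prob_node_event[of "{#}" shape_event, unfolded card_arrangements_empty] by simp
  finally have "shape_prob (Node {#}) = P.prob E - (1 - coeff 0) + shape_prob (Node {#}) * coeff 1" .
  then show ?thesis unfolding left_diff_distrib mult.commute[of "coeff 1"] by linarith
qed

lemma shape_prob_Node_unmerged:
  assumes "\<not> b" "E = space P"
  shows "shape_prob (Node M) = real (card (arrangements {..<size M} M)) * (\<Prod>t\<in>#M. shape_prob t) * pmf q (size M)"
proof -
  have p: "P.prob E = 1" using assms P.prob_space by simp
  \<comment> \<open>As everything survives, the power is \<open>0 ^ (k - size M)\<close>: it removes
    the larger k, the binomial coefficient removes the smaller ones.\<close>
  have "(\<lambda>k. pmf q k * real (k choose size M) * (1 - P.prob E) ^ (k - size M)) sums
      (pmf q (size M) * real (size M choose size M) * (1 - P.prob E) ^ (size M - size M))"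
    by (rule sums_single[THEN sums_cong[THEN iffD1, rotated]]) (auto simp: p)
  then have "coeff (size M) = pmf q (size M)" unfolding coeff_def using sums_unique by fastforce
  then show ?thesis
    using prob_E_node_event[of M] assms unfolding shape_prob_def shape_event_Node[of M] by simp
qed

end

section \<open>Galton-Watson measures and extinction\<close>

lemma genealogy_finite_family: "genealogy N u t \<Longrightarrow> finite (family (\<lambda>w. N (u @ w)))"
proof (induction rule: genealogy.induct)
  case (1 u ts)
  have "family (\<lambda>w. N (u @ w)) \<subseteq> insert [] (\<Union>i<N u. (#) i ` family (\<lambda>w. N ((u @ [i]) @ w)))"
  proof
    fix v assume v: "v \<in> family (\<lambda>w. N (u @ w))"
    show "v \<in> insert [] (\<Union>i<N u. (#) i ` family (\<lambda>w. N ((u @ [i]) @ w)))"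
    proof (cases v)
      case (Cons i w)
      then show ?thesis using v by (simp add: family_Cons image_iff)
    qed simp
  qed
  moreover have "finite (insert [] (\<Union>i<N u. (#) i ` family (\<lambda>w. N ((u @ [i]) @ w))))"
    using 1(2) by simp
  ultimately show ?case by (rule finite_subset)
qed

lemma finite_family_iff_genealogy: "finite (family N) \<longleftrightarrow> (\<exists>t. genealogy N [] t)"
  using genealogy_finite_family[of N "[]"] pruned_shape_exists[of id N False UNIV]
    genealogy_iff_pruned_shape[of id N] by auto

lemma finite_family_children:
  "finite (family N) \<longleftrightarrow> (\<forall>i<N []. finite (family (\<lambda>w. N (i # w))))"
proof
  assume "finite (family N)"
  then show "\<forall>i<N []. finite (family (\<lambda>w. N (i # w)))"
    using family_sub_finite[of N "[_]"] by (auto simp: family_Cons family.intros(1))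
next
  assume *: "\<forall>i<N []. finite (family (\<lambda>w. N (i # w)))"
  have "family N \<subseteq> insert [] (\<Union>i<N []. (#) i ` family (\<lambda>w. N (i # w)))"
  proof
    fix v assume v: "v \<in> family N"
    show "v \<in> insert [] (\<Union>i<N []. (#) i ` family (\<lambda>w. N (i # w)))"
    proof (cases v)
      case (Cons i w)
      then show ?thesis using v by (simp add: family_Cons image_iff)
    qed simp
  qed
  moreover have "finite (insert [] (\<Union>i<N []. (#) i ` family (\<lambda>w. N (i # w))))" using * by simp
  ultimately show "finite (family N)" by (rule finite_subset)
qed

lemma offspring_space_pmf: "offspring_space (measure_pmf r) id r"
  by unfold_locales (auto simp: measure_pmf_single Collect_conv_if)

lemma pruned_offspring_pmf: "pruned_offspring (measure_pmf r) id r UNIV"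
proof -
  interpret offspring_space "measure_pmf r" id r by (rule offspring_space_pmf)
  have "space P = UNIV" by (simp add: space_P)
  then show ?thesis by unfold_locales (metis sets.top, simp)
qed

definition GW_prob :: "nat pmf \<Rightarrow> ctree \<Rightarrow> real" where
  "GW_prob r t = measure (GW r) {Node {#t#}}"

text \<open>Finiteness is the countable union, over all trees t, of the measurable events that the
  genealogy is t.\<close>

lemma sets_finite_family_pmf: "{N. finite (family N)} \<in> sets (\<Pi>\<^sub>M u\<in>UNIV. measure_pmf r)"
proof -
  interpret pruned_offspring "measure_pmf r" id r False UNIV by (rule pruned_offspring_pmf)
  have sp: "space P = UNIV" by (simp add: space_P)
  have "{N. finite (family N)} = (\<Union>t. shape_event t)"
    by (auto simp: shape_event_def sp finite_family_iff_genealogy genealogy_iff_pruned_shape[of id, simplified])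
  moreover have "(\<Union>t\<in>UNIV. shape_event t) \<in> sets P"
    by (rule sets.countable_UN'[OF countable_ctree]) auto
  ultimately show ?thesis by (simp add: P_def)
qed

lemma planted_tree_eq_iff: "planted_tree N = Node {#t#} \<longleftrightarrow> genealogy N [] t"
proof
  assume *: "planted_tree N = Node {#t#}"
  then have fin: "finite (family N)" by (auto simp: planted_tree_def split: if_splits)
  then obtain t' where "genealogy N [] t'" using finite_family_iff_genealogy by blast
  then show "genealogy N [] t" using planted_tree_eq[OF fin] * by simp
next
  assume "genealogy N [] t"
  then show "planted_tree N = Node {#t#}" using planted_tree_eq finite_family_iff_genealogy by blast
qed

lemma planted_tree_empty_iff: "planted_tree N = Node {#} \<longleftrightarrow> infinite (family N)"
  by (simp add: planted_tree_def)

lemma measurable_planted_tree [measurable]: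
  "planted_tree \<in> measurable (\<Pi>\<^sub>M u\<in>UNIV. measure_pmf r) (count_space UNIV)"
proof -
  interpret pruned_offspring "measure_pmf r" id r False UNIV by (rule pruned_offspring_pmf)
  have sp: "space P = UNIV" by (simp add: space_P)
  have 1: "planted_tree -` {Node {#t#}} = shape_event t" for t
    by (auto simp: shape_event_def sp planted_tree_eq_iff genealogy_iff_pruned_shape[of id, simplified])
  have 2: "planted_tree -` {Node {#}} = UNIV - {N. finite (family N)}"
    by (auto simp: planted_tree_empty_iff)
  have s: "planted_tree -` {\<tau>} \<in> sets P" for \<tau>
  proof -
    consider t where "\<tau> = Node {#t#}" | "\<tau> = Node {#}" | "planted_tree -` {\<tau>} = {}"
      by (fastforce simp: planted_tree_def split: if_splits)
    then show ?thesis
    proof cases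
      case 2
      then show ?thesis using \<open>planted_tree -` {Node {#}} = _\<close> sets_finite_family_pmf[of r] sp
        by (metis P_def sets.compl_sets)
    qed (use 1 in auto)
  qed
  have "planted_tree \<in> measurable P (count_space UNIV)"
    unfolding measurable_count_space_eq_countable[OF countable_ctree] using s sp by simp
  then show ?thesis by (simp add: P_def)
qed

lemma GW_prob_Node:
  "GW_prob r (Node M) = real (card (arrangements {..<size M} M)) * (\<Prod>t\<in>#M. GW_prob r t) * pmf r (size M)"
proof -
  interpret pruned_offspring "measure_pmf r" id r False UNIV by (rule pruned_offspring_pmf)
  have sp: "space P = UNIV" by (simp add: space_P)
  have "GW_prob r t = shape_prob t" for t
  proof -
    have "GW_prob r t = P.prob (planted_tree -` {Node {#t#}} \<inter> space P)"
      unfolding GW_prob_def GW_def P_def by (rule measure_distr) auto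
    also have "planted_tree -` {Node {#t#}} \<inter> space P = shape_event t"
      by (auto simp: shape_event_def sp planted_tree_eq_iff genealogy_iff_pruned_shape[of id, simplified])
    finally show ?thesis by (simp add: shape_prob_def)
  qed
  then show ?thesis using shape_prob_Node_unmerged[of M] sp by simp
qed

context offspring_space begin

lemma sets_finite_family: "{\<omega> \<in> space P. finite (family (\<nu> \<circ> \<omega>))} \<in> sets P"
proof -
  have "(\<lambda>\<omega> u. \<nu> (\<omega> u)) \<in> measurable P (\<Pi>\<^sub>M u\<in>UNIV. measure_pmf q)"
  proof (rule measurable_PiM_single')
    show "(\<lambda>\<omega>. \<nu> (\<omega> u)) \<in> measurable P (measure_pmf q)" for u
    proof -
      have "(\<lambda>\<omega>. \<nu> (\<omega> u)) \<in> measurable P (count_space UNIV)" by measurable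
      then show ?thesis by simp
    qed
  qed auto
  from measurable_sets[OF this sets_finite_family_pmf]
  show ?thesis by (simp add: vimage_def Int_def conj_commute comp_def)
qed

definition extinction_prob :: real where
  "extinction_prob = P.prob {\<omega> \<in> space P. finite (family (\<nu> \<circ> \<omega>))}"

lemma pgf_extinction_prob: "pgf q extinction_prob = extinction_prob"
proof -
  define F where "F = {\<omega> \<in> space P. finite (family (\<nu> \<circ> \<omega>))}"
  define S where "S k = {\<omega> \<in> space P. \<nu> (\<omega> []) = k \<and> (\<forall>i<k. child i \<omega> \<in> F)}" for k
  have sets_F: "F \<in> sets P" unfolding F_def by (rule sets_finite_family)
  have sets_S: "S k \<in> sets P" for k unfolding S_def by (rule sets_root_children[of k "\<lambda>_. F", OF sets_F])
  have FS: "F = (\<Union>k. S k)"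
  proof -
    have "\<omega> \<in> F \<longleftrightarrow> \<omega> \<in> S (\<nu> (\<omega> []))" if "\<omega> \<in> space P" for \<omega>
      using finite_family_children[of "\<nu> \<circ> \<omega>"] child_space[OF that] that by (simp add: comp_def F_def S_def)
    moreover have "F \<subseteq> space P" "S k \<subseteq> space P" for k by (auto simp: F_def S_def)
    moreover have "k = \<nu> (\<omega> [])" if "\<omega> \<in> S k" for \<omega> k using that by (simp add: S_def)
    ultimately show ?thesis by blast
  qed
  have "disjoint_family S" by (auto simp: disjoint_family_on_def S_def)
  then have "(\<lambda>k. P.prob (S k)) sums P.prob (\<Union>k. S k)"
    using sets_S by (intro P.finite_measure_UNION) auto
  moreover have "P.prob (S k) = pmf q k * extinction_prob ^ k" for k
  proof -
    have "P.prob (S k) = pmf q k * (\<Prod>i<k. P.prob F)"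
      using prob_root_children[of k "\<lambda>_. F", OF sets_F] unfolding S_def .
    then show ?thesis by (simp add: extinction_prob_def F_def)
  qed
  ultimately have "(\<lambda>k. pmf q k * extinction_prob ^ k) sums P.prob F"
    unfolding FS by simp
  then have "(\<lambda>k. pmf q k * extinction_prob ^ k) sums extinction_prob"
    by (simp add: extinction_prob_def F_def)
  then show ?thesis unfolding pgf_def by (rule sums_unique[symmetric])
qed

lemma AE_finite_family:
  assumes "\<And>z. 0 \<le> z \<Longrightarrow> z < 1 \<Longrightarrow> pgf q z \<noteq> z"
  shows "AE \<omega> in P. finite (family (\<nu> \<circ> \<omega>))"
proof -
  have "0 \<le> extinction_prob" "extinction_prob \<le> 1" by (auto simp: extinction_prob_def)
  then have "extinction_prob = 1" using assms pgf_extinction_prob by force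
  then show ?thesis
    using P.prob_Collect_eq_1[OF sets_finite_family] by (simp add: extinction_prob_def)
qed

end

text \<open>\<open>planted_tree\<close> sends exactly the infinite families to the empty tree, so
  this is the probability that the family never dies out.\<close>

lemma GW_empty:
  assumes "\<And>z. 0 \<le> z \<Longrightarrow> z < 1 \<Longrightarrow> pgf r z \<noteq> z"
  shows "measure (GW r) {Node {#}} = 0"
proof -
  interpret offspring_space "measure_pmf r" id r by (rule offspring_space_pmf)
  have "measure (GW r) {Node {#}} = P.prob (planted_tree -` {Node {#}} \<inter> space P)"
    unfolding GW_def P_def by (rule measure_distr) auto
  also have "\<dots> = 0"
    using AE_finite_family[OF assms]
    by (subst P.prob_eq_0) (auto simp: planted_tree_empty_iff P_def elim: eventually_mono intro: measurable_sets[OF measurable_planted_tree, of "{Node {#}}", simplified])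
  finally show ?thesis .
qed

section \<open>The sample space with edge lengths\<close>

lemma prob_space_exponential_law:
  assumes "0 < lam"
  shows "prob_space (exponential_law lam)"
  unfolding exponential_law_def
proof (rule prob_space_restrict_space)
  let ?D = "density lborel (\<lambda>x. ennreal (exponential_density lam x))"
  interpret D: prob_space ?D using prob_space_exponential_density[OF assms] by simp
  show "{0<..} \<in> sets ?D" by simp
  have "AE x in ?D. x \<in> {0<..}"
  proof (subst AE_density)
    show "(\<lambda>x. ennreal (exponential_density lam x)) \<in> borel_measurable lborel" by measurable
    show "AE x in lborel. 0 < ennreal (exponential_density lam x) \<longrightarrow> x \<in> {0<..}"
      using AE_lborel_singleton[of 0] by eventually_elim (auto simp: exponential_density_def split: if_splits)
  qed
  then show "emeasure ?D {0<..} = 1" by (intro D.emeasure_eq_1_AE) auto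
qed

lemma offspring_space_gw:
  assumes "0 < lam"
  shows "offspring_space (measure_pmf q \<Otimes>\<^sub>M exponential_law lam) fst q"
proof -
  interpret L: prob_space "exponential_law lam" by (rule prob_space_exponential_law[OF assms])
  interpret prob_space "measure_pmf q \<Otimes>\<^sub>M exponential_law lam"
    by (rule prob_space_pair) (auto intro: measure_pmf.prob_space_axioms L.prob_space_axioms)
  have m: "fst \<in> measurable (measure_pmf q \<Otimes>\<^sub>M exponential_law lam) (measure_pmf q)" by (rule measurable_fst)
  show ?thesis
  proof unfold_locales
    show "fst \<in> measurable (measure_pmf q \<Otimes>\<^sub>M exponential_law lam) (count_space UNIV)" using m by simp
    show "prob {x \<in> space (measure_pmf q \<Otimes>\<^sub>M exponential_law lam). fst x = k} = pmf q k" for k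
    proof -
      have "prob (fst -` {k} \<inter> space (measure_pmf q \<Otimes>\<^sub>M exponential_law lam)) =
          measure (distr (measure_pmf q \<Otimes>\<^sub>M exponential_law lam) (measure_pmf q) fst) {k}"
        by (rule measure_distr[symmetric, OF m]) simp
      also have "\<dots> = pmf q k" unfolding L.distr_pair_fst by (rule measure_pmf_single)
      finally show ?thesis by (simp add: vimage_def Int_def conj_commute)
    qed
  qed
qed

lemma space_exponential_law: "space (exponential_law lam) = {0<..}"
  by (simp add: exponential_law_def space_restrict_space)

section \<open>Probability generating functions\<close>

text \<open>Tonelli for double series, through sums in \<open>ennreal\<close>; the column sums are
  finite because their total is S.\<close>

lemma sums_swap_nonneg:
  fixes f :: "nat \<Rightarrow> nat \<Rightarrow> real"
  assumes nn: "\<And>k m. 0 \<le> f k m" and row: "\<And>k. f k sums g k" and total: "g sums S"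
  shows "summable (\<lambda>k. f k m)" and "(\<lambda>m. \<Sum>k. f k m) sums S"
proof -
  have g: "0 \<le> g k" for k using sums_le[OF _ sums_zero row] nn by simp
  have S: "0 \<le> S" using sums_le[OF _ sums_zero total] g by simp
  have "(\<Sum>m. \<Sum>k. ennreal (f k m)) = (\<integral>\<^sup>+m. (\<Sum>k. ennreal (f k m)) \<partial>count_space UNIV)"
    by (simp add: nn_integral_count_space_nat)
  also have "\<dots> = (\<Sum>k. \<integral>\<^sup>+m. ennreal (f k m) \<partial>count_space UNIV)"
    by (rule nn_integral_suminf) simp
  also have "\<dots> = (\<Sum>k. ennreal (g k))"
    using row nn by (simp add: nn_integral_count_space_nat suminf_ennreal2 sums_iff)
  also have "\<dots> = ennreal S" using total g by (simp add: suminf_ennreal2 sums_iff)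
  finally have eq: "(\<Sum>m. \<Sum>k. ennreal (f k m)) = ennreal S" .
  have fin: "(\<Sum>k. ennreal (f k m)) \<noteq> top" for m
  proof
    assume "(\<Sum>k. ennreal (f k m)) = top"
    moreover have "(\<Sum>k. ennreal (f k m)) \<le> (\<Sum>m. \<Sum>k. ennreal (f k m))"
      using sum_le_suminf[of "\<lambda>m. \<Sum>k. ennreal (f k m)" "{m}"] by simp
    ultimately show False using eq by (simp add: top_unique)
  qed
  show sm: "summable (\<lambda>k. f k m)" for m 
    by (rule summable_suminf_not_top[OF _ fin]) (rule nn)
  have nn': "0 \<le> (\<Sum>k. f k m)" for m by (rule suminf_nonneg[OF sm nn])
  have e: "(\<Sum>k. ennreal (f k m)) = ennreal (\<Sum>k. f k m)" for m by (rule suminf_ennreal2[OF nn sm])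
  have eq': "(\<Sum>m. ennreal (\<Sum>k. f k m)) = ennreal S" using eq unfolding e .
  then have "(\<Sum>m. ennreal (\<Sum>k. f k m)) \<noteq> top" by (simp only: ennreal_neq_top not_False_eq_True)
  with nn' have s: "summable (\<lambda>m. \<Sum>k. f k m)" by (rule summable_suminf_not_top)
  have "ennreal (\<Sum>m. \<Sum>k. f k m) = ennreal S"
    using suminf_ennreal2[OF nn' s] eq' by simp
  then have "(\<Sum>m. \<Sum>k. f k m) = S" using S suminf_nonneg[OF s nn'] by simp
  then show "(\<lambda>m. \<Sum>k. f k m) sums S" using s by (simp add: sums_iff)
qed

lemma pmf_nat_sums: "(\<lambda>k. pmf r (k :: nat)) sums 1"
proof -
  have "(\<lambda>k. measure_pmf.prob r {k}) sums measure_pmf.prob r (\<Union>k. {k})"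
    by (rule measure_pmf.finite_measure_UNION) (auto simp: disjoint_family_on_def)
  then show ?thesis by (simp add: measure_pmf_single)
qed

lemma summable_pgf:
  assumes "0 \<le> z" "z \<le> 1"
  shows "summable (\<lambda>k. pmf r k * z ^ k)"
proof (rule summable_comparison_test'[OF sums_summable[OF pmf_nat_sums], of 0])
  fix k
  have "pmf r k * z ^ k \<le> pmf r k * 1" using assms by (intro mult_left_mono power_le_one) auto
  then show "norm (pmf r k * z ^ k) \<le> pmf r k" using assms by simp
qed

lemma pgf_1: "pgf r 1 = 1"
  using sums_unique[OF pmf_nat_sums[of r]] by (simp add: pgf_def)

text \<open>The same series as \<open>coeff\<close>, with x in place of the probability
  \<open>1 - P.prob E\<close> of not surviving.\<close>

definition pgf_coeff :: "nat pmf \<Rightarrow> real \<Rightarrow> nat \<Rightarrow> real" where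
  "pgf_coeff r x m = (\<Sum>k. pmf r k * real (k choose m) * x ^ (k - m))"

lemma pgf_has_derivative:
  assumes "\<bar>x\<bar> < 1"
  shows "(pgf r has_real_derivative pgf_coeff r x 1) (at x)"
proof -
  have s: "summable (\<lambda>n. pmf r n * 1 ^ n)" using sums_summable[OF pmf_nat_sums[of r]] by simp
  have 1: "(pgf r has_real_derivative (\<Sum>n. diffs (pmf r) n * x ^ n)) (at x)"
    unfolding pgf_def by (rule termdiffs_strong[OF s]) (use assms in simp)
  have "summable (\<lambda>n. diffs (pmf r) n * x ^ n)"
  proof (rule termdiff_converges[of x 1])
    show "summable (\<lambda>n. pmf r n * y ^ n)" if "norm y < 1" for y :: real
      using powser_inside[OF s] that by simp
  qed (use assms in simp)
  from diffs_equiv[OF this] have "pgf_coeff r x 1 = (\<Sum>n. diffs (pmf r) n * x ^ n)"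
    unfolding pgf_coeff_def by (simp add: sums_iff mult.commute)
  then show ?thesis using 1 by simp
qed

lemma deriv_pgf: "\<bar>x\<bar> < 1 \<Longrightarrow> deriv (pgf r) x = pgf_coeff r x 1"
  by (rule DERIV_imp_deriv) (rule pgf_has_derivative)

text \<open>Each product \<open>(k choose m) * x ^ (k - m) * (1 - x) ^ m\<close> is one term of the
  binomial expansion of \<open>((1 - x) + x) ^ k = 1\<close>, which gives a bound uniform in
  k.\<close>

lemma summable_pgf_coeff:
  assumes "0 \<le> x" "x < 1"
  shows "summable (\<lambda>k. pmf r k * real (k choose m) * x ^ (k - m))"
proof (rule summable_comparison_test')
  show "summable (\<lambda>k. pmf r k * (1 / (1 - x) ^ m))"
    by (intro summable_mult2 sums_summable[OF pmf_nat_sums])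
  fix k
  have "real (k choose m) * x ^ (k - m) * (1 - x) ^ m \<le> 1"
  proof (cases "m \<le> k")
    case True
    have "real (k choose m) * (1 - x) ^ m * x ^ (k - m) \<le> (\<Sum>i\<le>k. real (k choose i) * (1 - x) ^ i * x ^ (k - i))"
      by (rule member_le_sum) (use True assms in auto)
    also have "\<dots> = ((1 - x) + x) ^ k" by (rule binomial_ring[symmetric])
    finally show ?thesis by (simp add: mult_ac)
  qed (simp add: binomial_eq_0)
  then have "real (k choose m) * x ^ (k - m) \<le> 1 / (1 - x) ^ m"
    using assms by (simp add: pos_le_divide_eq)
  then have "pmf r k * (real (k choose m) * x ^ (k - m)) \<le> pmf r k * (1 / (1 - x) ^ m)"
    by (rule mult_left_mono) simp
  then show "norm (pmf r k * real (k choose m) * x ^ (k - m)) \<le> pmf r k * (1 / (1 - x) ^ m)"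
    using assms by (simp add: mult.assoc)
qed

lemma pgf_binomial_sums:
  assumes "0 \<le> x" "0 \<le> y" "x + y \<le> 1"
  shows "(\<lambda>m. pgf_coeff r x m * y ^ m) sums pgf r (x + y)"
proof (cases "y = 0")
  \<comment> \<open>Here x may be 1, where the coefficients of positive index need not
    converge.\<close>
  case True
  have "(\<lambda>m. pgf_coeff r x m * y ^ m) sums (pgf_coeff r x 0 * y ^ 0)"
    by (rule sums_single[THEN sums_cong[THEN iffD1, rotated]]) (simp add: True)
  then show ?thesis using True by (simp add: pgf_coeff_def pgf_def)
next
  case False
  define f where "f k m = pmf r k * (real (k choose m) * x ^ (k - m) * y ^ m)" for k m
  have row: "f k sums (pmf r k * (x + y) ^ k)" for k
  proof -
    have "f k sums (\<Sum>m\<le>k. f k m)" by (rule sums_finite) (auto simp: f_def)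
    also have "(\<Sum>m\<le>k. f k m) = pmf r k * (x + y) ^ k"
      unfolding f_def add.commute[of x y] binomial_ring by (simp add: sum_distrib_left mult_ac)
    finally show ?thesis .
  qed
  have total: "(\<lambda>k. pmf r k * (x + y) ^ k) sums pgf r (x + y)"
    using summable_pgf[of "x + y" r] assms by (simp add: pgf_def summable_sums)
  have nn: "0 \<le> f k m" for k m using assms by (simp add: f_def)
  have "(\<Sum>k. f k m) = pgf_coeff r x m * y ^ m" for m
  proof -
    have e: "f k m = (pmf r k * real (k choose m) * x ^ (k - m)) * y ^ m" for k by (simp add: f_def)
    show ?thesis
      unfolding pgf_coeff_def e by (rule suminf_mult2[symmetric], rule summable_pgf_coeff) (use assms False in auto)
  qed
  then show ?thesis using sums_swap_nonneg(2)[OF nn row total] by simp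
qed

lemma pgf_coeff_nonneg: "0 \<le> x \<Longrightarrow> x < 1 \<Longrightarrow> 0 \<le> pgf_coeff r x m"
  unfolding pgf_coeff_def by (rule suminf_nonneg[OF summable_pgf_coeff]) auto

text \<open>
  By induction on \<open>m\<close>: after subtracting the terms below \<open>m\<close> and dividing by \<open>z ^ m\<close>, the generating
  functions agree with the \<open>m\<close>-th coefficient up to \<open>z / (1 - z)\<close>.
\<close>

lemma coefficients_convergent:
  fixes a :: "nat \<Rightarrow> nat \<Rightarrow> real"
  assumes a: "\<And>n m. 0 \<le> a n m" "\<And>n m. a n m \<le> 1"
    and F: "\<And>z. 0 < z \<Longrightarrow> z < 1 \<Longrightarrow> convergent (\<lambda>n. \<Sum>m. a n m * z ^ m)"
  shows "convergent (\<lambda>n. a n m)"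
proof (induction m rule: less_induct)
  case (less m)
  have summ: "summable (\<lambda>m. a n m * z ^ m)" if "0 < z" "z < 1" for n and z :: real
  proof (rule summable_comparison_test'[of "\<lambda>m. z ^ m" 0])
    show "summable (\<lambda>m. z ^ m)" using that by (intro summable_geometric) simp
    fix m
    have "a n m * z ^ m \<le> 1 * z ^ m" using a that by (intro mult_right_mono) auto
    then show "norm (a n m * z ^ m) \<le> z ^ m" using a that by simp
  qed
  define T where "T z n = ((\<Sum>m. a n m * z ^ m) - (\<Sum>j<m. a n j * z ^ j)) / z ^ m" for z n
  have bound: "0 \<le> T z n - a n m \<and> T z n - a n m \<le> z / (1 - z)" if z: "0 < z" "z < 1" for z n
  proof -
    have s': "summable (\<lambda>i. a n (i + Suc m) * z ^ i)"
    proof (rule summable_comparison_test'[of "\<lambda>m. z ^ m" 0])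
      show "summable (\<lambda>m. z ^ m)" using z by (intro summable_geometric) simp
      fix i
      have "a n (i + Suc m) * z ^ i \<le> 1 * z ^ i" using a z by (intro mult_right_mono) auto
      then show "norm (a n (i + Suc m) * z ^ i) \<le> z ^ i" using a z by simp
    qed
    have "(\<Sum>k. a n k * z ^ k) = (\<Sum>i. a n (i + Suc m) * z ^ (i + Suc m)) + (\<Sum>j<Suc m. a n j * z ^ j)"
      by (rule suminf_split_initial_segment[OF summ[OF z]])
    also have "(\<Sum>i. a n (i + Suc m) * z ^ (i + Suc m)) = (\<Sum>i. a n (i + Suc m) * z ^ i) * z ^ Suc m"
      unfolding suminf_mult2[OF s'] by (simp only: power_add mult.assoc)
    finally have "T z n - a n m = (\<Sum>i. a n (i + Suc m) * z ^ i) * z"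
      using z by (simp add: T_def field_simps)
    moreover have "0 \<le> (\<Sum>i. a n (i + Suc m) * z ^ i)"
      using a z by (intro suminf_nonneg[OF s']) simp
    moreover have "(\<Sum>i. a n (i + Suc m) * z ^ i) \<le> (\<Sum>i. z ^ i)"
    proof (rule suminf_le[OF _ s'])
      show "a n (i + Suc m) * z ^ i \<le> z ^ i" for i
        using a z mult_right_mono[of "a n (i + Suc m)" 1 "z ^ i"] by simp
      show "summable (\<lambda>i. z ^ i)" using z by (intro summable_geometric) simp
    qed
    then have "(\<Sum>i. a n (i + Suc m) * z ^ i) \<le> 1 / (1 - z)" using z by (simp add: suminf_geometric)
    ultimately show ?thesis using z mult_right_mono[of "\<Sum>i. a n (i + Suc m) * z ^ i" "1 / (1 - z)" z] by simp
  qed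
  have T: "Cauchy (T z)" if z: "0 < z" "z < 1" for z
  proof -
    have "convergent (\<lambda>n. a n j * z ^ j)" if "j < m" for j
      using less[OF that] by (intro convergent_mult convergent_const)
    then have "convergent (\<lambda>n. \<Sum>j<m. a n j * z ^ j)" by (intro convergent_sum) auto
    then have "convergent (T z)"
      unfolding T_def divide_inverse by (intro convergent_mult convergent_diff convergent_const F z)
    then show ?thesis by (rule convergent_Cauchy)
  qed
  have "Cauchy (\<lambda>n. a n m)"
  proof (rule metric_CauchyI)
    fix e :: real assume e: "0 < e"
    define z where "z = e / (e + 4)"
    have z: "0 < z" "z < 1" using e by (auto simp: z_def field_simps)
    have zlt: "z / (1 - z) < e / 2"
    proof -
      have "1 - z = 4 / (e + 4)" using e by (simp add: z_def field_simps)
      then have "z / (1 - z) = e / 4" using e by (simp add: z_def)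
      then show ?thesis using e by simp
    qed
    obtain K where K: "\<And>i j. i \<ge> K \<Longrightarrow> j \<ge> K \<Longrightarrow> dist (T z i) (T z j) < e / 2"
      using metric_CauchyD[OF T[OF z], of "e / 2"] e by auto
    have "dist (a i m) (a j m) < e" if "i \<ge> K" "j \<ge> K" for i j
      using K[OF that] bound[OF z, of i] bound[OF z, of j] zlt unfolding dist_real_def by arith
    then show "\<exists>K. \<forall>i\<ge>K. \<forall>j\<ge>K. dist (a i m) (a j m) < e" by blast
  qed
  then show ?case by (rule Cauchy_convergent)
qed

text \<open>The two mass functions are interleaved into one sequence. Its generating functions are
  constant in n, so every coefficient converges, which forces the two alternating values to
  agree.\<close>

lemma pgf_determines_pmf:
  assumes "\<And>z. 0 < z \<Longrightarrow> z < 1 \<Longrightarrow> pgf r z = pgf r' z"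
  shows "r = r'"
proof (rule pmf_eqI)
  fix m
  define a where "a n = (if even n then pmf r else pmf r')" for n :: nat
  have "convergent (\<lambda>n. a n m)"
  proof (rule coefficients_convergent)
    show "0 \<le> a n m" "a n m \<le> 1" for n m by (auto simp: a_def pmf_le_1)
    show "convergent (\<lambda>n. \<Sum>m. a n m * z ^ m)" if "0 < z" "z < 1" for z
    proof -
      have "(\<lambda>n. \<Sum>m. a n m * z ^ m) = (\<lambda>n. pgf r z)"
        using assms[OF that] by (auto simp: a_def pgf_def fun_eq_iff)
      then show ?thesis by (simp add: convergent_const)
    qed
  qed
  then obtain L where L: "(\<lambda>n. a n m) \<longlonglongrightarrow> L" by (auto simp: convergent_def)
  have "(\<lambda>n. a (2 * n) m) \<longlonglongrightarrow> L" "(\<lambda>n. a (2 * n + 1) m) \<longlonglongrightarrow> L"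
    using LIMSEQ_subseq_LIMSEQ[OF L, of "\<lambda>n. 2 * n"] LIMSEQ_subseq_LIMSEQ[OF L, of "\<lambda>n. 2 * n + 1"]
    by (auto simp: strict_mono_def comp_def)
  then show "pmf r m = pmf r' m"
    by (simp add: a_def LIMSEQ_const_iff)
qed

text \<open>The coefficients converge to a limit of total mass at most 1. No mass escapes to
  infinity, because G is bounded by the limiting mass and tends to 1 at 1.\<close>

lemma pgf_continuity:
  fixes a :: "nat \<Rightarrow> nat \<Rightarrow> real"
  assumes a: "\<And>n m. 0 \<le> a n m" "\<And>n. a n sums 1"
    and F: "\<And>z. 0 < z \<Longrightarrow> z < 1 \<Longrightarrow> (\<lambda>n. \<Sum>m. a n m * z ^ m) \<longlonglongrightarrow> G z"
    and G: "(G \<longlongrightarrow> 1) (at_left 1)"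
  obtains r where "\<And>z. 0 < z \<Longrightarrow> z < 1 \<Longrightarrow> pgf r z = G z" "\<And>m. (\<lambda>n. a n m) \<longlonglongrightarrow> pmf r m"
proof -
  have part: "(\<Sum>m\<in>A. a n m) \<le> 1" if "finite A" for A n
    using sum_le_suminf[OF sums_summable[OF a(2)] that] a sums_unique[OF a(2)] by simp
  have le1: "a n m \<le> 1" for n m using part[of "{m}" n] by simp
  have "convergent (\<lambda>n. a n m)" for m
    by (rule coefficients_convergent[OF a(1) le1]) (use F in \<open>auto simp: convergent_def\<close>)
  then obtain \<alpha> where \<alpha>: "\<And>m. (\<lambda>n. a n m) \<longlonglongrightarrow> \<alpha> m" unfolding convergent_def by metis
  have \<alpha>0: "0 \<le> \<alpha> m" for m using LIMSEQ_le_const[OF \<alpha>] a by blast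
  have \<alpha>1: "(\<Sum>m\<in>A. \<alpha> m) \<le> 1" if "finite A" for A
    by (rule LIMSEQ_le_const2[OF tendsto_sum[OF \<alpha>]]) (use part[OF that] in blast)
  have sm: "summable \<alpha>" using \<alpha>0 \<alpha>1 by (intro summableI_nonneg_bounded[of _ 1]) auto
  have G_eq: "(\<Sum>m. \<alpha> m * z ^ m) = G z" if z: "0 < z" "z < 1" for z
  proof -
    have "(\<lambda>n. \<Sum>m. a n m * z ^ m) \<longlonglongrightarrow> (\<Sum>m. \<alpha> m * z ^ m)"
    proof (rule tannerys_theorem[THEN conjunct2, THEN conjunct2])
      show "(\<lambda>n. a n k * z ^ k) \<longlonglongrightarrow> \<alpha> k * z ^ k" for k by (intro tendsto_intros \<alpha>)
      show "summable (\<lambda>k. z ^ k)" using z by (intro summable_geometric) simp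
      have "norm (a n k * z ^ k) \<le> z ^ k" for n k
        using a le1 z mult_right_mono[of "a n k" 1 "z ^ k"] by simp
      then show "\<forall>\<^sub>F (k, n) in sequentially \<times>\<^sub>F sequentially. norm (a n k * z ^ k) \<le> z ^ k"
        by (intro always_eventually) auto
    qed simp
    then show ?thesis using F[OF z] LIMSEQ_unique by blast
  qed
  have "G z \<le> suminf \<alpha>" if z: "0 < z" "z < 1" for z
  proof -
    have le: "\<alpha> m * z ^ m \<le> \<alpha> m" for m
      using \<alpha>0 z by (intro mult_left_le) (auto intro: power_le_one)
    have "summable (\<lambda>m. \<alpha> m * z ^ m)"
      by (rule summable_comparison_test'[OF sm, of 0]) (use le \<alpha>0 z in simp)
    then show ?thesis unfolding G_eq[OF z, symmetric] using suminf_le[OF le _ sm] by blast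
  qed
  then have "eventually (\<lambda>z. G z \<le> suminf \<alpha>) (at_left 1)"
    using eventually_at_left_real[of 0 "1::real"] by (auto elim: eventually_mono)
  then have "1 \<le> suminf \<alpha>" by (intro tendsto_upperbound[OF G]) auto
  moreover have "suminf \<alpha> \<le> 1" using suminf_le_const[OF sm, of 1] \<alpha>1 by auto
  ultimately have sum1: "suminf \<alpha> = 1" by simp
  define r where "r = embed_pmf \<alpha>"
  have "(\<integral>\<^sup>+m. ennreal (\<alpha> m) \<partial>count_space UNIV) = 1"
    using suminf_ennreal2[OF \<alpha>0 sm] sum1 by (simp add: nn_integral_count_space_nat)
  then have r: "pmf r m = \<alpha> m" for m unfolding r_def using \<alpha>0 by (intro pmf_embed_pmf) auto
  show ?thesis
    by (rule that[of r]) (use G_eq \<alpha> in \<open>auto simp: pgf_def r\<close>)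
qed

section \<open>Asymptotics of the pruned offspring distribution\<close>

locale offspring_law =
  fixes q :: "nat pmf"
  assumes q1: "pmf q 1 = 0" and mean: "mean_offspring q \<le> 1"
begin

definition \<mu> :: real where "\<mu> = (\<Sum>k. real k * pmf q k)"

text \<open>With \<open>y = 1 - x\<close>, \<open>excess\<close> is the function D of the overview
  and \<open>slope\<close> its derivative with respect to y.\<close>

definition excess :: "real \<Rightarrow> real" where "excess x = pgf q x - x"

definition slope :: "real \<Rightarrow> real" where "slope x = 1 - pgf_coeff q x 1"

section \<open>Positivity and comparison of excess and slope\<close>

lemma mean_offspring_ennreal: "mean_offspring q = (\<Sum>k. ennreal (real k * pmf q k))"
  unfolding mean_offspring_def by (simp add: ennreal_mult ennreal_of_nat_eq_real_of_nat)

lemma summable_mean: "summable (\<lambda>k. real k * pmf q k)"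
proof (rule summable_suminf_not_top)
  show "(\<Sum>k. ennreal (real k * pmf q k)) \<noteq> top"
    using mean unfolding mean_offspring_ennreal by (auto simp: top_unique)
qed simp

lemma mean_offspring_eq: "mean_offspring q = ennreal \<mu>"
  unfolding mean_offspring_ennreal \<mu>_def by (rule suminf_ennreal2[OF _ summable_mean]) simp

lemma \<mu>_nonneg: "0 \<le> \<mu>"
  unfolding \<mu>_def by (rule suminf_nonneg[OF summable_mean]) simp

lemma \<mu>_le_1: "\<mu> \<le> 1"
  using mean \<mu>_nonneg by (simp add: mean_offspring_eq)

lemma critical_iff: "critical q \<longleftrightarrow> \<mu> = 1"
  using \<mu>_nonneg by (simp add: critical_def mean_offspring_eq)

lemma subcritical_iff: "subcritical q \<longleftrightarrow> \<mu> < 1"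
  using \<mu>_nonneg by (simp add: subcritical_def mean_offspring_eq ennreal_less_iff)

text \<open>Subtracting the tangent of Q at 1 leaves weighted Bernoulli gaps, which are
  nonnegative.\<close>

lemma excess_sums:
  assumes "0 \<le> x" "x \<le> 1"
  shows "(\<lambda>k. pmf q k * (x ^ k - 1 + real k * (1 - x))) sums (excess x - (1 - \<mu>) * (1 - x))"
proof -
  have "(\<lambda>k. pmf q k * x ^ k - pmf q k + real k * pmf q k * (1 - x)) sums (pgf q x - 1 + \<mu> * (1 - x))"
    unfolding pgf_def \<mu>_def
    by (intro sums_add sums_diff sums_mult2 summable_sums summable_pgf summable_mean pmf_nat_sums assms)
  then show ?thesis by (simp add: excess_def algebra_simps)
qed

lemma slope_sums:
  assumes "0 \<le> x" "x < 1"
  shows "(\<lambda>k. pmf q k * (real k * (1 - x ^ (k - 1)))) sums (slope x - (1 - \<mu>))"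
proof -
  have "(\<lambda>k. real k * pmf q k - pmf q k * real (k choose 1) * x ^ (k - 1)) sums (\<mu> - pgf_coeff q x 1)"
    unfolding \<mu>_def pgf_coeff_def
    by (intro sums_diff summable_sums summable_mean summable_pgf_coeff assms)
  then show ?thesis by (simp add: slope_def algebra_simps)
qed

text \<open>The gap is nondecreasing in k, with value 0 at \<open>k = 0\<close> and
  \<open>(1 - x)\<^sup>2\<close> at \<open>k = 2\<close>.\<close>

lemma bernoulli_gap:
  fixes x :: real
  assumes "0 \<le> x" "x \<le> 1"
  shows "0 \<le> x ^ k - 1 + real k * (1 - x)" and "k \<ge> 2 \<Longrightarrow> (1 - x)\<^sup>2 \<le> x ^ k - 1 + real k * (1 - x)"
proof -
  have step: "x ^ k - 1 + real k * (1 - x) \<le> x ^ Suc k - 1 + real (Suc k) * (1 - x)" for k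
  proof -
    have "0 \<le> (1 - x) * (1 - x ^ k)" using assms by (intro mult_nonneg_nonneg) (auto intro: power_le_one)
    then show ?thesis by (simp add: algebra_simps)
  qed
  show "0 \<le> x ^ k - 1 + real k * (1 - x)"
  proof (induction k)
    case (Suc k)
    then show ?case using step[of k] by linarith
  qed simp
  show "(1 - x)\<^sup>2 \<le> x ^ k - 1 + real k * (1 - x)" if "k \<ge> 2"
    using that
  proof (induction k rule: dec_induct)
    case base
    then show ?case by (simp add: power2_eq_square algebra_simps)
  next
    case (step n)
    then show ?case using \<open>\<And>k. _ \<le> x ^ Suc k - 1 + real (Suc k) * (1 - x)\<close>[of n] by linarith
  qed
qed

text \<open>The difference of the two sides is nondecreasing in k: its increment is
  \<open>(1 - x) * ((1 - x ^ k) - k * x ^ (k - 1) * (1 - x))\<close>, nonnegative by the geometric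
  sum. Equality at \<open>k = 2\<close> shows that the constant 2 is best; it becomes the bound
  \<open>1 / 2 \<le> c\<close>.\<close>

lemma half_gap:
  fixes x :: real
  assumes "0 \<le> x" "x \<le> 1"
  shows "(1 - x) * (real k * (1 - x ^ (k - 1))) \<le> 2 * (x ^ k - 1 + real k * (1 - x))"
proof (induction k)
  case (Suc k)
  have g: "real k * x ^ (k - 1) * (1 - x) \<le> 1 - x ^ k"
  proof (cases k)
    case (Suc j)
    have "(\<Sum>i<Suc j. x ^ j) \<le> (\<Sum>i<Suc j. x ^ i)"
      using assms by (intro sum_mono power_decreasing) auto
    then have "real (Suc j) * x ^ j * (1 - x) \<le> (\<Sum>i<Suc j. x ^ i) * (1 - x)"
      using assms by (intro mult_right_mono) simp_all
    also have "\<dots> = 1 - x ^ Suc j" using one_diff_power_eq[of x "Suc j"] by (simp add: mult.commute)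
    finally show ?thesis using Suc by simp
  qed simp
  have x: "k = 0 \<or> x ^ k = x * x ^ (k - 1)" by (cases k) auto
  have "0 \<le> (1 - x) * ((1 - x ^ k) - real k * x ^ (k - 1) * (1 - x))"
    using g assms by (intro mult_nonneg_nonneg) auto
  also have "\<dots> = (2 * (x ^ Suc k - 1 + real (Suc k) * (1 - x)) - (1 - x) * (real (Suc k) * (1 - x ^ (Suc k - 1))))
      - (2 * (x ^ k - 1 + real k * (1 - x)) - (1 - x) * (real k * (1 - x ^ (k - 1))))"
    using x by (auto simp: algebra_simps)
  finally show ?case using Suc by linarith
qed simp

text \<open>This is where \<open>pmf q 1 = 0\<close> enters: it excludes the degenerate critical law
  with \<open>pmf q 1 = 1\<close>, for which the excess vanishes identically.\<close>

lemma branching_degree: "\<mu> = 1 \<Longrightarrow> \<exists>k\<ge>2. 0 < pmf q k"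
proof (rule ccontr)
  assume \<mu>: "\<mu> = 1" and "\<not> (\<exists>k\<ge>2. 0 < pmf q k)"
  then have *: "pmf q k = 0" if "k \<ge> 2" for k using that pmf_nonneg[of q k] by (metis antisym_conv2)
  have "real k * pmf q k = 0" for k
  proof -
    consider "k = 0" | "k = 1" | "k \<ge> 2" by linarith
    then show ?thesis using q1 * by cases auto
  qed
  then have "\<mu> = 0" unfolding \<mu>_def by (simp only: suminf_zero)
  then show False using \<mu> by simp
qed

text \<open>In the critical case a single offspring number \<open>k \<ge> 2\<close> gives a positive
  term; in the subcritical case the linear part \<open>(1 - \<mu>) * (1 - x)\<close> is positive.
  Almost sure finiteness of the family rests on this.\<close>

lemma excess_pos:
  assumes "0 \<le> x" "x < 1"
  shows "0 < excess x"
proof -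
  note s = excess_sums[of x]
  have nn: "0 \<le> pmf q k * (x ^ k - 1 + real k * (1 - x))" for k
    using bernoulli_gap(1)[of x k] assms by simp
  show ?thesis
  proof (cases "\<mu> = 1")
    case True
    obtain k where k: "k \<ge> 2" "0 < pmf q k" using branching_degree[OF True] by blast
    have "0 < (1 - x)\<^sup>2" using assms by simp
    then have "0 < pmf q k * (x ^ k - 1 + real k * (1 - x))"
      using k bernoulli_gap(2)[of x k] assms by (intro mult_pos_pos) linarith+
    also have "\<dots> \<le> (\<Sum>k. pmf q k * (x ^ k - 1 + real k * (1 - x)))"
      using sum_le_suminf[of "\<lambda>k. pmf q k * (x ^ k - 1 + real k * (1 - x))" "{k}"] nn s assms
      by (simp add: sums_summable)
    also have "\<dots> = excess x" using sums_unique[OF s] assms True by simp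
    finally show ?thesis .
  next
    case False
    have "0 \<le> excess x - (1 - \<mu>) * (1 - x)" using sums_le[OF nn sums_zero s] assms by simp
    moreover have "0 < (1 - \<mu>) * (1 - x)" using False \<mu>_le_1 assms by (intro mult_pos_pos) auto
    ultimately show ?thesis by simp
  qed
qed

lemma slope_pos:
  assumes "0 \<le> x" "x < 1"
  shows "0 < slope x"
proof -
  note s = slope_sums[OF assms]
  have nn: "0 \<le> pmf q k * (real k * (1 - x ^ (k - 1)))" for k
    using assms by (auto intro!: mult_nonneg_nonneg power_le_one)
  show ?thesis
  proof (cases "\<mu> = 1")
    case True
    obtain k where k: "k \<ge> 2" "0 < pmf q k" using branching_degree[OF True] by blast
    have "x ^ (k - 1) < 1" using assms k by (intro power_less_one_iff[THEN iffD2]) auto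
    then have "0 < pmf q k * (real k * (1 - x ^ (k - 1)))"
      using k by (intro mult_pos_pos) auto
    also have "\<dots> \<le> (\<Sum>k. pmf q k * (real k * (1 - x ^ (k - 1))))"
      using sum_le_suminf[of "\<lambda>k. pmf q k * (real k * (1 - x ^ (k - 1)))" "{k}"] nn s
      by (simp add: sums_summable)
    also have "\<dots> = slope x" using sums_unique[OF s] True by simp
    finally show ?thesis .
  next
    case False
    have "0 \<le> slope x - (1 - \<mu>)" using sums_le[OF nn sums_zero s] by simp
    then show ?thesis using False \<mu>_le_1 by simp
  qed
qed

lemma pgf_no_fixed_point: "0 \<le> z \<Longrightarrow> z < 1 \<Longrightarrow> pgf q z \<noteq> z"
  using excess_pos[of z] by (simp add: excess_def)

lemma excess_has_derivative: "\<bar>x\<bar> < 1 \<Longrightarrow> (excess has_real_derivative - slope x) (at x)"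
  unfolding excess_def slope_def by (auto intro!: derivative_eq_intros pgf_has_derivative)

lemma slope_le_excess:
  assumes "\<mu> = 1" "0 \<le> x" "x < 1"
  shows "(1 - x) * slope x \<le> 2 * excess x"
proof -
  have 1: "(\<lambda>k. 2 * (pmf q k * (x ^ k - 1 + real k * (1 - x)))) sums (2 * excess x)"
    using sums_mult[OF excess_sums[of x], of 2] assms by simp
  have 2: "(\<lambda>k. (1 - x) * (pmf q k * (real k * (1 - x ^ (k - 1))))) sums ((1 - x) * slope x)"
    using sums_mult[OF slope_sums[of x], of "1 - x"] assms by simp
  show ?thesis
  proof (rule sums_le[OF _ 2 1])
    fix k
    have "pmf q k * ((1 - x) * (real k * (1 - x ^ (k - 1)))) \<le> pmf q k * (2 * (x ^ k - 1 + real k * (1 - x)))"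
      using half_gap[of x k] assms by (intro mult_left_mono) auto
    then show "(1 - x) * (pmf q k * (real k * (1 - x ^ (k - 1)))) \<le> 2 * (pmf q k * (x ^ k - 1 + real k * (1 - x)))"
      by (simp only: mult.left_commute[of "1 - x"] mult.left_commute[of 2])
  qed
qed

end

context offspring_law begin

text \<open>
  The offspring distribution of the pruned tree when a subtree survives with probability \<open>p\<close>; merging
  the degree-two vertices conditions on an offspring number different from 1.
\<close>

definition pruned_weight :: "real \<Rightarrow> nat \<Rightarrow> real" where
  "pruned_weight p m = (if m = 1 then 0 else
     (pgf_coeff q (1 - p) m * p ^ m + (if m = 0 then p - 1 else 0)) / (p * slope (1 - p)))"

lemma pruned_weight_sums:
  assumes p: "0 < p" "p \<le> 1" and z: "0 \<le> z" "z \<le> 1"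
  shows "(\<lambda>m. pruned_weight p m * z ^ m) sums (z + excess (1 - p * (1 - z)) / (p * slope (1 - p)))"
proof -
  define c where "c = p * slope (1 - p)"
  have c: "0 < c" using slope_pos[of "1 - p"] p by (simp add: c_def)
  \<comment> \<open>Corrections to the Taylor series at \<open>1 - p\<close>: the constant term
    gains \<open>p - 1\<close> and becomes the probability of surviving without a surviving child,
    and the linear term is removed because single children are merged.\<close>
  define u where "u m = (if m = 0 then p - 1 else if m = 1 then - pgf_coeff q (1 - p) 1 * p * z else 0)" for m :: nat
  have "(\<lambda>m. pgf_coeff q (1 - p) m * (p * z) ^ m) sums pgf q (1 - p + p * z)"
    using p z by (intro pgf_binomial_sums) (auto simp: mult_left_le algebra_simps)
  moreover have "u sums (\<Sum>m\<in>{0, 1}. u m)"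
    by (rule sums_finite) (auto simp: u_def)
  ultimately have "(\<lambda>m. (pgf_coeff q (1 - p) m * (p * z) ^ m + u m) / c) sums
      ((pgf q (1 - p + p * z) + (\<Sum>m\<in>{0, 1}. u m)) / c)"
    by (intro sums_divide sums_add)
  moreover have "(pgf_coeff q (1 - p) m * (p * z) ^ m + u m) / c = pruned_weight p m * z ^ m" for m
    by (auto simp: pruned_weight_def u_def c_def power_mult_distrib)
  moreover have "(pgf q (1 - p + p * z) + (\<Sum>m\<in>{0, 1}. u m)) / c = z + excess (1 - p * (1 - z)) / c"
  proof -
    have e: "1 - p * (1 - z) = 1 - p + p * z" by (simp add: algebra_simps)
    have "pgf q (1 - p + p * z) + (\<Sum>m\<in>{0, 1}. u m) = z * c + excess (1 - p + p * z)"
      by (simp add: u_def c_def slope_def excess_def algebra_simps)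
    then show ?thesis unfolding e using c by (simp add: add_divide_distrib)
  qed
  ultimately show ?thesis by (simp add: c_def)
qed

lemma pruned_weight_nonneg:
  assumes p: "0 < p" "p \<le> 1"
  shows "0 \<le> pruned_weight p m"
proof (cases "m = 0")
  case True
  have "pgf_coeff q (1 - p) 0 + p - 1 = excess (1 - p)" by (simp add: pgf_coeff_def excess_def pgf_def)
  then show ?thesis
    using True excess_pos[of "1 - p"] slope_pos[of "1 - p"] p by (simp add: pruned_weight_def)
next
  case False
  then show ?thesis
    using pgf_coeff_nonneg[of "1 - p" q m] slope_pos[of "1 - p"] p by (simp add: pruned_weight_def)
qed

lemma pruned_weight_0: "0 < p \<Longrightarrow> pruned_weight p 0 = excess (1 - p) / (p * slope (1 - p))"
  by (simp add: pruned_weight_def pgf_coeff_def excess_def pgf_def add_ac)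

lemma pruned_weight_total: "0 < p \<Longrightarrow> p \<le> 1 \<Longrightarrow> pruned_weight p sums 1"
  using pruned_weight_sums[of p 1] by (simp add: excess_def pgf_1)

text \<open>With the D of the overview, \<open>(1 - \<mu>) * p \<le> D(p) \<le> p * D'(p)\<close> by
  convexity and \<open>D(0) = 0\<close>, so the weight lies between
  \<open>(1 - \<mu>) / D'(p)\<close> and 1, while \<open>D'(p)\<close> tends to the positive number
  \<open>1 - \<mu>\<close>.\<close>

lemma pruned_weight_0_subcritical:
  assumes \<mu>: "\<mu> < 1" and p: "p \<longlonglongrightarrow> 0" "\<And>n. 0 < p n" "\<And>n. p n < 1"
  shows "(\<lambda>n. pruned_weight (p n) 0) \<longlonglongrightarrow> 1"
proof (rule tendsto_sandwich)
  have "(\<lambda>n. pgf_coeff q (1 - p n) 1) \<longlonglongrightarrow> \<mu>"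
    unfolding pgf_coeff_def \<mu>_def
  proof (rule tannerys_theorem[THEN conjunct2, THEN conjunct2])
    show "(\<lambda>n. pmf q k * real (k choose 1) * (1 - p n) ^ (k - 1)) \<longlonglongrightarrow> real k * pmf q k" for k
      by (rule tendsto_eq_intros p refl)+ simp
    show "summable (\<lambda>k. real k * pmf q k)" by (rule summable_mean)
    have "norm (pmf q k * real (k choose 1) * (1 - p n) ^ (k - 1)) \<le> real k * pmf q k" for k n
    proof -
      have "(1 - p n) ^ (k - 1) \<le> 1" "0 \<le> (1 - p n) ^ (k - 1)"
        using p(2,3)[of n] by (auto intro: power_le_one)
      then show ?thesis by (simp add: mult_left_le mult.commute mult_left_mono)
    qed
    then show "\<forall>\<^sub>F (k, n) in sequentially \<times>\<^sub>F sequentially. norm (pmf q k * real (k choose 1) * (1 - p n) ^ (k - 1)) \<le> real k * pmf q k"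
      by (intro always_eventually) auto
  qed simp
  then have "(\<lambda>n. slope (1 - p n)) \<longlonglongrightarrow> 1 - \<mu>" unfolding slope_def by (intro tendsto_intros)
  then have "(\<lambda>n. (1 - \<mu>) / slope (1 - p n)) \<longlonglongrightarrow> (1 - \<mu>) / (1 - \<mu>)"
    using \<mu> by (intro tendsto_intros) auto
  then show "(\<lambda>n. (1 - \<mu>) / slope (1 - p n)) \<longlonglongrightarrow> 1" using \<mu> by simp
  have gap: "(1 - \<mu>) / slope (1 - p n) \<le> pruned_weight (p n) 0 \<and> pruned_weight (p n) 0 \<le> 1" for n
  proof -
    have x: "0 \<le> 1 - p n" "1 - p n < 1" using p(2,3)[of n] by auto
    have s: "0 < slope (1 - p n)" using slope_pos x by blast
    have e: "(\<lambda>k. pmf q k * ((1 - p n) ^ k - 1 + real k * p n)) sums (excess (1 - p n) - (1 - \<mu>) * p n)"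
      using excess_sums[of "1 - p n"] x by simp
    have sl: "(\<lambda>k. p n * (pmf q k * (real k * (1 - (1 - p n) ^ (k - 1))))) sums (p n * (slope (1 - p n) - (1 - \<mu>)))"
      using sums_mult[OF slope_sums[OF x]] .
    have "0 \<le> excess (1 - p n) - (1 - \<mu>) * p n"
      by (rule sums_le[OF _ sums_zero e]) (use bernoulli_gap(1)[of "1 - p n"] x in auto)
    then have 1: "(1 - \<mu>) * p n \<le> excess (1 - p n)" by simp
    have "excess (1 - p n) - (1 - \<mu>) * p n \<le> p n * (slope (1 - p n) - (1 - \<mu>))"
    proof (rule sums_le[OF _ e sl])
      fix k
      have "(1 - p n) ^ k - 1 + real k * p n \<le> p n * (real k * (1 - (1 - p n) ^ (k - 1)))"
      proof (cases k)
        case (Suc j)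
        have "real (Suc j) * (1 - p n) ^ j * p n \<le> 1 - (1 - p n) ^ Suc j"
        proof -
          have "(\<Sum>i<Suc j. (1 - p n) ^ j) \<le> (\<Sum>i<Suc j. (1 - p n) ^ i)"
            using x by (intro sum_mono power_decreasing) auto
          then have "real (Suc j) * (1 - p n) ^ j * p n \<le> (\<Sum>i<Suc j. (1 - p n) ^ i) * p n"
            using p(2)[of n] by (intro mult_right_mono) simp_all
          also have "\<dots> = 1 - (1 - p n) ^ Suc j"
            using one_diff_power_eq[of "1 - p n" "Suc j"] by (simp add: mult.commute)
          finally show ?thesis .
        qed
        then show ?thesis using Suc by (simp add: algebra_simps)
      qed simp
      then have "pmf q k * ((1 - p n) ^ k - 1 + real k * p n) \<le> pmf q k * (p n * (real k * (1 - (1 - p n) ^ (k - 1))))"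
        by (rule mult_left_mono) simp
      then show "pmf q k * ((1 - p n) ^ k - 1 + real k * p n) \<le> p n * (pmf q k * (real k * (1 - (1 - p n) ^ (k - 1))))"
        by (simp only: mult.left_commute[of "p n"])
    qed
    then have 2: "excess (1 - p n) \<le> p n * slope (1 - p n)" by (simp add: algebra_simps)
    have c: "0 < p n * slope (1 - p n)" using s p(2)[of n] by simp
    have "(1 - \<mu>) * p n / (p n * slope (1 - p n)) \<le> excess (1 - p n) / (p n * slope (1 - p n))"
      using 1 c by (intro divide_right_mono) auto
    moreover have "(1 - \<mu>) * p n / (p n * slope (1 - p n)) = (1 - \<mu>) / slope (1 - p n)"
      using p(2)[of n] by simp
    moreover have "excess (1 - p n) / (p n * slope (1 - p n)) \<le> 1" using 2 c by simp
    ultimately show ?thesis using pruned_weight_0[OF p(2)[of n]] by simp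
  qed
  show "\<forall>\<^sub>F n in sequentially. (1 - \<mu>) / slope (1 - p n) \<le> pruned_weight (p n) 0" using gap by simp
  show "\<forall>\<^sub>F n in sequentially. pruned_weight (p n) 0 \<le> 1" using gap by simp
qed simp

text \<open>After exchanging the two sums, row k is a finite sum; multiplied by
  \<open>(1 - x)\<^sup>2\<close> it is the weighted Bernoulli gap of k, and in the critical case
  these add up to the excess.\<close>

lemma g_fun_eq:
  assumes \<mu>: "\<mu> = 1" and x: "0 \<le> x" "x < 1"
  shows "g_fun q x = excess x / (1 - x)\<^sup>2"
proof -
  define f where "f k m = (if m < k then real (k - 1 - m) * pmf q k * x ^ m else 0)" for k m
  have geo: "(\<Sum>m<k. real (k - 1 - m) * x ^ m) * (1 - x)\<^sup>2 = x ^ k - 1 + real k * (1 - x)" for k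
  proof (induction k)
    case (Suc k)
    have "(\<Sum>m<Suc k. real (Suc k - 1 - m) * x ^ m) = (\<Sum>m<k. real (k - 1 - m) * x ^ m) + (\<Sum>m<k. x ^ m)"
    proof -
      have "real (Suc k - 1 - m) * x ^ m = real (k - 1 - m) * x ^ m + x ^ m" if "m < k" for m
      proof -
        have "Suc k - 1 - m = Suc (k - 1 - m)" using that by simp
        then show ?thesis by (simp add: algebra_simps)
      qed
      then show ?thesis by (simp add: sum.distrib)
    qed
    moreover have "(\<Sum>m<k. x ^ m) * (1 - x) = 1 - x ^ k" using one_diff_power_eq[of x k] by (simp add: mult.commute)
    then have "(\<Sum>m<k. x ^ m) * (1 - x)\<^sup>2 = (1 - x ^ k) * (1 - x)" by (simp add: power2_eq_square mult.assoc[symmetric])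
    ultimately show ?case using Suc by (simp add: algebra_simps)
  qed simp
  have row: "f k sums (pmf q k * ((x ^ k - 1 + real k * (1 - x)) / (1 - x)\<^sup>2))" for k
  proof -
    have "f k sums (\<Sum>m<k. f k m)" by (rule sums_finite) (auto simp: f_def)
    also have "(\<Sum>m<k. f k m) = pmf q k * (\<Sum>m<k. real (k - 1 - m) * x ^ m)"
      by (simp add: f_def sum_distrib_left mult_ac)
    also have "(\<Sum>m<k. real (k - 1 - m) * x ^ m) = (x ^ k - 1 + real k * (1 - x)) / (1 - x)\<^sup>2"
      using geo[of k] x by (simp add: field_simps)
    finally show ?thesis .
  qed
  have total: "(\<lambda>k. pmf q k * ((x ^ k - 1 + real k * (1 - x)) / (1 - x)\<^sup>2)) sums (excess x / (1 - x)\<^sup>2)"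
    using sums_divide[OF excess_sums[of x], of "(1 - x)\<^sup>2"] x \<mu> by simp
  have nn: "0 \<le> f k m" for k m using x by (simp add: f_def)
  have "(\<Sum>\<^sub>\<infinity>k\<in>{m+1..}. (real k - real m - 1) * pmf q k) * x ^ m = (\<Sum>k. f k m)" for m
  proof -
    define h where "h k = (if m < k then real (k - 1 - m) * pmf q k else 0)" for k
    have h0: "0 \<le> h k" for k by (simp add: h_def)
    have sh: "summable h"
    proof (rule summable_comparison_test'[OF summable_mean, of 0])
      fix k
      show "norm (h k) \<le> real k * pmf q k" by (auto simp: h_def intro!: mult_right_mono)
    qed
    have "(\<Sum>\<^sub>\<infinity>k\<in>{m+1..}. (real k - real m - 1) * pmf q k) = (\<Sum>\<^sub>\<infinity>k\<in>UNIV. h k)"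
    proof (rule infsum_cong_neutral)
      fix k assume "k \<in> {m + 1..} \<inter> UNIV"
      then have "m < k" "real (k - 1 - m) = real k - real m - 1" by auto
      then show "(real k - real m - 1) * pmf q k = h k" by (simp add: h_def)
    qed (auto simp: h_def)
    also have "\<dots> = suminf h"
      by (rule infsumI) (rule sums_nonneg_imp_has_sum[OF summable_sums[OF sh] h0])
    finally show ?thesis
      by (simp add: suminf_mult2[OF sh] h_def f_def if_distrib[of "\<lambda>y. y * x ^ m"] cong: if_cong)
  qed
  then have "g_fun q x = (\<Sum>m. \<Sum>k. f k m)" by (simp add: g_fun_def)
  also have "\<dots> = excess x / (1 - x)\<^sup>2"
    using sums_unique[OF sums_swap_nonneg(2)[OF nn row total]] by simp
  finally show ?thesis .
qed

end

text \<open>c is the limit of \<open>D(y) / (y * D'(y))\<close> and turns out to be the parameter of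
  the invariant measure.\<close>

locale critical_law = offspring_law +
  fixes c :: real
  assumes \<mu>_1: "\<mu> = 1"
    and lim: "((\<lambda>x. excess x / ((1 - x) * slope x)) \<longlongrightarrow> c) (at_left 1)"
begin

section \<open>Regular variation in the critical case\<close>

lemma eventually_at_left_1: "(\<And>x. 0 < x \<Longrightarrow> x < 1 \<Longrightarrow> Q x) \<Longrightarrow> eventually Q (at_left (1 :: real))"
  using eventually_at_left_real[of 0 "1 :: real"] by (auto elim: eventually_mono)

lemma c_ge_half: "1 / 2 \<le> c"
proof (rule tendsto_lowerbound[OF lim])
  show "eventually (\<lambda>x. 1 / 2 \<le> excess x / ((1 - x) * slope x)) (at_left 1)"
  proof (rule eventually_at_left_1)
    fix x :: real assume x: "0 < x" "x < 1"
    then show "1 / 2 \<le> excess x / ((1 - x) * slope x)"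
      using slope_le_excess[OF \<mu>_1, of x] slope_pos[of x] by (simp add: pos_le_divide_eq)
  qed
qed simp

lemma elasticity_tendsto: "((\<lambda>x. (1 - x) * slope x / excess x) \<longlongrightarrow> 1 / c) (at_left 1)"
  using tendsto_inverse[OF lim] c_ge_half by (simp add: inverse_eq_divide)

text \<open>L'Hospital's rule for \<open>ln (excess x)\<close> against \<open>- ln (1 - x)\<close>:
  the quotient of the derivatives is minus the elasticity, with limit \<open>- 1 / c\<close>. The
  summand 2 comes from the factor \<open>(1 - x)\<^sup>2\<close> between the excess and
  \<open>g_fun\<close>.\<close>

lemma ln_g_fun_tendsto: "((\<lambda>x. ln (g_fun q x) / (- ln (1 - x))) \<longlongrightarrow> 2 - 1 / c) (at_left 1)"
proof -
  have "((\<lambda>x. ln (excess x) / (- ln (1 - x))) \<longlongrightarrow> - (1 / c)) (at_left 1)"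
  proof (rule lhopital_left_at_top)
    have "filterlim (\<lambda>x. 1 - x) (at_right 0) (at_left (1 :: real))"
      unfolding filterlim_at
      by (intro conjI eventually_at_left_1) (auto intro!: tendsto_eq_intros)
    then have "filterlim (\<lambda>x. ln (1 - x)) at_bot (at_left (1 :: real))"
      by (rule filterlim_compose[OF ln_at_0])
    then show "filterlim (\<lambda>x. - ln (1 - x)) at_top (at_left (1 :: real))"
      by (simp add: filterlim_uminus_at_bot)
    show "\<forall>\<^sub>F x in at_left (1 :: real). 1 / (1 - x) \<noteq> 0" by (rule eventually_at_left_1) simp
    show "\<forall>\<^sub>F x in at_left 1. ((\<lambda>x. ln (excess x)) has_real_derivative - slope x / excess x) (at x)"
      by (rule eventually_at_left_1)
         (auto intro!: derivative_eq_intros excess_has_derivative simp: excess_pos less_imp_neq[OF excess_pos, symmetric])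
    show "\<forall>\<^sub>F x in at_left (1 :: real). ((\<lambda>x. - ln (1 - x)) has_real_derivative 1 / (1 - x)) (at x)"
      by (rule eventually_at_left_1) (auto intro!: derivative_eq_intros)
    show "((\<lambda>x. (- slope x / excess x) / (1 / (1 - x))) \<longlongrightarrow> - (1 / c)) (at_left 1)"
      using tendsto_minus[OF elasticity_tendsto] by (simp add: mult.commute)
  qed
  then have "((\<lambda>x. 2 + ln (excess x) / (- ln (1 - x))) \<longlongrightarrow> 2 + - (1 / c)) (at_left 1)"
    by (intro tendsto_intros)
  then have *: "((\<lambda>x. 2 + ln (excess x) / (- ln (1 - x))) \<longlongrightarrow> 2 - 1 / c) (at_left 1)" by simp
  show ?thesis
  proof (rule Lim_transform_eventually[OF *])
    show "\<forall>\<^sub>F x in at_left 1. 2 + ln (excess x) / (- ln (1 - x)) = ln (g_fun q x) / (- ln (1 - x))"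
    proof (rule eventually_at_left_1)
      fix x :: real assume x: "0 < x" "x < 1"
      have l: "ln (1 - x) < 0" using x by simp
      have g: "ln (g_fun q x) = ln (excess x) - 2 * ln (1 - x)"
        using x excess_pos[of x] by (simp add: g_fun_eq \<mu>_1 ln_div ln_realpow)
      show "2 + ln (excess x) / (- ln (1 - x)) = ln (g_fun q x) / (- ln (1 - x))"
        unfolding g using l by (simp add: diff_divide_distrib)
    qed
  qed
qed

text \<open>
  The mean value theorem in logarithmic coordinates: the elasticity of the excess tends to
  \<open>1 / c\<close>, so the excess varies regularly with exponent \<open>1 / c\<close>.
\<close>

lemma excess_ratio:
  assumes p: "0 < p" "p < 1" and s: "0 < s" "s < 1"
  shows "\<exists>\<eta>. 1 - p < \<eta> \<and> \<eta> < 1 \<and>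
    excess (1 - p * s) / excess (1 - p) = exp (ln s * ((1 - \<eta>) * slope \<eta> / excess \<eta>))"
proof -
  have ps: "0 < p * s" "p * s < p" using p s by auto
  have d: "((\<lambda>t. ln (excess (1 - exp t))) has_real_derivative exp t * slope (1 - exp t) / excess (1 - exp t)) (at t)"
    if t: "t < 0" for t
  proof -
    have x: "0 < 1 - exp t" "1 - exp t < 1" using t by auto
    have "((\<lambda>t. 1 - exp t) has_real_derivative - exp t) (at t)" by (auto intro!: derivative_eq_intros)
    moreover have "(excess has_real_derivative - slope (1 - exp t)) (at (1 - exp t))"
      using x by (intro excess_has_derivative) auto
    ultimately have "((\<lambda>t. excess (1 - exp t)) has_real_derivative - slope (1 - exp t) * - exp t) (at t)"
      by (rule DERIV_chain2[rotated])
    moreover have "0 < excess (1 - exp t)" using excess_pos x by simp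
    ultimately show ?thesis
      by (auto intro!: derivative_eq_intros simp: divide_inverse)
  qed
  have "ln (p * s) < ln p" using ps p by simp
  moreover have "ln p < 0" using p by simp
  ultimately have "\<exists>z>ln (p * s). z < ln p \<and>
      ln (excess (1 - exp (ln p))) - ln (excess (1 - exp (ln (p * s)))) =
      (ln p - ln (p * s)) * (exp z * slope (1 - exp z) / excess (1 - exp z))"
    by (intro MVT2 d) auto
  then obtain t where t: "ln (p * s) < t" "t < ln p" and
    eq: "ln (excess (1 - exp (ln p))) - ln (excess (1 - exp (ln (p * s)))) =
      (ln p - ln (p * s)) * (exp t * slope (1 - exp t) / excess (1 - exp t))" by blast
  have e: "exp t < p" using t p by (metis exp_less_cancel_iff exp_ln)
  have pos: "0 < excess (1 - p)" "0 < excess (1 - p * s)" using p ps excess_pos by auto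
  have "ln (excess (1 - p * s)) - ln (excess (1 - p)) = ln s * (exp t * slope (1 - exp t) / excess (1 - exp t))"
  proof -
    have "ln p - ln (p * s) = - ln s" using p s by (simp add: ln_mult)
    then show ?thesis using eq p ps by simp
  qed
  then have "excess (1 - p * s) / excess (1 - p) = exp (ln s * (exp t * slope (1 - exp t) / excess (1 - exp t)))"
    using pos by (metis exp_diff exp_ln)
  then show ?thesis using e p by (intro exI[of _ "1 - exp t"]) auto
qed

lemma excess_regularly_varying:
  assumes p: "p \<longlonglongrightarrow> 0" "\<And>n. 0 < p n" "\<And>n. p n < 1" and s: "0 < s" "s < 1"
  shows "(\<lambda>n. excess (1 - p n * s) / excess (1 - p n)) \<longlonglongrightarrow> s powr (1 / c)"
proof -
  have "\<forall>n. \<exists>\<eta>. 1 - p n < \<eta> \<and> \<eta> < 1 \<and>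
    excess (1 - p n * s) / excess (1 - p n) = exp (ln s * ((1 - \<eta>) * slope \<eta> / excess \<eta>))"
    using excess_ratio p s by blast
  from choice[OF this] obtain \<eta> where \<eta>: "\<And>n. 1 - p n < \<eta> n" "\<And>n. \<eta> n < 1"
    "\<And>n. excess (1 - p n * s) / excess (1 - p n) = exp (ln s * ((1 - \<eta> n) * slope (\<eta> n) / excess (\<eta> n)))"
    by blast
  \<comment> \<open>The intermediate point is squeezed between \<open>1 - p n\<close> and 1, so the
    elasticity there has the limit \<open>1 / c\<close> although the point is not known.\<close>
  have "\<eta> \<longlonglongrightarrow> 1"
  proof (rule tendsto_sandwich)
    show "(\<lambda>n. 1 - p n) \<longlonglongrightarrow> 1" using tendsto_diff[OF tendsto_const p(1), of 1] by simp
    show "\<forall>\<^sub>F n in sequentially. 1 - p n \<le> \<eta> n" "\<forall>\<^sub>F n in sequentially. \<eta> n \<le> 1"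
      by (simp_all add: less_imp_le[OF \<eta>(1)] less_imp_le[OF \<eta>(2)])
  qed simp
  then have "filterlim \<eta> (at_left 1) sequentially"
    unfolding filterlim_at using \<eta>(2) by (auto simp: less_imp_neq)
  then have "(\<lambda>n. (1 - \<eta> n) * slope (\<eta> n) / excess (\<eta> n)) \<longlonglongrightarrow> 1 / c"
    by (rule filterlim_compose[OF elasticity_tendsto])
  then have "(\<lambda>n. exp (ln s * ((1 - \<eta> n) * slope (\<eta> n) / excess (\<eta> n)))) \<longlonglongrightarrow> exp (ln s * (1 / c))"
    by (intro tendsto_exp tendsto_mult_left)
  then show ?thesis unfolding \<eta>(3) using s by (simp add: powr_def mult.commute)
qed

lemma pruned_weight_pgf_tendsto:
  assumes p: "p \<longlonglongrightarrow> 0" "\<And>n. 0 < p n" "\<And>n. p n < 1" and z: "0 < z" "z < 1"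
  shows "(\<lambda>n. \<Sum>m. pruned_weight (p n) m * z ^ m) \<longlonglongrightarrow> z + c * (1 - z) powr (1 / c)"
proof -
  have "filterlim (\<lambda>n. 1 - p n) (at_left 1) sequentially"
    unfolding filterlim_at using p(2) tendsto_diff[OF tendsto_const p(1), of 1] by (simp add: less_imp_neq)
  then have "(\<lambda>n. excess (1 - p n) / ((1 - (1 - p n)) * slope (1 - p n))) \<longlonglongrightarrow> c"
    by (rule filterlim_compose[OF lim])
  then have "(\<lambda>n. excess (1 - p n) / (p n * slope (1 - p n))) \<longlonglongrightarrow> c" by simp
  then have "(\<lambda>n. z + excess (1 - p n) / (p n * slope (1 - p n)) * (excess (1 - p n * (1 - z)) / excess (1 - p n)))
      \<longlonglongrightarrow> z + c * (1 - z) powr (1 / c)"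
    using excess_regularly_varying[OF p, of "1 - z"] z by (intro tendsto_intros) auto
  moreover have "z + excess (1 - p n) / (p n * slope (1 - p n)) * (excess (1 - p n * (1 - z)) / excess (1 - p n)) =
      (\<Sum>m. pruned_weight (p n) m * z ^ m)" for n
  proof -
    have "0 < excess (1 - p n)" using p(2,3)[of n] by (intro excess_pos) auto
    then have "z + excess (1 - p n) / (p n * slope (1 - p n)) * (excess (1 - p n * (1 - z)) / excess (1 - p n)) =
        z + excess (1 - p n * (1 - z)) / (p n * slope (1 - p n))" by simp
    also have "\<dots> = (\<Sum>m. pruned_weight (p n) m * z ^ m)"
      using p(2,3)[of n] z by (intro sums_unique pruned_weight_sums) auto
    finally show ?thesis .
  qed
  ultimately show ?thesis by simp
qed

lemma igw_limit:
  assumes p: "p \<longlonglongrightarrow> 0" "\<And>n. 0 < p n" "\<And>n. p n < 1"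
  shows "(\<lambda>n. pruned_weight (p n) m) \<longlonglongrightarrow> pmf (igw_offspring c) m"
    and "\<And>z. 0 \<le> z \<Longrightarrow> z < 1 \<Longrightarrow> pgf (igw_offspring c) z \<noteq> z"
proof -
  define G where "G z = z + c * (1 - z) powr (1 / c)" for z :: real
  have c: "0 < c" using c_ge_half by simp
  have G1: "G 1 = 1" by (simp add: G_def)
  have Glim: "(G \<longlongrightarrow> 1) (at_left 1)"
  proof -
    have "((\<lambda>z. (1 - z) powr (1 / c)) \<longlongrightarrow> 0) (at_left 1)"
      by (rule tendsto_zero_powrI[where b = "1 / c"])
         (use c in \<open>auto intro!: tendsto_eq_intros eventually_at_left_1\<close>)
    then have "(G \<longlongrightarrow> 1 + c * 0) (at_left 1)" unfolding G_def by (intro tendsto_intros)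
    then show ?thesis by simp
  qed
  obtain r where r: "\<And>z. 0 < z \<Longrightarrow> z < 1 \<Longrightarrow> pgf r z = G z" "\<And>m. (\<lambda>n. pruned_weight (p n) m) \<longlonglongrightarrow> pmf r m"
    by (rule pgf_continuity[of "\<lambda>n. pruned_weight (p n)" G])
       (use p pruned_weight_pgf_tendsto[OF p] Glim pruned_weight_nonneg pruned_weight_total
        in \<open>auto simp: G_def less_imp_le\<close>)
  \<comment> \<open>\<open>igw_offspring\<close> is described on the closed unit interval, while
    \<open>pgf_continuity\<close> covers the open one; at 0 the limit is c by the definition of
    c.\<close>
  have r0: "pgf r 0 = G 0"
  proof -
    have "(\<lambda>n. pruned_weight (p n) 0) \<longlonglongrightarrow> c"
    proof -
      have "filterlim (\<lambda>n. 1 - p n) (at_left 1) sequentially"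
        unfolding filterlim_at using p(2) tendsto_diff[OF tendsto_const p(1), of 1] by (simp add: less_imp_neq)
      from filterlim_compose[OF lim this] show ?thesis using pruned_weight_0 p(2) by simp
    qed
    then have "pmf r 0 = c" using r(2) LIMSEQ_unique by blast
    moreover have "pgf r 0 = pmf r 0"
      unfolding pgf_def using sums_unique[OF powser_sums_zero[of "pmf r"]] by simp
    ultimately show ?thesis by (simp add: G_def)
  qed
  have rG: "\<forall>z\<in>{0..1}. pgf r z = z + c * (1 - z) powr (1 / c)"
  proof
    fix z :: real assume "z \<in> {0..1}"
    then consider "z = 0" | "0 < z" "z < 1" | "z = 1" by fastforce
    then show "pgf r z = z + c * (1 - z) powr (1 / c)"
      using r(1) r0 G1 pgf_1[of r] by cases (auto simp: G_def)
  qed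
  have "igw_offspring c = r"
    unfolding igw_offspring_def
  proof (rule the_equality)
    show "\<forall>z\<in>{0..1}. pgf r z = z + c * (1 - z) powr (1 / c)" by (rule rG)
    fix r' assume "\<forall>z\<in>{0..1}. pgf r' z = z + c * (1 - z) powr (1 / c)"
    then show "r' = r" using rG by (intro pgf_determines_pmf) simp
  qed
  then show "(\<lambda>n. pruned_weight (p n) m) \<longlonglongrightarrow> pmf (igw_offspring c) m"
    and "\<And>z. 0 \<le> z \<Longrightarrow> z < 1 \<Longrightarrow> pgf (igw_offspring c) z \<noteq> z"
    using r(2) rG c by auto
qed

end

section \<open>Convergence of the conditional shape\<close>

text \<open>The pointwise results on shapes use \<open>survivors\<close>, the probabilistic ones its
  restriction to the sample space; children stay in the sample space, so the pruned shapes
  agree.\<close>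

lemma pruned_shape_restrict:
  assumes "pruned_shape b \<nu> (E \<inter> S) \<omega> t" "\<omega> \<in> S" "\<And>\<omega> i. \<omega> \<in> S \<Longrightarrow> (\<lambda>w. \<omega> (i # w)) \<in> S"
  shows "pruned_shape b \<nu> E \<omega> t"
  using assms(1,2)
proof (induction rule: pruned_shape.induct)
  case (node I \<omega> ts)
  show ?case
  proof (rule pruned_shape.node)
    show "I = {i. i < \<nu> (\<omega> []) \<and> (\<lambda>w. \<omega> (i # w)) \<in> E}" using node(1) assms(3)[OF node.prems] by simp
    show "card I \<noteq> 1" if b using node(2) that .
    show "pruned_shape b \<nu> E (\<lambda>w. \<omega> (i # w)) (ts i)" if "i \<in> I" for i
      using node.IH[OF that assms(3)[OF node.prems]] .
  qed
next
  case (merge \<omega> j t)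
  have "{i. i < \<nu> (\<omega> []) \<and> (\<lambda>w. \<omega> (i # w)) \<in> E} = {j}"
    using merge(2) assms(3)[OF merge.prems] by simp
  then show ?case using pruned_shape.merge[of b \<nu> \<omega> E j t] merge(1) merge.IH[OF assms(3)[OF merge.prems]] by simp
qed

text \<open>Reductions never remove the root and add no points. Since infinite families are assigned
  the empty tree, survival implies a finite family.\<close>

lemma is_empty_tree_iterated_reduction:
  "is_empty_tree (iterated_reduction H n empty_metric_tree)"
proof -
  have "mspace (fst (iterated_reduction H n empty_metric_tree)) = {([], 0)} \<and>
      snd (iterated_reduction H n empty_metric_tree) = ([], 0)"
  proof (induction n)
    case 0
    have "Metric_space {([], 0) :: point} (\<lambda>_ _. 0)" unfolding Metric_space_def by simp
    from Metric_space.mspace_metric[OF this] show ?case by (simp add: empty_metric_tree_def)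
  next
    case (Suc n)
    define X where "X = iterated_reduction H n empty_metric_tree"
    have X: "mspace (fst X) = {([], 0)}" "snd X = ([], 0)" using Suc by (simp_all add: X_def)
    let ?K = "reduced_points (H (Suc n)) X"
    have K: "?K = {([], 0)}" using X by (auto simp: reduced_points_def)
    have "?K \<subseteq> mtopology_of (fst X) closure_of ?K" by (rule closure_of_subset) (simp add: K X)
    moreover have "mtopology_of (fst X) closure_of ?K \<subseteq> mspace (fst X)"
      using closure_of_subset_topspace[of "mtopology_of (fst X)"] by simp
    ultimately have "mtopology_of (fst X) closure_of ?K = {([], 0)}"
      unfolding K X(1) by (rule subset_antisym[rotated])
    then have "mspace (fst (reduction (H (Suc n)) X)) = {([], 0)}" "snd (reduction (H (Suc n)) X) = ([], 0)"
      using X by (simp_all add: reduction_def)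
    then show ?case by (simp add: X_def)
  qed
  then show ?thesis by (simp add: is_empty_tree_def)
qed

lemma survivors_finite_family: "\<omega> \<in> survivors H n \<Longrightarrow> finite (family (fst \<circ> \<omega>))"
  using is_empty_tree_iterated_reduction by (auto simp: survivors_def random_tree_def split: if_splits)

lemma prod_mset_divide: "(\<Prod>t\<in>#M. f t / (p :: real)) = (\<Prod>t\<in>#M. f t) / p ^ size M"
  by (induction M) (auto simp: field_simps)

lemma tendsto_prod_mset:
  fixes f :: "nat \<Rightarrow> 'a \<Rightarrow> real"
  assumes "\<And>t. t \<in># M \<Longrightarrow> (\<lambda>n. f n t) \<longlonglongrightarrow> g t"
  shows "(\<lambda>n. \<Prod>t\<in>#M. f n t) \<longlonglongrightarrow> (\<Prod>t\<in>#M. g t)"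
  using assms by (induction M) (auto intro!: tendsto_mult)

text \<open>The probability of a tree is a finite product of counts and weights, so convergence of
  every single weight suffices.\<close>

lemma shape_law_tendsto:
  assumes rec: "\<And>n M. size M \<noteq> 1 \<Longrightarrow>
      f n (Node M) = real (card (arrangements {..<size M} M)) * (\<Prod>t\<in>#M. f n t) * w n (size M)"
    and w: "\<And>m. (\<lambda>n. w n m) \<longlonglongrightarrow> pmf r m"
    and "reduced t"
  shows "(\<lambda>n. f n t) \<longlonglongrightarrow> GW_prob r t"
  using \<open>reduced t\<close>
proof (induction rule: reduced.induct)
  case (1 M)
  show ?case
    unfolding rec[OF \<open>size M \<noteq> 1\<close>] GW_prob_Node
    by (intro tendsto_mult tendsto_const tendsto_prod_mset w) (use 1 in simp)
qed

locale reduced_random_tree = offspring_law q for q +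
  fixes lam :: real and H :: "nat \<Rightarrow> point rooted set" and n :: nat
  assumes lam: "0 < lam" and H: "\<And>n. n \<ge> 1 \<Longrightarrow> hereditary (H n)"
    and survival: "\<P>(\<omega> in gw_space q lam. \<not> is_empty_tree (iterated_reduction H n (random_tree \<omega>))) > 0"
begin

sublocale O: offspring_space "measure_pmf q \<Otimes>\<^sub>M exponential_law lam" fst q
  by (rule offspring_space_gw[OF lam])

lemma gw_space_eq: "gw_space q lam = O.P"
  by (simp add: gw_space_def O.P_def)

definition E :: "(nat list \<Rightarrow> nat \<times> real) set" where
  "E = survivors H n \<inter> space O.P"

definition p :: real where "p = O.P.prob E"

lemma E_eq: "E = {\<omega> \<in> space O.P. \<not> is_empty_tree (iterated_reduction H n (random_tree \<omega>))}"
  by (auto simp: E_def survivors_def)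

text \<open>Measurability of survival comes from its positive probability: \<open>measure\<close>
  assigns 0 to every set outside the sigma-algebra.\<close>

lemma p_pos: "0 < p" and E_sets: "E \<in> sets O.P"
proof -
  show "0 < p" using survival by (simp add: p_def E_eq gw_space_eq)
  then show "E \<in> sets O.P" unfolding p_def using measure_notin_sets[of E O.P] by force
qed

lemma p_le_1: "p \<le> 1"
  by (simp add: p_def)

lemma edge_length_pos: "\<omega> \<in> space O.P \<Longrightarrow> 0 < snd (\<omega> u)"
proof -
  assume "\<omega> \<in> space O.P"
  then have "\<omega> u \<in> space (measure_pmf q \<Otimes>\<^sub>M exponential_law lam)" by (simp add: O.space_P)
  then show ?thesis by (auto simp: space_pair_measure space_exponential_law)
qed

sublocale pruned_offspring "measure_pmf q \<Otimes>\<^sub>M exponential_law lam" fst q True E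
proof
  show "E \<in> sets O.P" by (rule E_sets)
  have "AE \<omega> in O.P. finite (family (fst \<circ> \<omega>))"
    by (rule O.AE_finite_family) (rule pgf_no_fixed_point)
  then show "AE \<omega> in O.P. (\<exists>i<fst (\<omega> []). O.child i \<omega> \<in> E) \<longrightarrow> \<omega> \<in> E"
    using AE_space
  proof eventually_elim
    case (elim \<omega>)
    show ?case
    proof (intro impI)
      assume "\<exists>i<fst (\<omega> []). O.child i \<omega> \<in> E"
      then obtain i where "i < fst (\<omega> [])" "O.child i \<omega> \<in> survivors H n" by (auto simp: E_def)
      then have "\<omega> \<in> survivors H n"
        using survivors_child[of \<omega> H i n] elim edge_length_pos H by blast
      then show "\<omega> \<in> E" using elim by (simp add: E_def)
    qed
  qed
qed

lemma shape_on_E: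
  assumes "\<omega> \<in> E"
  shows "\<exists>t. \<omega> \<in> shape_event t \<and> shape (iterated_reduction H n (random_tree \<omega>)) = Node {#t#}"
proof -
  have \<omega>: "\<omega> \<in> survivors H n" "\<omega> \<in> space O.P" using assms by (auto simp: E_def)
  have fin: "finite (family (fst \<circ> \<omega>))" using survivors_finite_family \<omega> by blast
  obtain t where t: "pruned_shape True fst E \<omega> t" using pruned_shape_exists[OF fin] by blast
  then have "pruned_shape True fst (survivors H n) \<omega> t"
    unfolding E_def by (rule pruned_shape_restrict) (use \<omega> O.child_space in auto)
  then have "shape (iterated_reduction H n (random_tree \<omega>)) = Node {#t#}"
    by (intro shape_of_survivor[OF fin _ _ \<omega>(1)]) (use edge_length_pos[OF \<omega>(2)] H in auto)
  then show ?thesis using t \<omega> by (auto simp: shape_event_def)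
qed

lemma shape_event_eq:
  "{\<omega> \<in> space O.P. shape (iterated_reduction H n (random_tree \<omega>)) \<in> B \<and>
     \<not> is_empty_tree (iterated_reduction H n (random_tree \<omega>))} =
   (\<Union>t\<in>{t. Node {#t#} \<in> B}. E \<inter> shape_event t)"
proof -
  have "{\<omega> \<in> space O.P. shape (iterated_reduction H n (random_tree \<omega>)) \<in> B \<and>
     \<not> is_empty_tree (iterated_reduction H n (random_tree \<omega>))} =
    {\<omega> \<in> E. shape (iterated_reduction H n (random_tree \<omega>)) \<in> B}" by (auto simp: E_eq)
  also have "\<dots> = (\<Union>t\<in>{t. Node {#t#} \<in> B}. E \<inter> shape_event t)"
  proof (intro equalityI subsetI)
    fix \<omega> assume "\<omega> \<in> {\<omega> \<in> E. shape (iterated_reduction H n (random_tree \<omega>)) \<in> B}"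
    then show "\<omega> \<in> (\<Union>t\<in>{t. Node {#t#} \<in> B}. E \<inter> shape_event t)" using shape_on_E[of \<omega>] by auto
  next
    fix \<omega> assume "\<omega> \<in> (\<Union>t\<in>{t. Node {#t#} \<in> B}. E \<inter> shape_event t)"
    then obtain t where t: "Node {#t#} \<in> B" "\<omega> \<in> E" "\<omega> \<in> shape_event t" by blast
    obtain t' where t': "\<omega> \<in> shape_event t'" "shape (iterated_reduction H n (random_tree \<omega>)) = Node {#t'#}"
      using shape_on_E t by blast
    have "t' = t" using shape_event_disjoint[of t t'] t t' by blast
    then show "\<omega> \<in> {\<omega> \<in> E. shape (iterated_reduction H n (random_tree \<omega>)) \<in> B}" using t t' by simp
  qed
  finally show ?thesis .
qed

definition shape_law :: "ctree set \<Rightarrow> real" where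
  "shape_law B = \<P>(\<omega> in gw_space q lam. shape (iterated_reduction H n (random_tree \<omega>)) \<in> B
     \<bar> \<not> is_empty_tree (iterated_reduction H n (random_tree \<omega>)))"

lemma shape_law_eq: "shape_law B = O.P.prob (\<Union>t\<in>{t. Node {#t#} \<in> B}. E \<inter> shape_event t) / p"
  unfolding shape_law_def cond_prob_def gw_space_eq shape_event_eq p_def E_eq[symmetric] ..

lemma shape_law_single: "shape_law {Node {#t#}} = shape_prob t / p"
proof -
  have "(\<Union>t'\<in>{t'. Node {#t'#} \<in> {Node {#t#}}}. E \<inter> shape_event t') = E \<inter> shape_event t" by auto
  then show ?thesis unfolding shape_law_eq shape_prob_def by simp
qed

lemma shape_law_empty: "shape_law {Node {#}} = 0"
  unfolding shape_law_eq by simp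

lemma coeff_eq: "coeff m = pgf_coeff q (1 - p) m"
  by (simp add: coeff_def pgf_coeff_def p_def)

lemma slope_p: "0 < slope (1 - p)" and slope_coeff: "1 - coeff 1 = slope (1 - p)"
  using slope_pos[of "1 - p"] p_pos p_le_1 by (simp_all add: coeff_eq slope_def)

text \<open>Conditioning divides every shape probability by p: the subtrees in M leave a factor
  \<open>p ^ size M\<close> in the numerator and the tree itself a p in the denominator, which turns
  the coefficient into \<open>pruned_weight\<close>.\<close>

lemma shape_law_Node:
  assumes M: "size M \<noteq> 1"
  shows "shape_law {Node {#Node M#}} =
    real (card (arrangements {..<size M} M)) * (\<Prod>t\<in>#M. shape_law {Node {#t#}}) * pruned_weight p (size M)"
proof (cases "M = {#}")
  case True
  have "slope (1 - p) * shape_prob (Node {#}) = p - 1 + pgf_coeff q (1 - p) 0"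
    using shape_prob_leaf slope_coeff coeff_eq by (simp add: p_def)
  then have "shape_prob (Node {#}) = (p - 1 + pgf_coeff q (1 - p) 0) / slope (1 - p)"
    using slope_p by (simp add: field_simps)
  then show ?thesis
    using True p_pos slope_p by (simp add: shape_law_single pruned_weight_def arrangements_def add_ac mult.commute)
next
  case False
  have "slope (1 - p) * shape_prob (Node M) =
      real (card (arrangements {..<size M} M)) * (\<Prod>t\<in>#M. shape_prob t) * pgf_coeff q (1 - p) (size M)"
    using shape_prob_Node[OF _ M False] slope_coeff coeff_eq by simp
  then have "shape_prob (Node M) =
      real (card (arrangements {..<size M} M)) * (\<Prod>t\<in>#M. shape_prob t) * pgf_coeff q (1 - p) (size M) / slope (1 - p)"
    using slope_p by (simp add: field_simps)
  then show ?thesis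
    using M False p_pos slope_p unfolding shape_law_single prod_mset_divide
    by (simp add: pruned_weight_def mult_ac)
qed

text \<open>The mass of the single edge \<open>Node {#Node {#}#}\<close> confines the probability of
  every set of shapes; in the subcritical case that mass tends to 1.\<close>

lemma shape_law_bounds:
  "Node {#Node {#}#} \<in> B \<Longrightarrow> shape_law {Node {#Node {#}#}} \<le> shape_law B"
  "shape_law B \<le> 1"
  "Node {#Node {#}#} \<notin> B \<Longrightarrow> shape_law B \<le> 1 - shape_law {Node {#Node {#}#}}"
  "0 \<le> shape_law B"
proof -
  have sets: "(\<Union>t\<in>T. E \<inter> shape_event t) \<in> sets O.P" for T
    by (rule sets.countable_UN'[OF countable_subset[OF subset_UNIV countable_ctree]]) (use E_sets in auto)
  show "0 \<le> shape_law B" unfolding shape_law_eq using p_pos by simp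
  show "shape_law B \<le> 1"
    unfolding shape_law_eq using p_pos by (simp add: p_def) (rule O.P.finite_measure_mono, use E_sets in auto)
  show "shape_law {Node {#Node {#}#}} \<le> shape_law B" if "Node {#Node {#}#} \<in> B"
    unfolding shape_law_eq using p_pos that
    by (intro divide_right_mono O.P.finite_measure_mono sets) auto
  show "shape_law B \<le> 1 - shape_law {Node {#Node {#}#}}" if "Node {#Node {#}#} \<notin> B"
  proof -
    have "O.P.prob (\<Union>t\<in>{t. Node {#t#} \<in> B}. E \<inter> shape_event t) \<le> O.P.prob (E - (E \<inter> shape_event (Node {#})))"
    proof (rule O.P.finite_measure_mono)
      show "(\<Union>t\<in>{t. Node {#t#} \<in> B}. E \<inter> shape_event t) \<subseteq> E - (E \<inter> shape_event (Node {#}))"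
      proof
        fix \<omega> assume "\<omega> \<in> (\<Union>t\<in>{t. Node {#t#} \<in> B}. E \<inter> shape_event t)"
        then obtain t where t: "Node {#t#} \<in> B" "\<omega> \<in> E" "\<omega> \<in> shape_event t" by blast
        then have "t \<noteq> Node {#}" using that by auto
        then show "\<omega> \<in> E - (E \<inter> shape_event (Node {#}))"
          using shape_event_disjoint[of t "Node {#}"] t by blast
      qed
    qed (use E_sets in auto)
    also have "\<dots> = p - shape_prob (Node {#})"
      unfolding p_def shape_prob_def by (rule O.P.finite_measure_Diff) (use E_sets in auto)
    finally show ?thesis
      unfolding shape_law_single unfolding shape_law_eq using p_pos by (simp add: field_simps)
  qed
qed

end

section \<open>Both limits, along the indices with survival probability below 1\<close>

theorem theorem10:
  fixes q :: "nat pmf" and lam :: real and H :: "nat \<Rightarrow> point rooted set"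
  defines "P \<equiv> gw_space q lam"
    and "T \<equiv> random_tree"
    and "R \<equiv> iterated_reduction H"
  assumes "pmf q 1 = 0" and "lam > 0"
    and "mean_offspring q \<le> 1"
    and "\<And>n. n \<ge> 1 \<Longrightarrow> hereditary (H n)"
    and "(\<lambda>n. \<P>(\<omega> in P. \<not> is_empty_tree (R n (T \<omega>)))) \<longlonglongrightarrow> 0"
    and "\<And>n. n \<ge> 1 \<Longrightarrow> \<P>(\<omega> in P. \<not> is_empty_tree (R n (T \<omega>))) > 0"
  shows
    "(critical q \<and>
      (\<exists>c. ((\<lambda>x. (pgf q x - x) / ((1 - x) * (1 - deriv (pgf q) x))) \<longlongrightarrow> c) (at_left 1)) \<longrightarrow>
      (\<exists>L. ((\<lambda>x. ln (g_fun q x) / (- ln (1 - x))) \<longlongrightarrow> L) (at_left 1) \<and>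
        (\<forall>\<tau>\<in>planted_trees.
          (\<lambda>n. \<P>(\<omega> in P. shape (R n (T \<omega>)) = \<tau> \<bar> \<not> is_empty_tree (R n (T \<omega>))))
            \<longlonglongrightarrow> measure (IGW (1 / (2 - L))) {\<tau>}))) \<and>
     (subcritical q \<longrightarrow>
        (\<forall>B\<subseteq>planted_trees.
          (\<lambda>n. \<P>(\<omega> in P. shape (R n (T \<omega>)) \<in> B \<bar> \<not> is_empty_tree (R n (T \<omega>))))
            \<longlonglongrightarrow> measure (GW (return_pmf 0)) B))"
proof -
  interpret Q: offspring_law q by unfold_locales fact+
  define \<pi> where "\<pi> n = \<P>(\<omega> in P. \<not> is_empty_tree (R n (T \<omega>)))" for n
  have "eventually (\<lambda>n. \<pi> n < 1) sequentially"
    using assms(8) unfolding \<pi>_def by (rule order_tendstoD) simp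
  then obtain N0 where N0: "\<And>n. n \<ge> N0 \<Longrightarrow> \<pi> n < 1" by (auto simp: eventually_sequentially)
  \<comment> \<open>The asymptotic results take a survival probability strictly between 0 and 1; it
    is below 1 from \<open>N0\<close> on and positive from index 1 on.\<close>
  define N where "N = Suc N0"
  have \<pi>: "(\<lambda>n. \<pi> (n + N)) \<longlonglongrightarrow> 0" "\<And>n. 0 < \<pi> (n + N)" "\<And>n. \<pi> (n + N) < 1"
    using LIMSEQ_ignore_initial_segment[OF assms(8), of N] assms(9) N0 by (auto simp: \<pi>_def N_def)
  define law where "law n B = \<P>(\<omega> in P. shape (R n (T \<omega>)) \<in> B \<bar> \<not> is_empty_tree (R n (T \<omega>)))" for n B
  have loc: "reduced_random_tree q lam H (n + N)" for n
    by unfold_locales (use assms(5,7) \<pi>(2)[of n] in \<open>simp_all add: \<pi>_def P_def T_def R_def\<close>)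
  have law_eq: "law (n + N) = reduced_random_tree.shape_law q lam H (n + N)" for n
    using reduced_random_tree.shape_law_def[OF loc[of n]] by (simp add: law_def fun_eq_iff P_def T_def R_def)
  have p_eq: "reduced_random_tree.p q lam H (n + N) = \<pi> (n + N)" for n
    unfolding reduced_random_tree.p_def[OF loc] reduced_random_tree.E_eq[OF loc]
      reduced_random_tree.gw_space_eq[OF loc, symmetric] by (simp add: \<pi>_def P_def T_def R_def)
  have law_Node: "law (n + N) {Node {#Node M#}} = real (card (arrangements {..<size M} M)) *
      (\<Prod>t\<in>#M. law (n + N) {Node {#t#}}) * Q.pruned_weight (\<pi> (n + N)) (size M)" if "size M \<noteq> 1" for n M
    unfolding law_eq p_eq[symmetric] by (rule reduced_random_tree.shape_law_Node[OF loc that])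
  show ?thesis
  proof (intro conjI impI)
    assume "critical q \<and>
      (\<exists>c. ((\<lambda>x. (pgf q x - x) / ((1 - x) * (1 - deriv (pgf q) x))) \<longlongrightarrow> c) (at_left 1))"
    then obtain c where crit: "critical q"
      and c: "((\<lambda>x. (pgf q x - x) / ((1 - x) * (1 - deriv (pgf q) x))) \<longlongrightarrow> c) (at_left 1)" by blast
    interpret critical_law q c
    proof
      show "Q.\<mu> = 1" using crit by (simp add: Q.critical_iff)
      have "eventually (\<lambda>x. 0 < x \<and> x < 1) (at_left (1 :: real))"
        using eventually_at_left_real[of 0 "1 :: real"] by (auto elim: eventually_mono)
      then have "eventually (\<lambda>x. (pgf q x - x) / ((1 - x) * (1 - deriv (pgf q) x)) =
          Q.excess x / ((1 - x) * Q.slope x)) (at_left 1)"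
        by eventually_elim (simp add: Q.excess_def Q.slope_def deriv_pgf)
      then show "((\<lambda>x. Q.excess x / ((1 - x) * Q.slope x)) \<longlongrightarrow> c) (at_left 1)"
        by (rule Lim_transform_eventually[OF c])
    qed
    \<comment> \<open>Inserting \<open>L = 2 - 1 / c\<close> into \<open>1 / (2 - L)\<close> gives
      back c.\<close>
    have igw: "IGW (1 / (2 - (2 - 1 / c))) = GW (igw_offspring c)"
      using c_ge_half by (simp add: IGW_def)
    have "(\<lambda>n. \<P>(\<omega> in P. shape (R n (T \<omega>)) = \<tau> \<bar> \<not> is_empty_tree (R n (T \<omega>))))
            \<longlonglongrightarrow> measure (IGW (1 / (2 - (2 - 1 / c)))) {\<tau>}" if \<tau>: "\<tau> \<in> planted_trees" for \<tau>
    proof -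
      have "(\<lambda>n. law (n + N) {\<tau>}) \<longlonglongrightarrow> measure (GW (igw_offspring c)) {\<tau>}"
      proof (cases "\<tau> = Node {#}")
        \<comment> \<open>A surviving tree never has the empty shape, and under the limit measure
          the empty tree stands for an infinite family, which has probability 0.\<close>
        case True
        have "law (n + N) {\<tau>} = 0" for n
          unfolding law_eq True by (rule reduced_random_tree.shape_law_empty[OF loc])
        then show ?thesis using GW_empty[of "igw_offspring c"] igw_limit(2)[OF \<pi>] True by simp
      next
        case False
        then obtain t where t: "\<tau> = Node {#t#}" "reduced t" using \<tau> by (auto simp: planted_trees_def)
        have "(\<lambda>n. law (n + N) {Node {#t#}}) \<longlonglongrightarrow> GW_prob (igw_offspring c) t"
          by (rule shape_law_tendsto[where w = "\<lambda>n. Q.pruned_weight (\<pi> (n + N))" and f = "\<lambda>n t. law (n + N) {Node {#t#}}"])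
             (use law_Node igw_limit(1)[OF \<pi>] t in auto)
        then show ?thesis using t by (simp add: GW_prob_def)
      qed
      then have "(\<lambda>n. law n {\<tau>}) \<longlonglongrightarrow> measure (GW (igw_offspring c)) {\<tau>}" by (rule LIMSEQ_offset)
      then show ?thesis unfolding igw by (simp add: law_def)
    qed
    then show "\<exists>L. ((\<lambda>x. ln (g_fun q x) / (- ln (1 - x))) \<longlongrightarrow> L) (at_left 1) \<and>
        (\<forall>\<tau>\<in>planted_trees.
          (\<lambda>n. \<P>(\<omega> in P. shape (R n (T \<omega>)) = \<tau> \<bar> \<not> is_empty_tree (R n (T \<omega>))))
            \<longlonglongrightarrow> measure (IGW (1 / (2 - L))) {\<tau>})"
      using ln_g_fun_tendsto by blast
  next
    assume "subcritical q"
    then have \<mu>: "Q.\<mu> < 1" by (simp add: Q.subcritical_iff)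
    let ?leaf = "Node {#Node {#}#}"
    have leaf: "(\<lambda>n. law (n + N) {?leaf}) \<longlonglongrightarrow> 1"
    proof -
      have "law (n + N) {?leaf} = Q.pruned_weight (\<pi> (n + N)) 0" for n
        using law_Node[of "{#}" n] by (simp add: arrangements_def)
      then show ?thesis using Q.pruned_weight_0_subcritical[OF \<mu> \<pi>] by simp
    qed
    interpret G: prob_space "GW (return_pmf 0)"
      unfolding GW_def
      by (rule prob_space.prob_space_distr[OF _ measurable_planted_tree])
         (rule prob_space_PiM, rule measure_pmf.prob_space_axioms)
    have "measure (GW (return_pmf 0)) {?leaf} = 1"
      using GW_prob_Node[of "return_pmf 0" "{#}"] by (simp add: GW_prob_def arrangements_def)
    then have ae: "AE x in GW (return_pmf 0). x = ?leaf"
      using G.prob_eq_1[of "{?leaf}"] by (simp add: GW_def)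
    have sG: "B \<in> sets (GW (return_pmf 0))" for B by (simp add: GW_def)
    have meas: "measure (GW (return_pmf 0)) B = (if ?leaf \<in> B then 1 else 0)" for B
    proof (cases "?leaf \<in> B")
      case True
      then show ?thesis using G.prob_eq_1[OF sG[of B]] ae by (auto elim: eventually_mono)
    next
      case False
      then show ?thesis using G.prob_eq_0[OF sG[of B]] ae by (auto elim: eventually_mono)
    qed
    show "\<forall>B\<subseteq>planted_trees.
          (\<lambda>n. \<P>(\<omega> in P. shape (R n (T \<omega>)) \<in> B \<bar> \<not> is_empty_tree (R n (T \<omega>))))
            \<longlonglongrightarrow> measure (GW (return_pmf 0)) B"
    proof (intro allI impI)
      fix B :: "ctree set"
      have b: "?leaf \<in> B \<Longrightarrow> law (n + N) {?leaf} \<le> law (n + N) B" "law (n + N) B \<le> 1"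
        "?leaf \<notin> B \<Longrightarrow> law (n + N) B \<le> 1 - law (n + N) {?leaf}" "0 \<le> law (n + N) B" for n
        using reduced_random_tree.shape_law_bounds[OF loc[of n]] unfolding law_eq by simp_all
      have "(\<lambda>n. law (n + N) B) \<longlonglongrightarrow> measure (GW (return_pmf 0)) B"
      proof (cases "?leaf \<in> B")
        case True
        have "(\<lambda>n. law (n + N) B) \<longlonglongrightarrow> 1"
          by (rule tendsto_sandwich[OF _ _ leaf tendsto_const]) (use b True in auto)
        then show ?thesis using True meas by simp
      next
        case False
        have "(\<lambda>n. 1 - law (n + N) {?leaf}) \<longlonglongrightarrow> 1 - 1" by (intro tendsto_intros leaf)
        then have z: "(\<lambda>n. 1 - law (n + N) {?leaf}) \<longlonglongrightarrow> 0" by simp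
        have "(\<lambda>n. law (n + N) B) \<longlonglongrightarrow> 0"
          by (rule tendsto_sandwich[OF _ _ tendsto_const z]) (use b False in auto)
        then show ?thesis using False meas by simp
      qed
      then have "(\<lambda>n. law n B) \<longlonglongrightarrow> measure (GW (return_pmf 0)) B" by (rule LIMSEQ_offset)
      then show "(\<lambda>n. \<P>(\<omega> in P. shape (R n (T \<omega>)) \<in> B \<bar> \<not> is_empty_tree (R n (T \<omega>))))
            \<longlonglongrightarrow> measure (GW (return_pmf 0)) B" by (simp add: law_def)
    qed
  qed
qed

end
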